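(* The theory $\mathbf{Q}$ (and hence also $\mathbf{Q}^{\mathrm{wo}}$) inherits the $\mu$-operator of $\widehat{\mathbf{PR_a}}$: for every $\mathbf{PR_a}$-predicate $\varphi=\varphi(a,n):A\times\mathbb{N}\to 2$, $$\mathbf{Q}\vdash\ \mu^{\mathbf{PR_a}}\varphi=\mu^{\mathbf{PR_a}}\{n\,|\,\varphi(a,n)\}\ \mathrel{\hat=}\ \mu^{\mathbf{Q}}\{n\,|\,\varphi(a,n)\}:A\rightharpoonup\mathbb{N},$$ where $\mu^{\mathbf{Q}}\{n\,|\,\varphi(a,n)\}=\min\{n'\,|\,\varphi(a,n')\}$ if $\exists n\,\varphi(a,n)$, and it is undefined if $\forall n\,\neg\varphi(a,n)$. The equality is equality of partial maps in $\widehat{\mathbf{Q}}$.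
   Context: $\mathbf{PR_a}$ is the categorical (free-variables, equational) theory of primitive recursion with predicate abstraction. Its objects are finite powers of $\mathbb{N}$ and the objects $\{A\,|\,\chi\}$ defined by primitive recursive predicates $\chi:A\to 2$. Its maps are primitive recursive map terms modulo derivable equality (on the defining predicate). For a theory $\mathbf{S}$ extending $\mathbf{PR_a}$, $\widehat{\mathbf{S}}$ is the theory of partial maps over $\mathbf{S}$. A partial map $f:A\rightharpoonup B$ is given by $\mathbf{S}$-maps $d_f:D_f\to A$ and $\widehat f:D_f\to B$ that are right-unique: $d_f(\hat a)=d_f(\hat a')\Rightarrow\widehat f(\hat a)=\widehat f(\hat a')$ is derivable. $f\mathrel{\hat=}g$ means that there are $\mathbf{S}$-maps $i:D_f\to D_g$ and $j:D_g\to D_f$ with $d_g i=d_f$, $\widehat g i=\widehat f$, $d_f j=d_g$, $\widehat f j=\widehat g$. $\mu^{\mathbf{PR_a}}\varphi:A\rightharpoonup\mathbb{N}$ is the partial map of $\widehat{\mathbf{PR_a}}$ with $D=\{(a,n)\in A\times\mathbb{N}\,|\,\varphi(a,n)\}$, $d(a,n)=a$, and rule $(a,n)\mapsto\min\{n'\le n\,|\,\varphi(a,n')\}$. $\mathbf{Q}=\mathbf{PR_a}+\forall\exists!$ is the Cartesian extension of $\mathbf{PR_a}$ by classical quantification. For predicates $\varphi:A\times B\to 2$ there are (total) predicates $\exists_b\varphi(a,b),\forall_b\varphi(a,b):A\to 2$ with the usual properties, and the following hold: (1) the quantified law of excluded middle, $\mathbf{Q}\vdash[\forall_b\varphi(a,b)\vee\exists_b\neg\varphi(a,b)]=\mathrm{true}_A$;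 (2) map definition by unique existence: if $\mathbf{Q}\vdash(\forall a\in A)(\exists! b\in B)\varphi(a,b)$, then there is a unique $\mathbf{Q}$-map $f_\varphi:A\to B$ with $\mathbf{Q}\vdash[f_\varphi(a)\doteq_B b]=\varphi(a,b):A\times B\to 2$, where $\doteq_B$ is the equality predicate on $B$. Objects $\{a\in A\,|\,\psi(a)\}$ for $\mathbf{Q}$-predicates $\psi:A\to2$, such as $\{a\in A\,|\,\exists n\,\varphi(a,n)\}$, are available. As a partial map over $\mathbf{Q}$, $\mu^{\mathbf{Q}}\varphi$ is given by the inclusion $\{a\in A\,|\,\exists n\,\varphi(a,n)\}\subseteq A$ and the rule $a\mapsto\min\{n'\,|\,\varphi(a,n')\}$. $\mathbf{Q}^{\mathrm{wo}}=\mathbf{Q}+\mathrm{wo}(\omega^\omega)$ is $\mathbf{Q}$ with the additional axiom that the lexicographical order on $\omega^\omega$ ($=\mathbb{N}^*$, containing $\mathbb{N}[\omega]$, the coefficient strings of polynomials in $\omega$) is a well-order. *)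

theory Defs
  imports Main
begin

text \<open>
  The theories are presented as typed equational calculi of categorical map terms (no variables;
  a context is an object, variables are projections).  Composition \<open>g \<odot> f\<close> is ``\<open>g\<close> after \<open>f\<close>''.

  The object \<open>2\<close> is \<open>{0,1} \<subseteq> \<nat>\<close>: a predicate \<open>\<chi> : A \<rightarrow> 2\<close> is a map \<open>\<chi> : A \<rightarrow> \<nat>\<close> with
  \<open>sgn \<circ> \<chi> = \<chi>\<close>, the truth value \<open>true\<close> being \<open>1\<close>.
\<close>

datatype obj =
    One | Nat | Prod obj obj (infixr "\<^bold>\<times>" 75)
  | Sub obj trm  \<comment> \<open>\<open>{A | \<chi>}\<close>\<close>
and trm =
    Id obj
  | Comp trm trm (infixr "\<odot>" 70)
  | Bang obj
  | Fst obj obj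
  | Snd obj obj
  | Pair trm trm ("\<^bold>\<langle>_, _\<^bold>\<rangle>")
  | Zero
  | Succ
  | Iter trm          \<comment> \<open>\<open>f\<^sup>\<section> : A \<times> \<nat> \<rightarrow> A\<close> for \<open>f : A \<rightarrow> A\<close>\<close>
  | Incl obj trm      \<comment> \<open>\<open>{A | \<chi>} \<rightarrow> A\<close>\<close>
  | Lift obj trm trm  \<comment> \<open>\<open>f : C \<rightarrow> A\<close> with \<open>\<chi> \<circ> f = true\<close>, as a map \<open>C \<rightarrow> {A | \<chi>}\<close>\<close>
  | Ex obj obj trm    \<comment> \<open>\<open>\<exists>\<^sub>b \<phi>(a,b) : A \<rightarrow> 2\<close> for \<open>\<phi> : A \<times> B \<rightarrow> 2\<close>\<close>
  | All obj obj trm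
  | Desc obj obj trm  \<comment> \<open>\<open>f\<^sub>\<phi> : A \<rightarrow> B\<close> for \<open>\<phi> : A \<times> B \<rightarrow> 2\<close>\<close>

section \<open>Primitive recursive arithmetic and logic\<close>

definition zero :: "obj \<Rightarrow> trm" where
  "zero A = Zero \<odot> Bang A"

definition true :: "obj \<Rightarrow> trm" where
  "true A = Succ \<odot> zero A"

text \<open>\<open>f \<times> g : A \<times> B \<rightarrow> A' \<times> B'\<close>; the objects are the domains of \<open>f\<close> and \<open>g\<close>.\<close>

definition cross :: "obj \<Rightarrow> obj \<Rightarrow> trm \<Rightarrow> trm \<Rightarrow> trm" where
  "cross A B f g = \<^bold>\<langle>f \<odot> Fst A B, g \<odot> Snd A B\<^bold>\<rangle>"

definition add :: trm where
  "add = Iter Succ"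

text \<open>Second component of the \<open>n\<close>-fold iteration of \<open>(x,y) \<mapsto> (x+1,x)\<close> from \<open>(0,0)\<close>.\<close>

definition pre :: trm where
  "pre = Snd Nat Nat \<odot> Iter \<^bold>\<langle>Succ \<odot> Fst Nat Nat, Fst Nat Nat\<^bold>\<rangle>
           \<odot> \<^bold>\<langle>\<^bold>\<langle>zero Nat, zero Nat\<^bold>\<rangle>, Id Nat\<^bold>\<rangle>"

definition monus :: trm where
  "monus = Iter pre"

text \<open>Second component of the \<open>n\<close>-fold iteration of \<open>(m,x) \<mapsto> (m,x+m)\<close> from \<open>(m,0)\<close>.\<close>

definition mult :: trm where
  "mult = Snd Nat Nat
      \<odot> Iter \<^bold>\<langle>Fst Nat Nat, add \<odot> \<^bold>\<langle>Snd Nat Nat, Fst Nat Nat\<^bold>\<rangle>\<^bold>\<rangle>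
      \<odot> \<^bold>\<langle>\<^bold>\<langle>Fst Nat Nat, zero (Nat \<^bold>\<times> Nat)\<^bold>\<rangle>, Snd Nat Nat\<^bold>\<rangle>"

definition nott :: trm where
  "nott = monus \<odot> \<^bold>\<langle>true Nat, Id Nat\<^bold>\<rangle>"

definition sgnt :: trm where
  "sgnt = nott \<odot> nott"

definition neg :: "trm \<Rightarrow> trm" ("\<^bold>\<not> _" [60] 60) where
  "\<^bold>\<not> f = nott \<odot> f"

definition conj :: "trm \<Rightarrow> trm \<Rightarrow> trm" (infixr "\<^bold>\<and>" 55) where
  "f \<^bold>\<and> g = sgnt \<odot> mult \<odot> \<^bold>\<langle>f, g\<^bold>\<rangle>"

definition disj :: "trm \<Rightarrow> trm \<Rightarrow> trm" (infixr "\<^bold>\<or>" 53) where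
  "f \<^bold>\<or> g = sgnt \<odot> add \<odot> \<^bold>\<langle>f, g\<^bold>\<rangle>"

definition impl :: "trm \<Rightarrow> trm \<Rightarrow> trm" (infixr "\<^bold>\<longrightarrow>" 52) where
  "(f \<^bold>\<longrightarrow> g) = (\<^bold>\<not> f \<^bold>\<or> g)"

definition leq :: "trm \<Rightarrow> trm \<Rightarrow> trm" (infix "\<^bold>\<le>" 62) where
  "f \<^bold>\<le> g = nott \<odot> monus \<odot> \<^bold>\<langle>f, g\<^bold>\<rangle>"

definition less :: "trm \<Rightarrow> trm \<Rightarrow> trm" (infix "\<^bold>\<prec>" 62) where
  "f \<^bold>\<prec> g = Succ \<odot> f \<^bold>\<le> g"

text \<open>The equality predicate \<open>\<doteq>\<^sub>B : B \<times> B \<rightarrow> 2\<close>.\<close>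

fun eqp :: "obj \<Rightarrow> trm" where
  "eqp One = true (One \<^bold>\<times> One)"
| "eqp Nat = (Fst Nat Nat \<^bold>\<le> Snd Nat Nat \<^bold>\<and> Snd Nat Nat \<^bold>\<le> Fst Nat Nat)"
| "eqp (A \<^bold>\<times> B) =
     (let P = A \<^bold>\<times> B in
        eqp A \<odot> cross P P (Fst A B) (Fst A B) \<^bold>\<and> eqp B \<odot> cross P P (Snd A B) (Snd A B))"
| "eqp (Sub A \<chi>) = eqp A \<odot> cross (Sub A \<chi>) (Sub A \<chi>) (Incl A \<chi>) (Incl A \<chi>)"

definition equ :: "obj \<Rightarrow> trm \<Rightarrow> trm \<Rightarrow> trm" where
  "equ B f g = eqp B \<odot> \<^bold>\<langle>f, g\<^bold>\<rangle>"

text \<open>\<open>\<exists>!b \<phi>(a,b)\<close> as \<open>\<exists>b (\<phi>(a,b) \<and> \<forall>b' (\<phi>(a,b') \<Rightarrow> b' \<doteq> b))\<close>; the inner context is \<open>(A \<times> B) \<times> B\<close>.\<close>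

definition Ex1 :: "obj \<Rightarrow> obj \<Rightarrow> trm \<Rightarrow> trm" where
  "Ex1 A B \<phi> =
     (let X = (A \<^bold>\<times> B) \<^bold>\<times> B;
          a = Fst A B \<odot> Fst (A \<^bold>\<times> B) B; b = Snd A B \<odot> Fst (A \<^bold>\<times> B) B; b' = Snd (A \<^bold>\<times> B) B
      in Ex A B (\<phi> \<^bold>\<and> All (A \<^bold>\<times> B) B (\<phi> \<odot> \<^bold>\<langle>a, b'\<^bold>\<rangle> \<^bold>\<longrightarrow> equ B b' b)))"

section \<open>The order on \<open>\<omega>\<^sup>\<omega>\<close>\<close>

text \<open>
  Strings of natural numbers are coded bijectively by natural numbers: \<open>0\<close> is the empty string and
  \<open>1 + c(a,l)\<close> is the string with first entry \<open>a\<close> and remaining string \<open>l\<close>, where \<open>c\<close> is Cantor's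
  pairing, i.e. the inverse of the enumeration of \<open>\<nat> \<times> \<nat>\<close> obtained by iterating
  \<open>(x,y) \<mapsto> (if y = 0 then (0,x+1) else (x+1,y-1))\<close> from \<open>(0,0)\<close>.
  Entry \<open>i\<close> is the coefficient of \<open>\<omega>\<^sup>i\<close>.
\<close>

definition unpair :: trm where
  "unpair =
     (let x = Fst Nat Nat; y = Snd Nat Nat in
      Iter \<^bold>\<langle>mult \<odot> \<^bold>\<langle>sgnt \<odot> y, Succ \<odot> x\<^bold>\<rangle>,
            add \<odot> \<^bold>\<langle>mult \<odot> \<^bold>\<langle>nott \<odot> y, Succ \<odot> x\<^bold>\<rangle>, pre \<odot> y\<^bold>\<rangle>\<^bold>\<rangle>
        \<odot> \<^bold>\<langle>\<^bold>\<langle>zero Nat, zero Nat\<^bold>\<rangle>, Id Nat\<^bold>\<rangle>)"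

definition head :: trm where
  "head = Fst Nat Nat \<odot> unpair \<odot> pre"

definition tail :: trm where
  "tail = Snd Nat Nat \<odot> unpair \<odot> pre"

text \<open>The string \<open>x\<close> without its first \<open>i\<close> entries; it is nonzero iff \<open>i < length x\<close>.\<close>

definition dropt :: "trm \<Rightarrow> trm \<Rightarrow> trm" where
  "dropt x i = Iter tail \<odot> \<^bold>\<langle>x, i\<^bold>\<rangle>"

definition coef :: "trm \<Rightarrow> trm \<Rightarrow> trm" where
  "coef x i = head \<odot> dropt x i"

text \<open>
  For \<open>x, y : X \<rightarrow> \<nat>\<close>: the string \<open>x\<close> is shorter than \<open>y\<close>, or they have the same length and \<open>x\<close> is
  smaller at the highest place where they differ.  Variable \<open>i\<close> lives in \<open>X \<times> \<nat>\<close>, variable \<open>j\<close> in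
  \<open>(X \<times> \<nat>) \<times> \<nat>\<close>.
\<close>

definition lexless :: "obj \<Rightarrow> trm \<Rightarrow> trm \<Rightarrow> trm" where
  "lexless X x y =
     (let Y = X \<^bold>\<times> Nat;
          x' = x \<odot> Fst X Nat; y' = y \<odot> Fst X Nat; i = Snd X Nat;
          x'' = x' \<odot> Fst Y Nat; y'' = y' \<odot> Fst Y Nat; i' = i \<odot> Fst Y Nat; j = Snd Y Nat
      in Ex X Nat (\<^bold>\<not> dropt x' i \<^bold>\<and> sgnt \<odot> dropt y' i)
         \<^bold>\<or> (All X Nat (equ Nat (sgnt \<odot> dropt x' i) (sgnt \<odot> dropt y' i))
            \<^bold>\<and> Ex X Nat (coef x' i \<^bold>\<prec> coef y' i
                 \<^bold>\<and> All Y Nat (i' \<^bold>\<prec> j \<^bold>\<longrightarrow> equ Nat (coef x'' j) (coef y'' j)))))"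

definition lexleq :: "obj \<Rightarrow> trm \<Rightarrow> trm \<Rightarrow> trm" where
  "lexleq X x y = (lexless X x y \<^bold>\<or> equ Nat x y)"

text \<open>For \<open>\<chi> : A \<times> \<omega>\<^sup>\<omega> \<rightarrow> 2\<close>: if \<open>{x | \<chi>(a,x)}\<close> is nonempty, it has a least element.\<close>

definition least_element :: "obj \<Rightarrow> trm \<Rightarrow> trm" where
  "least_element A \<chi> =
     (let Y = A \<^bold>\<times> Nat; a = Fst A Nat \<odot> Fst Y Nat; x = Snd A Nat \<odot> Fst Y Nat; y = Snd Y Nat
      in Ex A Nat \<chi> \<^bold>\<longrightarrow>
         Ex A Nat (\<chi> \<^bold>\<and> All Y Nat (\<chi> \<odot> \<^bold>\<langle>a, y\<^bold>\<rangle> \<^bold>\<longrightarrow> lexleq (Y \<^bold>\<times> Nat) x y)))"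

section \<open>Derivability\<close>

datatype thy = PRa | Q | Qwo

text \<open>
  \<open>eq_Sub\<close> is the defining clause of predicate abstraction: two maps on \<open>{A | \<chi>}\<close> are equal iff they
  are equal under the hypothesis \<open>\<chi>\<close>.
  \<open>eq_Iter_unique\<close> is Freyd's uniqueness of the initialised iterated.
\<close>

inductive
  ob :: "thy \<Rightarrow> obj \<Rightarrow> bool" ("_ \<turnstile>\<^sub>o _" [51, 51] 50) and
  arr :: "thy \<Rightarrow> trm \<Rightarrow> obj \<Rightarrow> obj \<Rightarrow> bool" ("_ \<turnstile> _ \<Colon> _ \<rightarrow> _" [51, 51, 51, 51] 50) and
  prd :: "thy \<Rightarrow> trm \<Rightarrow> obj \<Rightarrow> bool" ("_ \<turnstile> _ \<Colon> _ \<rightarrow> \<two>" [51, 51, 51] 50) and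
  eqv :: "thy \<Rightarrow> trm \<Rightarrow> trm \<Rightarrow> obj \<Rightarrow> obj \<Rightarrow> bool"
    ("_ \<turnstile> _ \<approx> _ \<Colon> _ \<rightarrow> _" [51, 51, 51, 51, 51] 50)
  for T :: thy
where
  ob_One: "T \<turnstile>\<^sub>o One"
| ob_Nat: "T \<turnstile>\<^sub>o Nat"
| ob_Prod: "\<lbrakk>T \<turnstile>\<^sub>o A; T \<turnstile>\<^sub>o B\<rbrakk> \<Longrightarrow> T \<turnstile>\<^sub>o A \<^bold>\<times> B"
| ob_Sub: "\<lbrakk>T \<turnstile>\<^sub>o A; T \<turnstile> \<chi> \<Colon> A \<rightarrow> \<two>\<rbrakk> \<Longrightarrow> T \<turnstile>\<^sub>o Sub A \<chi>"

| prd: "\<lbrakk>T \<turnstile> \<chi> \<Colon> A \<rightarrow> Nat; T \<turnstile> sgnt \<odot> \<chi> \<approx> \<chi> \<Colon> A \<rightarrow> Nat\<rbrakk> \<Longrightarrow> T \<turnstile> \<chi> \<Colon> A \<rightarrow> \<two>"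

| arr_Id: "T \<turnstile>\<^sub>o A \<Longrightarrow> T \<turnstile> Id A \<Colon> A \<rightarrow> A"
| arr_Comp: "\<lbrakk>T \<turnstile> f \<Colon> A \<rightarrow> B; T \<turnstile> g \<Colon> B \<rightarrow> C\<rbrakk> \<Longrightarrow> T \<turnstile> g \<odot> f \<Colon> A \<rightarrow> C"
| arr_Bang: "T \<turnstile>\<^sub>o A \<Longrightarrow> T \<turnstile> Bang A \<Colon> A \<rightarrow> One"
| arr_Fst: "\<lbrakk>T \<turnstile>\<^sub>o A; T \<turnstile>\<^sub>o B\<rbrakk> \<Longrightarrow> T \<turnstile> Fst A B \<Colon> A \<^bold>\<times> B \<rightarrow> A"
| arr_Snd: "\<lbrakk>T \<turnstile>\<^sub>o A; T \<turnstile>\<^sub>o B\<rbrakk> \<Longrightarrow> T \<turnstile> Snd A B \<Colon> A \<^bold>\<times> B \<rightarrow> B"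
| arr_Pair: "\<lbrakk>T \<turnstile> f \<Colon> C \<rightarrow> A; T \<turnstile> g \<Colon> C \<rightarrow> B\<rbrakk> \<Longrightarrow> T \<turnstile> \<^bold>\<langle>f, g\<^bold>\<rangle> \<Colon> C \<rightarrow> A \<^bold>\<times> B"
| arr_Zero: "T \<turnstile> Zero \<Colon> One \<rightarrow> Nat"
| arr_Succ: "T \<turnstile> Succ \<Colon> Nat \<rightarrow> Nat"
| arr_Iter: "T \<turnstile> f \<Colon> A \<rightarrow> A \<Longrightarrow> T \<turnstile> Iter f \<Colon> A \<^bold>\<times> Nat \<rightarrow> A"
| arr_Incl: "\<lbrakk>T \<turnstile>\<^sub>o A; T \<turnstile> \<chi> \<Colon> A \<rightarrow> \<two>\<rbrakk> \<Longrightarrow> T \<turnstile> Incl A \<chi> \<Colon> Sub A \<chi> \<rightarrow> A"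
| arr_Lift: "\<lbrakk>T \<turnstile> \<chi> \<Colon> A \<rightarrow> \<two>; T \<turnstile> f \<Colon> C \<rightarrow> A; T \<turnstile> \<chi> \<odot> f \<approx> true C \<Colon> C \<rightarrow> Nat\<rbrakk>
    \<Longrightarrow> T \<turnstile> Lift A \<chi> f \<Colon> C \<rightarrow> Sub A \<chi>"

| eq_refl: "T \<turnstile> f \<Colon> A \<rightarrow> B \<Longrightarrow> T \<turnstile> f \<approx> f \<Colon> A \<rightarrow> B"
| eq_sym: "T \<turnstile> f \<approx> g \<Colon> A \<rightarrow> B \<Longrightarrow> T \<turnstile> g \<approx> f \<Colon> A \<rightarrow> B"
| eq_trans: "\<lbrakk>T \<turnstile> f \<approx> g \<Colon> A \<rightarrow> B; T \<turnstile> g \<approx> h \<Colon> A \<rightarrow> B\<rbrakk> \<Longrightarrow> T \<turnstile> f \<approx> h \<Colon> A \<rightarrow> B"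
| eq_Comp: "\<lbrakk>T \<turnstile> f \<approx> f' \<Colon> A \<rightarrow> B; T \<turnstile> g \<approx> g' \<Colon> B \<rightarrow> C\<rbrakk> \<Longrightarrow> T \<turnstile> g \<odot> f \<approx> g' \<odot> f' \<Colon> A \<rightarrow> C"
| eq_assoc: "\<lbrakk>T \<turnstile> f \<Colon> A \<rightarrow> B; T \<turnstile> g \<Colon> B \<rightarrow> C; T \<turnstile> h \<Colon> C \<rightarrow> D\<rbrakk>
    \<Longrightarrow> T \<turnstile> (h \<odot> g) \<odot> f \<approx> h \<odot> (g \<odot> f) \<Colon> A \<rightarrow> D"
| eq_Id_right: "T \<turnstile> f \<Colon> A \<rightarrow> B \<Longrightarrow> T \<turnstile> f \<odot> Id A \<approx> f \<Colon> A \<rightarrow> B"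
| eq_Id_left: "T \<turnstile> f \<Colon> A \<rightarrow> B \<Longrightarrow> T \<turnstile> Id B \<odot> f \<approx> f \<Colon> A \<rightarrow> B"
| eq_Bang: "T \<turnstile> f \<Colon> A \<rightarrow> One \<Longrightarrow> T \<turnstile> f \<approx> Bang A \<Colon> A \<rightarrow> One"
| eq_Fst: "\<lbrakk>T \<turnstile> f \<Colon> C \<rightarrow> A; T \<turnstile> g \<Colon> C \<rightarrow> B\<rbrakk> \<Longrightarrow> T \<turnstile> Fst A B \<odot> \<^bold>\<langle>f, g\<^bold>\<rangle> \<approx> f \<Colon> C \<rightarrow> A"
| eq_Snd: "\<lbrakk>T \<turnstile> f \<Colon> C \<rightarrow> A; T \<turnstile> g \<Colon> C \<rightarrow> B\<rbrakk> \<Longrightarrow> T \<turnstile> Snd A B \<odot> \<^bold>\<langle>f, g\<^bold>\<rangle> \<approx> g \<Colon> C \<rightarrow> B"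
| eq_Pair: "\<lbrakk>T \<turnstile> h \<Colon> C \<rightarrow> A \<^bold>\<times> B; T \<turnstile> Fst A B \<odot> h \<approx> f \<Colon> C \<rightarrow> A; T \<turnstile> Snd A B \<odot> h \<approx> g \<Colon> C \<rightarrow> B\<rbrakk>
    \<Longrightarrow> T \<turnstile> h \<approx> \<^bold>\<langle>f, g\<^bold>\<rangle> \<Colon> C \<rightarrow> A \<^bold>\<times> B"
| eq_Iter_zero: "T \<turnstile> f \<Colon> A \<rightarrow> A \<Longrightarrow> T \<turnstile> Iter f \<odot> \<^bold>\<langle>Id A, zero A\<^bold>\<rangle> \<approx> Id A \<Colon> A \<rightarrow> A"
| eq_Iter_Succ: "T \<turnstile> f \<Colon> A \<rightarrow> A
    \<Longrightarrow> T \<turnstile> Iter f \<odot> cross A Nat (Id A) Succ \<approx> f \<odot> Iter f \<Colon> A \<^bold>\<times> Nat \<rightarrow> A"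
| eq_Iter_unique: "\<lbrakk>T \<turnstile> f \<Colon> A \<rightarrow> B; T \<turnstile> g \<Colon> B \<rightarrow> B; T \<turnstile> h \<Colon> A \<^bold>\<times> Nat \<rightarrow> B;
      T \<turnstile> h \<odot> \<^bold>\<langle>Id A, zero A\<^bold>\<rangle> \<approx> f \<Colon> A \<rightarrow> B;
      T \<turnstile> h \<odot> cross A Nat (Id A) Succ \<approx> g \<odot> h \<Colon> A \<^bold>\<times> Nat \<rightarrow> B\<rbrakk>
    \<Longrightarrow> T \<turnstile> h \<approx> Iter g \<odot> cross A Nat f (Id Nat) \<Colon> A \<^bold>\<times> Nat \<rightarrow> B"

| eq_Incl: "\<lbrakk>T \<turnstile>\<^sub>o A; T \<turnstile> \<chi> \<Colon> A \<rightarrow> \<two>\<rbrakk>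
    \<Longrightarrow> T \<turnstile> \<chi> \<odot> Incl A \<chi> \<approx> true (Sub A \<chi>) \<Colon> Sub A \<chi> \<rightarrow> Nat"
| eq_Lift: "T \<turnstile> Lift A \<chi> f \<Colon> C \<rightarrow> Sub A \<chi> \<Longrightarrow> T \<turnstile> Incl A \<chi> \<odot> Lift A \<chi> f \<approx> f \<Colon> C \<rightarrow> A"
| eq_Incl_mono: "\<lbrakk>T \<turnstile> g \<Colon> C \<rightarrow> Sub A \<chi>; T \<turnstile> h \<Colon> C \<rightarrow> Sub A \<chi>;
      T \<turnstile> Incl A \<chi> \<odot> g \<approx> Incl A \<chi> \<odot> h \<Colon> C \<rightarrow> A\<rbrakk>
    \<Longrightarrow> T \<turnstile> g \<approx> h \<Colon> C \<rightarrow> Sub A \<chi>"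
| eq_Sub: "\<lbrakk>T \<turnstile> \<chi> \<Colon> A \<rightarrow> \<two>; T \<turnstile> f \<Colon> A \<rightarrow> B; T \<turnstile> g \<Colon> A \<rightarrow> B;
      T \<turnstile> (\<chi> \<^bold>\<longrightarrow> equ B f g) \<approx> true A \<Colon> A \<rightarrow> Nat\<rbrakk>
    \<Longrightarrow> T \<turnstile> f \<odot> Incl A \<chi> \<approx> g \<odot> Incl A \<chi> \<Colon> Sub A \<chi> \<rightarrow> B"
| eq_Sub_conv: "\<lbrakk>T \<turnstile> \<chi> \<Colon> A \<rightarrow> \<two>; T \<turnstile> f \<Colon> A \<rightarrow> B; T \<turnstile> g \<Colon> A \<rightarrow> B;
      T \<turnstile> f \<odot> Incl A \<chi> \<approx> g \<odot> Incl A \<chi> \<Colon> Sub A \<chi> \<rightarrow> B\<rbrakk>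
    \<Longrightarrow> T \<turnstile> (\<chi> \<^bold>\<longrightarrow> equ B f g) \<approx> true A \<Colon> A \<rightarrow> Nat"

| arr_Ex: "\<lbrakk>T \<noteq> PRa; T \<turnstile> \<phi> \<Colon> A \<^bold>\<times> B \<rightarrow> \<two>\<rbrakk> \<Longrightarrow> T \<turnstile> Ex A B \<phi> \<Colon> A \<rightarrow> Nat"
| sgn_Ex: "\<lbrakk>T \<noteq> PRa; T \<turnstile> \<phi> \<Colon> A \<^bold>\<times> B \<rightarrow> \<two>\<rbrakk> \<Longrightarrow> T \<turnstile> sgnt \<odot> Ex A B \<phi> \<approx> Ex A B \<phi> \<Colon> A \<rightarrow> Nat"
| arr_All: "\<lbrakk>T \<noteq> PRa; T \<turnstile> \<phi> \<Colon> A \<^bold>\<times> B \<rightarrow> \<two>\<rbrakk> \<Longrightarrow> T \<turnstile> All A B \<phi> \<Colon> A \<rightarrow> Nat"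
| sgn_All: "\<lbrakk>T \<noteq> PRa; T \<turnstile> \<phi> \<Colon> A \<^bold>\<times> B \<rightarrow> \<two>\<rbrakk>
    \<Longrightarrow> T \<turnstile> sgnt \<odot> All A B \<phi> \<approx> All A B \<phi> \<Colon> A \<rightarrow> Nat"
| Ex_intro: "\<lbrakk>T \<noteq> PRa; T \<turnstile> \<phi> \<Colon> A \<^bold>\<times> B \<rightarrow> \<two>\<rbrakk>
    \<Longrightarrow> T \<turnstile> (\<phi> \<^bold>\<longrightarrow> Ex A B \<phi> \<odot> Fst A B) \<approx> true (A \<^bold>\<times> B) \<Colon> A \<^bold>\<times> B \<rightarrow> Nat"
| Ex_elim: "\<lbrakk>T \<noteq> PRa; T \<turnstile> \<phi> \<Colon> A \<^bold>\<times> B \<rightarrow> \<two>; T \<turnstile> \<psi> \<Colon> A \<rightarrow> \<two>;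
      T \<turnstile> (\<phi> \<^bold>\<longrightarrow> \<psi> \<odot> Fst A B) \<approx> true (A \<^bold>\<times> B) \<Colon> A \<^bold>\<times> B \<rightarrow> Nat\<rbrakk>
    \<Longrightarrow> T \<turnstile> (Ex A B \<phi> \<^bold>\<longrightarrow> \<psi>) \<approx> true A \<Colon> A \<rightarrow> Nat"
| Ex_subst: "\<lbrakk>T \<noteq> PRa; T \<turnstile> \<phi> \<Colon> A \<^bold>\<times> B \<rightarrow> \<two>; T \<turnstile> f \<Colon> C \<rightarrow> A\<rbrakk>
    \<Longrightarrow> T \<turnstile> Ex A B \<phi> \<odot> f \<approx> Ex C B (\<phi> \<odot> cross C B f (Id B)) \<Colon> C \<rightarrow> Nat"
| All_elim: "\<lbrakk>T \<noteq> PRa; T \<turnstile> \<phi> \<Colon> A \<^bold>\<times> B \<rightarrow> \<two>\<rbrakk>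
    \<Longrightarrow> T \<turnstile> (All A B \<phi> \<odot> Fst A B \<^bold>\<longrightarrow> \<phi>) \<approx> true (A \<^bold>\<times> B) \<Colon> A \<^bold>\<times> B \<rightarrow> Nat"
| All_intro: "\<lbrakk>T \<noteq> PRa; T \<turnstile> \<phi> \<Colon> A \<^bold>\<times> B \<rightarrow> \<two>; T \<turnstile> \<psi> \<Colon> A \<rightarrow> \<two>;
      T \<turnstile> (\<psi> \<odot> Fst A B \<^bold>\<longrightarrow> \<phi>) \<approx> true (A \<^bold>\<times> B) \<Colon> A \<^bold>\<times> B \<rightarrow> Nat\<rbrakk>
    \<Longrightarrow> T \<turnstile> (\<psi> \<^bold>\<longrightarrow> All A B \<phi>) \<approx> true A \<Colon> A \<rightarrow> Nat"
| All_subst: "\<lbrakk>T \<noteq> PRa; T \<turnstile> \<phi> \<Colon> A \<^bold>\<times> B \<rightarrow> \<two>; T \<turnstile> f \<Colon> C \<rightarrow> A\<rbrakk>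
    \<Longrightarrow> T \<turnstile> All A B \<phi> \<odot> f \<approx> All C B (\<phi> \<odot> cross C B f (Id B)) \<Colon> C \<rightarrow> Nat"
| excluded_middle: "\<lbrakk>T \<noteq> PRa; T \<turnstile> \<phi> \<Colon> A \<^bold>\<times> B \<rightarrow> \<two>\<rbrakk>
    \<Longrightarrow> T \<turnstile> (All A B \<phi> \<^bold>\<or> Ex A B (\<^bold>\<not> \<phi>)) \<approx> true A \<Colon> A \<rightarrow> Nat"

| arr_Desc: "\<lbrakk>T \<noteq> PRa; T \<turnstile> \<phi> \<Colon> A \<^bold>\<times> B \<rightarrow> \<two>; T \<turnstile> Ex1 A B \<phi> \<approx> true A \<Colon> A \<rightarrow> Nat\<rbrakk>
    \<Longrightarrow> T \<turnstile> Desc A B \<phi> \<Colon> A \<rightarrow> B"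
| eq_Desc: "T \<turnstile> Desc A B \<phi> \<Colon> A \<rightarrow> B
    \<Longrightarrow> T \<turnstile> eqp B \<odot> cross A B (Desc A B \<phi>) (Id B) \<approx> \<phi> \<Colon> A \<^bold>\<times> B \<rightarrow> Nat"
| eq_Desc_unique: "\<lbrakk>T \<turnstile> Desc A B \<phi> \<Colon> A \<rightarrow> B; T \<turnstile> f \<Colon> A \<rightarrow> B;
      T \<turnstile> eqp B \<odot> cross A B f (Id B) \<approx> \<phi> \<Colon> A \<^bold>\<times> B \<rightarrow> Nat\<rbrakk>
    \<Longrightarrow> T \<turnstile> f \<approx> Desc A B \<phi> \<Colon> A \<rightarrow> B"

| well_order: "\<lbrakk>T = Qwo; T \<turnstile> \<chi> \<Colon> A \<^bold>\<times> Nat \<rightarrow> \<two>\<rbrakk>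
    \<Longrightarrow> T \<turnstile> least_element A \<chi> \<approx> true A \<Colon> A \<rightarrow> Nat"

section \<open>Partial maps\<close>

record pmap =
  dom_ob :: obj
  dom_map :: trm
  rule_map :: trm

definition partial_map :: "thy \<Rightarrow> pmap \<Rightarrow> obj \<Rightarrow> obj \<Rightarrow> bool"
    ("_ \<turnstile> _ \<Colon> _ \<rightharpoonup> _" [51, 51, 51, 51] 50) where
  "T \<turnstile> F \<Colon> A \<rightharpoonup> B \<longleftrightarrow>
     (let D = dom_ob F; d = dom_map F; r = rule_map F in
        T \<turnstile> d \<Colon> D \<rightarrow> A \<and> T \<turnstile> r \<Colon> D \<rightarrow> B \<and>
        T \<turnstile> (eqp A \<odot> cross D D d d \<^bold>\<longrightarrow> eqp B \<odot> cross D D r r) \<approx> true (D \<^bold>\<times> D) \<Colon> D \<^bold>\<times> D \<rightarrow> Nat)"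

definition partial_eq :: "thy \<Rightarrow> pmap \<Rightarrow> pmap \<Rightarrow> obj \<Rightarrow> obj \<Rightarrow> bool"
    ("_ \<turnstile> _ \<wedgeq> _ \<Colon> _ \<rightharpoonup> _" [51, 51, 51, 51, 51] 50) where
  "T \<turnstile> F \<wedgeq> G \<Colon> A \<rightharpoonup> B \<longleftrightarrow>
     T \<turnstile> F \<Colon> A \<rightharpoonup> B \<and> T \<turnstile> G \<Colon> A \<rightharpoonup> B \<and>
     (\<exists>i j. T \<turnstile> i \<Colon> dom_ob F \<rightarrow> dom_ob G \<and> T \<turnstile> j \<Colon> dom_ob G \<rightarrow> dom_ob F \<and>
        T \<turnstile> dom_map G \<odot> i \<approx> dom_map F \<Colon> dom_ob F \<rightarrow> A \<and>
        T \<turnstile> rule_map G \<odot> i \<approx> rule_map F \<Colon> dom_ob F \<rightarrow> B \<and>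
        T \<turnstile> dom_map F \<odot> j \<approx> dom_map G \<Colon> dom_ob G \<rightarrow> A \<and>
        T \<turnstile> rule_map F \<odot> j \<approx> rule_map G \<Colon> dom_ob G \<rightarrow> B)"

section \<open>The two \<open>\<mu>\<close>-operators\<close>

text \<open>
  \<open>min {n' \<le> n | \<phi>(a,n')}\<close> by search: \<open>n\<close>-fold iteration of \<open>(a,m) \<mapsto> (a, m + \<not>\<phi>(a,m))\<close> from \<open>(a,0)\<close>
  (the value is \<open>n\<close> if there is no such \<open>n' \<le> n\<close>).
\<close>

definition bounded_min :: "obj \<Rightarrow> trm \<Rightarrow> trm" where
  "bounded_min A \<phi> =
     Snd A Nat
     \<odot> Iter \<^bold>\<langle>Fst A Nat, add \<odot> \<^bold>\<langle>Snd A Nat, \<^bold>\<not> \<phi>\<^bold>\<rangle>\<^bold>\<rangle>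
     \<odot> \<^bold>\<langle>\<^bold>\<langle>Fst A Nat, zero (A \<^bold>\<times> Nat)\<^bold>\<rangle>, Snd A Nat\<^bold>\<rangle>"

definition mu_PRa :: "obj \<Rightarrow> trm \<Rightarrow> pmap" where
  "mu_PRa A \<phi> =
     \<lparr>dom_ob = Sub (A \<^bold>\<times> Nat) \<phi>,
      dom_map = Fst A Nat \<odot> Incl (A \<^bold>\<times> Nat) \<phi>,
      rule_map = bounded_min A \<phi> \<odot> Incl (A \<^bold>\<times> Nat) \<phi>\<rparr>"

text \<open>\<open>n' = min {n | \<phi>(a,n)}\<close>, i.e. \<open>\<phi>(a,n') \<and> \<forall>n (\<phi>(a,n) \<Rightarrow> n' \<le> n)\<close>, as a predicate of
  \<open>(a,n') : A \<times> \<nat>\<close>.\<close>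

definition is_min :: "obj \<Rightarrow> trm \<Rightarrow> trm" where
  "is_min A \<phi> =
     (let Y = A \<^bold>\<times> Nat; a = Fst A Nat \<odot> Fst Y Nat; n' = Snd A Nat \<odot> Fst Y Nat; n = Snd Y Nat
      in \<phi> \<^bold>\<and> All Y Nat (\<phi> \<odot> \<^bold>\<langle>a, n\<^bold>\<rangle> \<^bold>\<longrightarrow> n' \<^bold>\<le> n))"

definition mu_Q :: "obj \<Rightarrow> trm \<Rightarrow> pmap" where
  "mu_Q A \<phi> =
     (let \<epsilon> = Ex A Nat \<phi>; D = Sub A \<epsilon> in
     \<lparr>dom_ob = D,
      dom_map = Incl A \<epsilon>,
      rule_map = Desc D Nat (is_min A \<phi> \<odot> cross D Nat (Incl A \<epsilon>) (Id Nat))\<rparr>)"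

end

theory Submission
  imports Defs
begin

text \<open>
  Both partial maps send \<open>a\<close> to the least \<open>n\<close> with \<open>\<phi>(a,n)\<close>; they differ in the witness that the
  domain of definition carries.  On \<open>{(a,n) | \<phi>(a,n)}\<close> the least element is found by bounded search
  up to \<open>n\<close>; on \<open>{a | \<exists>n \<phi>(a,n)}\<close> it is obtained by description from unique existence.  One
  comparison map forgets the witness, \<open>(a,n) \<mapsto> a\<close>; the other takes the described least element
  itself as witness, \<open>a \<mapsto> (a, min)\<close>.  Both are compatible with the rules because bounded search
  yields a least element (\<open>is_min_bm\<close>), so does description (\<open>is_min_r\<close>), and least elements are
  unique (\<open>is_min_unique\<close>).  Bounded search yields a least element because its value, unless it
  already satisfies \<open>\<phi>\<close>, equals the bound (\<open>bm_stationary\<close>), and because it cannot step beyond a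
  place where \<open>\<phi>\<close> holds (\<open>bm_le\<close>), which uses linearity of the order.

  These are arguments with hypotheses, case distinctions and inductions, whereas the calculus has
  only equations between variable-free map terms.  The bridge is a Kripke-Joyal reading.  Maps modulo
  derivable equality form a category with products, in which derivable equations become equalities
  of sets and can be used for rewriting.  A map \<open>x : X \<rightarrow> A\<close> is regarded as an element of \<open>A\<close> at
  stage \<open>X\<close>, composition with \<open>u : Y \<rightarrow> X\<close> as passage to the later stage \<open>Y\<close>, and a predicate
  \<open>p : X \<rightarrow> 2\<close> as valid at \<open>X\<close> if it equals \<open>true\<close>.  The rules for predicate abstraction give this
  reading its force: restriction to the stage \<open>{X | p}\<close> is the same as assuming \<open>p\<close>.  From
  them follow that the equality predicate reflects equality (\<open>eqe_imp_eq\<close>), the deduction theorem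
  (\<open>im_iff\<close>) and case distinction on a predicate (\<open>pred_cases\<close>).  Uniqueness of the initialised
  iterated gives uniqueness of primitive recursion (\<open>rec_unique\<close>), hence case distinction on
  numbers and induction (\<open>nat_cases\<close>, \<open>pred_induct\<close>).  The quantifiers then satisfy their usual
  forcing clauses (\<open>All_iff\<close>, \<open>Ex_I\<close>, \<open>Ex_E\<close>).
\<close>

section \<open>Domains, codomains and monotonicity\<close>

fun dm :: "trm \<Rightarrow> obj" and cd :: "trm \<Rightarrow> obj" where
  "dm (Id A) = A"
| "dm (g \<odot> f) = dm f"
| "dm (Bang A) = A"
| "dm (Fst A B) = A \<^bold>\<times> B"
| "dm (Snd A B) = A \<^bold>\<times> B"
| "dm (\<^bold>\<langle>f, g\<^bold>\<rangle>) = dm f"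
| "dm Zero = One"
| "dm Succ = Nat"
| "dm (Iter f) = dm f \<^bold>\<times> Nat"
| "dm (Incl A \<chi>) = Sub A \<chi>"
| "dm (Lift A \<chi> f) = dm f"
| "dm (Ex A B \<phi>) = A"
| "dm (All A B \<phi>) = A"
| "dm (Desc A B \<phi>) = A"
| "cd (Id A) = A"
| "cd (g \<odot> f) = cd g"
| "cd (Bang A) = One"
| "cd (Fst A B) = A"
| "cd (Snd A B) = B"
| "cd (\<^bold>\<langle>f, g\<^bold>\<rangle>) = cd f \<^bold>\<times> cd g"
| "cd Zero = Nat"
| "cd Succ = Nat"
| "cd (Iter f) = cd f"
| "cd (Incl A \<chi>) = A"
| "cd (Lift A \<chi> f) = Sub A \<chi>"
| "cd (Ex A B \<phi>) = Nat"
| "cd (All A B \<phi>) = Nat"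
| "cd (Desc A B \<phi>) = B"

inductive_cases ob_ProdE: "T \<turnstile>\<^sub>o A \<^bold>\<times> B"
inductive_cases arr_CompE: "T \<turnstile> g \<odot> f \<Colon> A \<rightarrow> C"
inductive_cases arr_PairE: "T \<turnstile> \<^bold>\<langle>f, g\<^bold>\<rangle> \<Colon> A \<rightarrow> C"
inductive_cases prdE: "T \<turnstile> f \<Colon> A \<rightarrow> \<two>"

lemma arr_Comp_iff: "T \<turnstile> g \<odot> f \<Colon> A \<rightarrow> C \<longleftrightarrow> (\<exists>B. T \<turnstile> f \<Colon> A \<rightarrow> B \<and> T \<turnstile> g \<Colon> B \<rightarrow> C)"
  by (metis arr_Comp arr_CompE)

lemma arr_Pair_iff:
  "T \<turnstile> \<^bold>\<langle>f, g\<^bold>\<rangle> \<Colon> C \<rightarrow> D \<longleftrightarrow> (\<exists>A B. D = A \<^bold>\<times> B \<and> T \<turnstile> f \<Colon> C \<rightarrow> A \<and> T \<turnstile> g \<Colon> C \<rightarrow> B)"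
  by (metis arr_Pair arr_PairE)

lemma arr_dm_cd: "T \<turnstile> f \<Colon> A \<rightarrow> B \<Longrightarrow> dm f = A \<and> cd f = B"
  by (induction rule: ob_arr_prd_eqv.inducts(2)[where ?P1.0 = "\<lambda>_. True" and ?P3.0 = "\<lambda>_ _. True" and ?P4.0 = "\<lambda>_ _ _ _. True"]) auto

lemma
  fixes T :: thy
  shows "T \<turnstile>\<^sub>o A \<Longrightarrow> True" and arr_ob_both: "T \<turnstile> f \<Colon> B \<rightarrow> C \<Longrightarrow> T \<turnstile>\<^sub>o B \<and> T \<turnstile>\<^sub>o C"
  and "T \<turnstile> p \<Colon> D \<rightarrow> \<two> \<Longrightarrow> T \<turnstile>\<^sub>o D" and "T \<turnstile> g \<approx> h \<Colon> E \<rightarrow> F \<Longrightarrow> True"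
proof (induction rule: ob_arr_prd_eqv.inducts)
qed (auto intro: ob_One ob_Nat ob_Prod ob_Sub elim: ob_ProdE)

lemma arr_ob: "T \<turnstile> f \<Colon> A \<rightarrow> B \<Longrightarrow> T \<turnstile>\<^sub>o A" "T \<turnstile> f \<Colon> A \<rightarrow> B \<Longrightarrow> T \<turnstile>\<^sub>o B"
  using arr_ob_both by blast+

lemma ob_Prod_iff: "T \<turnstile>\<^sub>o A \<^bold>\<times> B \<longleftrightarrow> T \<turnstile>\<^sub>o A \<and> T \<turnstile>\<^sub>o B"
  by (auto intro: ob_Prod elim: ob_ProdE)

text \<open>
  The rules with a side condition on the theory cannot occur in a derivation of \<open>PRa\<close>; so every derivation of \<open>PRa\<close> can be repeated in the extensions.
\<close>

lemma
  assumes "T' \<noteq> PRa"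
  shows PRa_mono_ob: "PRa \<turnstile>\<^sub>o A \<Longrightarrow> T' \<turnstile>\<^sub>o A"
    and PRa_mono_arr: "PRa \<turnstile> f \<Colon> B \<rightarrow> C \<Longrightarrow> T' \<turnstile> f \<Colon> B \<rightarrow> C"
    and PRa_mono_prd: "PRa \<turnstile> p \<Colon> D \<rightarrow> \<two> \<Longrightarrow> T' \<turnstile> p \<Colon> D \<rightarrow> \<two>"
    and PRa_mono_eqv: "PRa \<turnstile> g \<approx> h \<Colon> E \<rightarrow> F \<Longrightarrow> T' \<turnstile> g \<approx> h \<Colon> E \<rightarrow> F"
proof (induction rule: ob_arr_prd_eqv.inducts)
qed ((simp; fail) | (rule ob_arr_prd_eqv.intros; (assumption | rule assms)))+

inductive_cases ob_SubE: "T \<turnstile>\<^sub>o Sub A \<chi>"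

section \<open>Maps modulo derivable equality\<close>

locale calculus =
  fixes T :: thy
begin

text \<open>
  The class of an ill-typed term is empty, which makes composition and pairing of classes strict in
  ill-typedness.  In particular \<open>\<guillemotleft>f \<odot> g\<guillemotright> = \<guillemotleft>f\<guillemotright> \<cdot> \<guillemotleft>g\<guillemotright>\<close> and associativity hold without typing conditions.
  Types are recovered from a class by \<open>src\<close> and \<open>tgt\<close>, so that typing conditions can be solved by
  rewriting.
\<close>

definition cls :: "trm \<Rightarrow> trm set" ("\<guillemotleft>_\<guillemotright>") where
  "\<guillemotleft>f\<guillemotright> = {g. \<exists>A B. T \<turnstile> f \<Colon> A \<rightarrow> B \<and> T \<turnstile> g \<Colon> A \<rightarrow> B \<and> T \<turnstile> f \<approx> g \<Colon> A \<rightarrow> B}"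

definition wt :: "trm set \<Rightarrow> bool" where
  "wt x \<longleftrightarrow> (\<exists>f A B. T \<turnstile> f \<Colon> A \<rightarrow> B \<and> x = \<guillemotleft>f\<guillemotright>)"

definition src :: "trm set \<Rightarrow> obj" where "src x = dm (SOME f. f \<in> x)"
definition tgt :: "trm set \<Rightarrow> obj" where "tgt x = cd (SOME f. f \<in> x)"

abbreviation hom :: "trm set \<Rightarrow> obj \<Rightarrow> obj \<Rightarrow> bool" where
  "hom x A B \<equiv> wt x \<and> src x = A \<and> tgt x = B"

definition cmp :: "trm set \<Rightarrow> trm set \<Rightarrow> trm set" (infixr "\<cdot>" 70) where
  "x \<cdot> y = (\<Union>f\<in>x. \<Union>g\<in>y. \<guillemotleft>f \<odot> g\<guillemotright>)"

definition pair :: "trm set \<Rightarrow> trm set \<Rightarrow> trm set" ("\<langle>_, _\<rangle>") where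
  "\<langle>x, y\<rangle> = (\<Union>f\<in>x. \<Union>g\<in>y. \<guillemotleft>\<^bold>\<langle>f, g\<^bold>\<rangle>\<guillemotright>)"

lemma cls_eq_iff:
  assumes f: "T \<turnstile> f \<Colon> A \<rightarrow> B"
  shows "\<guillemotleft>f\<guillemotright> = \<guillemotleft>g\<guillemotright> \<longleftrightarrow> T \<turnstile> g \<Colon> A \<rightarrow> B \<and> T \<turnstile> f \<approx> g \<Colon> A \<rightarrow> B"
proof
  assume *: "\<guillemotleft>f\<guillemotright> = \<guillemotleft>g\<guillemotright>"
  have "f \<in> \<guillemotleft>f\<guillemotright>" using f eq_refl unfolding cls_def by blast
  then have "f \<in> \<guillemotleft>g\<guillemotright>" using * by simp
  then show "T \<turnstile> g \<Colon> A \<rightarrow> B \<and> T \<turnstile> f \<approx> g \<Colon> A \<rightarrow> B"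
    using f arr_dm_cd eq_sym unfolding cls_def by blast
next
  assume g: "T \<turnstile> g \<Colon> A \<rightarrow> B \<and> T \<turnstile> f \<approx> g \<Colon> A \<rightarrow> B"
  have "h \<in> \<guillemotleft>f\<guillemotright> \<longleftrightarrow> h \<in> \<guillemotleft>g\<guillemotright>" for h
  proof
    assume "h \<in> \<guillemotleft>f\<guillemotright>"
    then have "T \<turnstile> h \<Colon> A \<rightarrow> B" "T \<turnstile> f \<approx> h \<Colon> A \<rightarrow> B"
      using f arr_dm_cd unfolding cls_def by blast+
    then show "h \<in> \<guillemotleft>g\<guillemotright>" using g eq_trans[OF eq_sym] unfolding cls_def by blast
  next
    assume "h \<in> \<guillemotleft>g\<guillemotright>"
    then have "T \<turnstile> h \<Colon> A \<rightarrow> B" "T \<turnstile> g \<approx> h \<Colon> A \<rightarrow> B"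
      using g arr_dm_cd unfolding cls_def by blast+
    then show "h \<in> \<guillemotleft>f\<guillemotright>" using f g eq_trans unfolding cls_def by blast
  qed
  then show "\<guillemotleft>f\<guillemotright> = \<guillemotleft>g\<guillemotright>" by blast
qed

lemma cls_eqI: "T \<turnstile> f \<Colon> A \<rightarrow> B \<Longrightarrow> T \<turnstile> g \<Colon> A \<rightarrow> B \<Longrightarrow> T \<turnstile> f \<approx> g \<Colon> A \<rightarrow> B \<Longrightarrow> \<guillemotleft>f\<guillemotright> = \<guillemotleft>g\<guillemotright>"
  using cls_eq_iff by blast

lemma cls_empty: "(\<And>A B. \<not> T \<turnstile> f \<Colon> A \<rightarrow> B) \<Longrightarrow> \<guillemotleft>f\<guillemotright> = {}"
  unfolding cls_def by blast

lemma mem_cls_typed: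
  assumes "g \<in> \<guillemotleft>f\<guillemotright>"
  shows "T \<turnstile> f \<Colon> A \<rightarrow> B \<longleftrightarrow> T \<turnstile> g \<Colon> A \<rightarrow> B" and "T \<turnstile> f \<Colon> A \<rightarrow> B \<Longrightarrow> T \<turnstile> g \<approx> f \<Colon> A \<rightarrow> B"
proof -
  obtain A' B' where *: "T \<turnstile> f \<Colon> A' \<rightarrow> B'" "T \<turnstile> g \<Colon> A' \<rightarrow> B'" "T \<turnstile> f \<approx> g \<Colon> A' \<rightarrow> B'"
    using assms unfolding cls_def by blast
  have "A = A' \<and> B = B'" if "T \<turnstile> f \<Colon> A \<rightarrow> B \<or> T \<turnstile> g \<Colon> A \<rightarrow> B"
    using that arr_dm_cd[OF *(1)] arr_dm_cd[OF *(2)] arr_dm_cd[of T _ A B] by metis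
  then show "T \<turnstile> f \<Colon> A \<rightarrow> B \<longleftrightarrow> T \<turnstile> g \<Colon> A \<rightarrow> B" and "T \<turnstile> f \<Colon> A \<rightarrow> B \<Longrightarrow> T \<turnstile> g \<approx> f \<Colon> A \<rightarrow> B"
    using * eq_sym[OF *(3)] by auto
qed

lemma mem_cls: "g \<in> \<guillemotleft>f\<guillemotright> \<Longrightarrow> \<guillemotleft>g\<guillemotright> = \<guillemotleft>f\<guillemotright>"
proof -
  assume "g \<in> \<guillemotleft>f\<guillemotright>"
  then obtain A B where *: "T \<turnstile> f \<Colon> A \<rightarrow> B" "T \<turnstile> g \<Colon> A \<rightarrow> B" "T \<turnstile> f \<approx> g \<Colon> A \<rightarrow> B"
    unfolding cls_def by blast
  from cls_eqI[OF this] show ?thesis ..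
qed

lemma cls_self: "T \<turnstile> f \<Colon> A \<rightarrow> B \<Longrightarrow> f \<in> \<guillemotleft>f\<guillemotright>"
  unfolding cls_def using eq_refl by blast

lemma hom_cls: assumes f: "T \<turnstile> f \<Colon> A \<rightarrow> B" shows "hom \<guillemotleft>f\<guillemotright> A B"
proof -
  have "(SOME g. g \<in> \<guillemotleft>f\<guillemotright>) \<in> \<guillemotleft>f\<guillemotright>" using cls_self[OF f] by (rule someI)
  then have "T \<turnstile> (SOME g. g \<in> \<guillemotleft>f\<guillemotright>) \<Colon> A \<rightarrow> B" using f by (simp add: mem_cls_typed(1))
  from arr_dm_cd[OF this]
  have "src \<guillemotleft>f\<guillemotright> = A" "tgt \<guillemotleft>f\<guillemotright> = B" unfolding src_def tgt_def by simp_all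
  then show ?thesis using f unfolding wt_def by blast
qed

lemma homE: assumes "hom x A B" obtains f where "T \<turnstile> f \<Colon> A \<rightarrow> B" "x = \<guillemotleft>f\<guillemotright>"
proof -
  obtain f A' B' where f: "T \<turnstile> f \<Colon> A' \<rightarrow> B'" "x = \<guillemotleft>f\<guillemotright>" using assms unfolding wt_def by blast
  then show ?thesis using hom_cls[OF f(1)] assms that by simp
qed

lemma hom_cls_iff: "hom \<guillemotleft>f\<guillemotright> A B \<longleftrightarrow> T \<turnstile> f \<Colon> A \<rightarrow> B"
proof
  assume "hom \<guillemotleft>f\<guillemotright> A B"
  then obtain g where "T \<turnstile> g \<Colon> A \<rightarrow> B" "\<guillemotleft>f\<guillemotright> = \<guillemotleft>g\<guillemotright>" by (rule homE)
  then show "T \<turnstile> f \<Colon> A \<rightarrow> B" using cls_eq_iff[of g A B f] by simp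
qed (rule hom_cls)

lemma cls_Comp [simp]: "\<guillemotleft>f \<odot> g\<guillemotright> = \<guillemotleft>f\<guillemotright> \<cdot> \<guillemotleft>g\<guillemotright>"
proof (cases "\<exists>A B. T \<turnstile> f \<odot> g \<Colon> A \<rightarrow> B")
  case True
  then obtain A B C where fg: "T \<turnstile> f \<Colon> B \<rightarrow> C" "T \<turnstile> g \<Colon> A \<rightarrow> B" by (auto elim: arr_CompE)
  have "\<guillemotleft>f' \<odot> g'\<guillemotright> = \<guillemotleft>f \<odot> g\<guillemotright>" if "f' \<in> \<guillemotleft>f\<guillemotright>" "g' \<in> \<guillemotleft>g\<guillemotright>" for f' g'
  proof (rule cls_eqI)
    note f' = mem_cls_typed[OF that(1), of B C] and g' = mem_cls_typed[OF that(2), of A B]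
    show "T \<turnstile> f' \<odot> g' \<Colon> A \<rightarrow> C" "T \<turnstile> f \<odot> g \<Colon> A \<rightarrow> C"
      using f'(1) g'(1) fg arr_Comp by simp_all
    show "T \<turnstile> f' \<odot> g' \<approx> f \<odot> g \<Colon> A \<rightarrow> C" using f'(2) g'(2) fg eq_Comp by simp
  qed
  moreover have "f \<in> \<guillemotleft>f\<guillemotright>" "g \<in> \<guillemotleft>g\<guillemotright>" by (rule cls_self, rule fg)+
  ultimately show ?thesis unfolding cmp_def by blast
next
  case False
  have "\<guillemotleft>f' \<odot> g'\<guillemotright> = {}" if "f' \<in> \<guillemotleft>f\<guillemotright>" "g' \<in> \<guillemotleft>g\<guillemotright>" for f' g'
  proof (rule cls_empty)
    show "\<not> T \<turnstile> f' \<odot> g' \<Colon> A \<rightarrow> C" for A C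
      using False by (auto elim!: arr_CompE simp: mem_cls_typed(1)[OF that(1), symmetric]
          mem_cls_typed(1)[OF that(2), symmetric]) (metis arr_Comp)
  qed
  moreover have "\<guillemotleft>f \<odot> g\<guillemotright> = {}" using False by (intro cls_empty) blast
  ultimately show ?thesis unfolding cmp_def by simp
qed

lemma cls_Pair [simp]: "\<guillemotleft>\<^bold>\<langle>f, g\<^bold>\<rangle>\<guillemotright> = \<langle>\<guillemotleft>f\<guillemotright>, \<guillemotleft>g\<guillemotright>\<rangle>"
proof (cases "\<exists>A B. T \<turnstile> \<^bold>\<langle>f, g\<^bold>\<rangle> \<Colon> A \<rightarrow> B")
  case True
  then obtain A B C where fg: "T \<turnstile> f \<Colon> A \<rightarrow> C" "T \<turnstile> g \<Colon> A \<rightarrow> B" by (auto elim: arr_PairE)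
  have "\<guillemotleft>\<^bold>\<langle>f', g'\<^bold>\<rangle>\<guillemotright> = \<guillemotleft>\<^bold>\<langle>f, g\<^bold>\<rangle>\<guillemotright>" if "f' \<in> \<guillemotleft>f\<guillemotright>" "g' \<in> \<guillemotleft>g\<guillemotright>" for f' g'
  proof -
    have *: "T \<turnstile> f' \<Colon> A \<rightarrow> C" "T \<turnstile> g' \<Colon> A \<rightarrow> B" "T \<turnstile> f' \<approx> f \<Colon> A \<rightarrow> C" "T \<turnstile> g' \<approx> g \<Colon> A \<rightarrow> B"
      using mem_cls_typed[OF that(1), of A C] mem_cls_typed[OF that(2), of A B] fg by simp_all
    have "T \<turnstile> \<^bold>\<langle>f', g'\<^bold>\<rangle> \<approx> \<^bold>\<langle>f, g\<^bold>\<rangle> \<Colon> A \<rightarrow> C \<^bold>\<times> B"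
      by (rule eq_Pair[OF arr_Pair[OF *(1,2)] eq_trans[OF eq_Fst[OF *(1,2)] *(3)]
          eq_trans[OF eq_Snd[OF *(1,2)] *(4)]])
    then show ?thesis by (rule cls_eqI[OF arr_Pair[OF *(1,2)] arr_Pair[OF fg]])
  qed
  moreover have "f \<in> \<guillemotleft>f\<guillemotright>" "g \<in> \<guillemotleft>g\<guillemotright>" by (rule cls_self, rule fg)+
  ultimately show ?thesis unfolding pair_def by blast
next
  case False
  have "\<guillemotleft>\<^bold>\<langle>f', g'\<^bold>\<rangle>\<guillemotright> = {}" if "f' \<in> \<guillemotleft>f\<guillemotright>" "g' \<in> \<guillemotleft>g\<guillemotright>" for f' g'
  proof (rule cls_empty)
    show "\<not> T \<turnstile> \<^bold>\<langle>f', g'\<^bold>\<rangle> \<Colon> A \<rightarrow> C" for A C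
      using False by (auto elim!: arr_PairE simp: mem_cls_typed(1)[OF that(1), symmetric]
          mem_cls_typed(1)[OF that(2), symmetric]) (metis arr_Pair)
  qed
  moreover have "\<guillemotleft>\<^bold>\<langle>f, g\<^bold>\<rangle>\<guillemotright> = {}" using False by (intro cls_empty) blast
  ultimately show ?thesis unfolding pair_def by simp
qed

lemma eqvI: "hom \<guillemotleft>f\<guillemotright> A B \<Longrightarrow> \<guillemotleft>f\<guillemotright> = \<guillemotleft>g\<guillemotright> \<Longrightarrow> T \<turnstile> f \<approx> g \<Colon> A \<rightarrow> B"
  using cls_eq_iff hom_cls_iff by blast

text \<open>
  With \<open>true\<close> at a stage written as a successor, the rules for numbers compute with truth values too.
\<close>

abbreviation zr where "zr X \<equiv> \<guillemotleft>zero X\<guillemotright>"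
abbreviation sc where "sc x \<equiv> \<guillemotleft>Succ\<guillemotright> \<cdot> x"
abbreviation tr where "tr X \<equiv> sc (zr X)"

lemma hom_ob: "hom x A B \<Longrightarrow> T \<turnstile>\<^sub>o A" "hom x A B \<Longrightarrow> T \<turnstile>\<^sub>o B"
  by (erule homE; erule arr_ob)+

lemma wtE: assumes "wt x" obtains f where "T \<turnstile> f \<Colon> src x \<rightarrow> tgt x" "x = \<guillemotleft>f\<guillemotright>"
  using assms homE[of x "src x" "tgt x"] by blast

lemma wt_ob [simp]: "wt x \<Longrightarrow> T \<turnstile>\<^sub>o src x" "wt x \<Longrightarrow> T \<turnstile>\<^sub>o tgt x"
  using hom_ob by blast+

declare ob_Nat [simp] ob_One [simp] ob_Prod_iff [simp]

text \<open>
  If either side is ill-typed, so is the other, and both are empty.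
\<close>

lemma cmp_assoc [simp]: "(x \<cdot> y) \<cdot> z = x \<cdot> y \<cdot> z"
proof -
  have assoc: "\<guillemotleft>(f \<odot> g) \<odot> h\<guillemotright> = \<guillemotleft>f \<odot> g \<odot> h\<guillemotright>" for f g h
  proof (cases "\<exists>A B C D. T \<turnstile> h \<Colon> A \<rightarrow> B \<and> T \<turnstile> g \<Colon> B \<rightarrow> C \<and> T \<turnstile> f \<Colon> C \<rightarrow> D")
    case True
    then obtain A B C D where *: "T \<turnstile> h \<Colon> A \<rightarrow> B" "T \<turnstile> g \<Colon> B \<rightarrow> C" "T \<turnstile> f \<Colon> C \<rightarrow> D" by blast
    show ?thesis
      by (rule cls_eqI[OF arr_Comp[OF *(1) arr_Comp[OF *(2,3)]]
            arr_Comp[OF arr_Comp[OF *(1,2)] *(3)] eq_assoc[OF *]])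
  next
    case False
    then have "\<guillemotleft>(f \<odot> g) \<odot> h\<guillemotright> = {}" "\<guillemotleft>f \<odot> g \<odot> h\<guillemotright> = {}"
      by (intro cls_empty; force simp: arr_Comp_iff)+
    then show ?thesis by simp
  qed
  have 1: "(\<Union>k\<in>\<guillemotleft>f \<odot> g\<guillemotright>. \<guillemotleft>k \<odot> h\<guillemotright>) = \<guillemotleft>(f \<odot> g) \<odot> h\<guillemotright>" for f g h
  proof (cases "\<guillemotleft>f \<odot> g\<guillemotright> = {}")
    case True
    then show ?thesis unfolding cls_Comp[of _ h] by (simp add: cmp_def del: cls_Comp)
  next
    case False
    have "\<guillemotleft>k \<odot> h\<guillemotright> = \<guillemotleft>(f \<odot> g) \<odot> h\<guillemotright>" if "k \<in> \<guillemotleft>f \<odot> g\<guillemotright>" for k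
      using mem_cls[OF that] by simp
    then show ?thesis using False by blast
  qed
  have 2: "(\<Union>k\<in>\<guillemotleft>g \<odot> h\<guillemotright>. \<guillemotleft>f \<odot> k\<guillemotright>) = \<guillemotleft>f \<odot> g \<odot> h\<guillemotright>" for f g h
  proof (cases "\<guillemotleft>g \<odot> h\<guillemotright> = {}")
    case True
    then show ?thesis unfolding cls_Comp[of f] by (simp add: cmp_def del: cls_Comp)
  next
    case False
    have "\<guillemotleft>f \<odot> k\<guillemotright> = \<guillemotleft>f \<odot> g \<odot> h\<guillemotright>" if "k \<in> \<guillemotleft>g \<odot> h\<guillemotright>" for k
      using mem_cls[OF that] by simp
    then show ?thesis using False by blast
  qed
  have "(x \<cdot> y) \<cdot> z = (\<Union>f\<in>x. \<Union>g\<in>y. \<Union>h\<in>z. \<Union>k\<in>\<guillemotleft>f \<odot> g\<guillemotright>. \<guillemotleft>k \<odot> h\<guillemotright>)"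
    unfolding cmp_def by blast
  also have "\<dots> = (\<Union>f\<in>x. \<Union>g\<in>y. \<Union>h\<in>z. \<Union>k\<in>\<guillemotleft>g \<odot> h\<guillemotright>. \<guillemotleft>f \<odot> k\<guillemotright>)"
    unfolding 1 2 assoc ..
  also have "\<dots> = x \<cdot> y \<cdot> z" unfolding cmp_def by blast
  finally show ?thesis .
qed

lemma hom_cmp: assumes "wt x" "wt y" "src x = tgt y" shows "hom (x \<cdot> y) (src y) (tgt x)"
proof -
  obtain f g where f: "T \<turnstile> f \<Colon> src x \<rightarrow> tgt x" "x = \<guillemotleft>f\<guillemotright>" and g: "T \<turnstile> g \<Colon> src y \<rightarrow> tgt y" "y = \<guillemotleft>g\<guillemotright>"
    by (rule wtE[OF assms(1)], rule wtE[OF assms(2)]) blast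
  have "T \<turnstile> f \<odot> g \<Colon> src y \<rightarrow> tgt x"
    by (rule arr_Comp[OF g(1)]) (use f(1) assms(3) in simp)
  from hom_cls[OF this] show ?thesis using f(2) g(2) by simp
qed

lemma wt_cmp [simp]: "wt x \<Longrightarrow> wt y \<Longrightarrow> src x = tgt y \<Longrightarrow> wt (x \<cdot> y)"
  and src_cmp [simp]: "wt x \<Longrightarrow> wt y \<Longrightarrow> src x = tgt y \<Longrightarrow> src (x \<cdot> y) = src y"
  and tgt_cmp [simp]: "wt x \<Longrightarrow> wt y \<Longrightarrow> src x = tgt y \<Longrightarrow> tgt (x \<cdot> y) = tgt x"
  using hom_cmp by simp_all

lemma hom_pair: assumes "wt x" "wt y" "src x = src y" shows "hom \<langle>x, y\<rangle> (src y) (tgt x \<^bold>\<times> tgt y)"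
proof -
  obtain f g where f: "T \<turnstile> f \<Colon> src x \<rightarrow> tgt x" "x = \<guillemotleft>f\<guillemotright>" and g: "T \<turnstile> g \<Colon> src y \<rightarrow> tgt y" "y = \<guillemotleft>g\<guillemotright>"
    by (rule wtE[OF assms(1)], rule wtE[OF assms(2)]) blast
  have "T \<turnstile> \<^bold>\<langle>f, g\<^bold>\<rangle> \<Colon> src y \<rightarrow> tgt x \<^bold>\<times> tgt y"
    by (rule arr_Pair[OF _ g(1)]) (use f(1) assms(3) in simp)
  from hom_cls[OF this] show ?thesis using f(2) g(2) by simp
qed

lemma wt_pair [simp]: "wt x \<Longrightarrow> wt y \<Longrightarrow> src x = src y \<Longrightarrow> wt \<langle>x, y\<rangle>"
  and src_pair [simp]: "wt x \<Longrightarrow> wt y \<Longrightarrow> src x = src y \<Longrightarrow> src \<langle>x, y\<rangle> = src y"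
  and tgt_pair [simp]: "wt x \<Longrightarrow> wt y \<Longrightarrow> src x = src y \<Longrightarrow> tgt \<langle>x, y\<rangle> = tgt x \<^bold>\<times> tgt y"
  using hom_pair by simp_all

lemma hom_Id [simp]: "T \<turnstile>\<^sub>o A \<Longrightarrow> hom \<guillemotleft>Id A\<guillemotright> A A" by (rule hom_cls) (rule arr_Id)
lemma hom_Fst [simp]: "T \<turnstile>\<^sub>o A \<Longrightarrow> T \<turnstile>\<^sub>o B \<Longrightarrow> hom \<guillemotleft>Fst A B\<guillemotright> (A \<^bold>\<times> B) A" by (rule hom_cls) (rule arr_Fst)
lemma hom_Snd [simp]: "T \<turnstile>\<^sub>o A \<Longrightarrow> T \<turnstile>\<^sub>o B \<Longrightarrow> hom \<guillemotleft>Snd A B\<guillemotright> (A \<^bold>\<times> B) B" by (rule hom_cls) (rule arr_Snd)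
lemma hom_Succ [simp]: "hom \<guillemotleft>Succ\<guillemotright> Nat Nat" by (rule hom_cls) (rule arr_Succ)
lemma arr_zero: "T \<turnstile>\<^sub>o A \<Longrightarrow> T \<turnstile> zero A \<Colon> A \<rightarrow> Nat"
  unfolding zero_def by (rule arr_Comp[OF arr_Bang arr_Zero])
lemma hom_zero [simp]: "T \<turnstile>\<^sub>o A \<Longrightarrow> hom (zr A) A Nat"
  by (rule hom_cls) (rule arr_zero)

lemma cls_true [simp]: "\<guillemotleft>true A\<guillemotright> = tr A" by (simp add: true_def)
lemma cls_cross [simp]: "\<guillemotleft>cross A B f g\<guillemotright> = \<langle>\<guillemotleft>f\<guillemotright> \<cdot> \<guillemotleft>Fst A B\<guillemotright>, \<guillemotleft>g\<guillemotright> \<cdot> \<guillemotleft>Snd A B\<guillemotright>\<rangle>"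
  by (simp add: cross_def)

lemma Id_left [simp]: "wt x \<Longrightarrow> tgt x = B \<Longrightarrow> \<guillemotleft>Id B\<guillemotright> \<cdot> x = x"
proof -
  assume "wt x" "tgt x = B"
  then obtain f where f: "T \<turnstile> f \<Colon> src x \<rightarrow> B" "x = \<guillemotleft>f\<guillemotright>" by (metis wtE)
  from cls_eqI[OF arr_Comp[OF f(1) arr_Id[OF arr_ob(2)[OF f(1)]]] f(1) eq_Id_left[OF f(1)]]
  show ?thesis using f(2) by simp
qed

lemma Id_right [simp]: "wt x \<Longrightarrow> src x = A \<Longrightarrow> x \<cdot> \<guillemotleft>Id A\<guillemotright> = x"
proof -
  assume "wt x" "src x = A"
  then obtain f where f: "T \<turnstile> f \<Colon> A \<rightarrow> tgt x" "x = \<guillemotleft>f\<guillemotright>" by (metis wtE)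
  from cls_eqI[OF arr_Comp[OF arr_Id[OF arr_ob(1)[OF f(1)]] f(1)] f(1) eq_Id_right[OF f(1)]]
  show ?thesis using f(2) by simp
qed

lemma Fst_pair [simp]:
  assumes "wt x" "wt y" "src x = src y" "tgt x = A" "tgt y = B" shows "\<guillemotleft>Fst A B\<guillemotright> \<cdot> \<langle>x, y\<rangle> = x"
proof -
  obtain f g where f: "T \<turnstile> f \<Colon> src y \<rightarrow> A" "x = \<guillemotleft>f\<guillemotright>" and g: "T \<turnstile> g \<Colon> src y \<rightarrow> B" "y = \<guillemotleft>g\<guillemotright>"
    using wtE[OF assms(1)] wtE[OF assms(2)] assms(3-5) by metis
  from cls_eqI[OF arr_Comp[OF arr_Pair[OF f(1) g(1)] arr_Fst] f(1) eq_Fst[OF f(1) g(1)]]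
  show ?thesis using f g arr_ob by simp
qed

lemma Snd_pair [simp]:
  assumes "wt x" "wt y" "src x = src y" "tgt x = A" "tgt y = B" shows "\<guillemotleft>Snd A B\<guillemotright> \<cdot> \<langle>x, y\<rangle> = y"
proof -
  obtain f g where f: "T \<turnstile> f \<Colon> src y \<rightarrow> A" "x = \<guillemotleft>f\<guillemotright>" and g: "T \<turnstile> g \<Colon> src y \<rightarrow> B" "y = \<guillemotleft>g\<guillemotright>"
    using wtE[OF assms(1)] wtE[OF assms(2)] assms(3-5) by metis
  from cls_eqI[OF arr_Comp[OF arr_Pair[OF f(1) g(1)] arr_Snd] g(1) eq_Snd[OF f(1) g(1)]]
  show ?thesis using f g arr_ob by simp
qed

lemma pair_eta: 
  assumes "wt z" "tgt z = A \<^bold>\<times> B" shows "\<langle>\<guillemotleft>Fst A B\<guillemotright> \<cdot> z, \<guillemotleft>Snd A B\<guillemotright> \<cdot> z\<rangle> = z"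
proof -
  obtain h where h: "T \<turnstile> h \<Colon> src z \<rightarrow> A \<^bold>\<times> B" "z = \<guillemotleft>h\<guillemotright>" using assms by (metis wtE)
  then have AB: "T \<turnstile>\<^sub>o A" "T \<turnstile>\<^sub>o B" using arr_ob(2)[OF h(1)] by simp_all
  note F = arr_Comp[OF h(1) arr_Fst[OF AB]] and S = arr_Comp[OF h(1) arr_Snd[OF AB]]
  from cls_eqI[OF h(1) arr_Pair[OF F S] eq_Pair[OF h(1) eq_refl[OF F] eq_refl[OF S]]]
  show ?thesis using h(2) by simp
qed

lemma Id_prod [simp]: "T \<turnstile>\<^sub>o A \<Longrightarrow> T \<turnstile>\<^sub>o B \<Longrightarrow> \<langle>\<guillemotleft>Fst A B\<guillemotright>, \<guillemotleft>Snd A B\<guillemotright>\<rangle> = \<guillemotleft>Id (A \<^bold>\<times> B)\<guillemotright>"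
  using pair_eta[of "\<guillemotleft>Id (A \<^bold>\<times> B)\<guillemotright>" A B] by simp

lemma pair_cmp [simp]:
  assumes "wt z" shows "\<langle>x, y\<rangle> \<cdot> z = \<langle>x \<cdot> z, y \<cdot> z\<rangle>"
proof -
  obtain h where h: "T \<turnstile> h \<Colon> src z \<rightarrow> tgt z" "z = \<guillemotleft>h\<guillemotright>" using assms by (metis wtE)
  have 1: "\<langle>\<guillemotleft>f\<guillemotright>, \<guillemotleft>g\<guillemotright>\<rangle> \<cdot> z = \<langle>\<guillemotleft>f\<guillemotright> \<cdot> z, \<guillemotleft>g\<guillemotright> \<cdot> z\<rangle>" for f g
  proof (cases "\<exists>A B. T \<turnstile> f \<Colon> tgt z \<rightarrow> A \<and> T \<turnstile> g \<Colon> tgt z \<rightarrow> B")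
    case True
    then obtain A B where f: "hom \<guillemotleft>f\<guillemotright> (tgt z) A" and g: "hom \<guillemotleft>g\<guillemotright> (tgt z) B" using hom_cls by blast
    let ?w = "\<langle>\<guillemotleft>f\<guillemotright>, \<guillemotleft>g\<guillemotright>\<rangle> \<cdot> z"
    have "\<guillemotleft>Fst A B\<guillemotright> \<cdot> ?w = \<guillemotleft>f\<guillemotright> \<cdot> z" "\<guillemotleft>Snd A B\<guillemotright> \<cdot> ?w = \<guillemotleft>g\<guillemotright> \<cdot> z"
      using f g by (simp_all add: cmp_assoc[symmetric] del: cmp_assoc)
    then show ?thesis using pair_eta[of ?w A B] f g assms by simp
  next
    case False
    have "\<guillemotleft>\<^bold>\<langle>f, g\<^bold>\<rangle> \<odot> h\<guillemotright> = {}" "\<guillemotleft>\<^bold>\<langle>f \<odot> h, g \<odot> h\<^bold>\<rangle>\<guillemotright> = {}"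
      using False arr_dm_cd[OF h(1)] by (intro cls_empty; auto simp: arr_Comp_iff arr_Pair_iff dest: arr_dm_cd)+
    then show ?thesis using h(2) by simp
  qed
  have "\<langle>x, y\<rangle> \<cdot> z = (\<Union>f\<in>x. \<Union>g\<in>y. \<guillemotleft>\<^bold>\<langle>f, g\<^bold>\<rangle>\<guillemotright> \<cdot> z)" unfolding cmp_def pair_def by blast
  also have "\<dots> = (\<Union>f\<in>x. \<Union>g\<in>y. \<langle>\<guillemotleft>f\<guillemotright> \<cdot> z, \<guillemotleft>g\<guillemotright> \<cdot> z\<rangle>)" using 1 by simp
  also have "\<dots> = (\<Union>f\<in>x. \<Union>g\<in>y. \<langle>\<guillemotleft>f \<odot> h\<guillemotright>, \<guillemotleft>g \<odot> h\<guillemotright>\<rangle>)" using h by simp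
  also have "\<dots> = \<langle>\<Union>f\<in>x. \<guillemotleft>f \<odot> h\<guillemotright>, \<Union>g\<in>y. \<guillemotleft>g \<odot> h\<guillemotright>\<rangle>" unfolding pair_def by blast
  also have "\<dots> = \<langle>x \<cdot> z, y \<cdot> z\<rangle>"
  proof -
    have "(\<Union>f\<in>x. \<guillemotleft>f \<odot> h\<guillemotright>) = x \<cdot> z" for x
    proof -
      have "\<guillemotleft>f \<odot> k\<guillemotright> = \<guillemotleft>f \<odot> h\<guillemotright>" if "k \<in> z" for f k
        using mem_cls[of k h] that h(2) by (metis cls_Comp)
      moreover have "h \<in> z" using h cls_self by simp
      ultimately show ?thesis unfolding cmp_def by blast
    qed
    then show ?thesis by simp
  qed
  finally show ?thesis .
qed

lemma zero_cmp [simp]: "wt x \<Longrightarrow> tgt x = A \<Longrightarrow> zr A \<cdot> x = zr (src x)"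
proof -
  assume "wt x" "tgt x = A"
  then obtain f where f: "T \<turnstile> f \<Colon> src x \<rightarrow> A" "x = \<guillemotleft>f\<guillemotright>" by (metis wtE)
  note o = arr_ob[OF f(1)]
  note b = arr_Comp[OF f(1) arr_Bang[OF o(2)]]
  from cls_eqI[OF b arr_Bang[OF o(1)] eq_Bang[OF b]] have "\<guillemotleft>Bang A\<guillemotright> \<cdot> x = \<guillemotleft>Bang (src x)\<guillemotright>" using f(2) by simp
  then show ?thesis by (simp add: zero_def)
qed

section \<open>Iteration\<close>

lemma hom_Iter [simp]: "wt \<guillemotleft>f\<guillemotright> \<Longrightarrow> src \<guillemotleft>f\<guillemotright> = tgt \<guillemotleft>f\<guillemotright> \<Longrightarrow> hom \<guillemotleft>Iter f\<guillemotright> (tgt \<guillemotleft>f\<guillemotright> \<^bold>\<times> Nat) (tgt \<guillemotleft>f\<guillemotright>)"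
  by (rule hom_cls, rule arr_Iter, rule iffD1[OF hom_cls_iff]) simp

lemma Iter_zero [simp]:
  assumes "wt x" "src x = X" "wt \<guillemotleft>f\<guillemotright>" "src \<guillemotleft>f\<guillemotright> = tgt x" "tgt \<guillemotleft>f\<guillemotright> = tgt x"
  shows "\<guillemotleft>Iter f\<guillemotright> \<cdot> \<langle>x, zr X\<rangle> = x"
proof -
  let ?A = "tgt x"
  have f: "T \<turnstile> f \<Colon> ?A \<rightarrow> ?A" using assms hom_cls_iff by blast
  have A: "T \<turnstile>\<^sub>o ?A" using assms(1) by simp
  from cls_eqI[OF arr_Comp[OF arr_Pair[OF arr_Id[OF A] arr_zero[OF A]] arr_Iter[OF f]] arr_Id[OF A] eq_Iter_zero[OF f]]
  have "\<guillemotleft>Iter f\<guillemotright> \<cdot> \<langle>\<guillemotleft>Id ?A\<guillemotright>, zr ?A\<rangle> = \<guillemotleft>Id ?A\<guillemotright>" by simp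
  from arg_cong[OF this, of "\<lambda>z. z \<cdot> x"] show ?thesis using assms by simp
qed

lemma Iter_Succ [simp]:
  assumes "wt x" "wt n" "src n = src x" "tgt n = Nat" "wt \<guillemotleft>f\<guillemotright>" "src \<guillemotleft>f\<guillemotright> = tgt x" "tgt \<guillemotleft>f\<guillemotright> = tgt x"
  shows "\<guillemotleft>Iter f\<guillemotright> \<cdot> \<langle>x, sc n\<rangle> = \<guillemotleft>f\<guillemotright> \<cdot> \<guillemotleft>Iter f\<guillemotright> \<cdot> \<langle>x, n\<rangle>"
proof -
  let ?A = "tgt x"
  have f: "T \<turnstile> f \<Colon> ?A \<rightarrow> ?A" using assms hom_cls_iff by blast
  have A: "T \<turnstile>\<^sub>o ?A" using assms(1) by simp
  have "T \<turnstile> cross ?A Nat (Id ?A) Succ \<Colon> ?A \<^bold>\<times> Nat \<rightarrow> ?A \<^bold>\<times> Nat"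
    unfolding cross_def by (intro arr_Pair arr_Comp[OF arr_Fst arr_Id] arr_Comp[OF arr_Snd arr_Succ] A ob_Nat)
  from cls_eqI[OF arr_Comp[OF this arr_Iter[OF f]] arr_Comp[OF arr_Iter[OF f] f] eq_Iter_Succ[OF f]] 
  have "\<guillemotleft>Iter f\<guillemotright> \<cdot> \<langle>\<guillemotleft>Id ?A\<guillemotright> \<cdot> \<guillemotleft>Fst ?A Nat\<guillemotright>, sc \<guillemotleft>Snd ?A Nat\<guillemotright>\<rangle> = \<guillemotleft>f\<guillemotright> \<cdot> \<guillemotleft>Iter f\<guillemotright>" by simp
  from arg_cong[OF this, of "\<lambda>z. z \<cdot> \<langle>x, n\<rangle>"] show ?thesis using assms A by simp
qed

text \<open>
  Freyd's uniqueness rule on elements: two maps with the same initial value that obey the same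
  step \<open>g\<close> are equal, since both are the iterated of \<open>g\<close> on that initial value.
\<close>

lemma iter_unique:
  assumes h: "hom h (X \<^bold>\<times> Nat) B" and h': "hom h' (X \<^bold>\<times> Nat) B" and g: "hom g B B"
    and z_elem: "\<And>Y x. hom x Y X \<Longrightarrow> h \<cdot> \<langle>x, zr Y\<rangle> = h' \<cdot> \<langle>x, zr Y\<rangle>"
    and s_elem: "\<And>Y x n. hom x Y X \<Longrightarrow> hom n Y Nat \<Longrightarrow> h \<cdot> \<langle>x, sc n\<rangle> = g \<cdot> h \<cdot> \<langle>x, n\<rangle>"
    and s'_elem: "\<And>Y x n. hom x Y X \<Longrightarrow> hom n Y Nat \<Longrightarrow> h' \<cdot> \<langle>x, sc n\<rangle> = g \<cdot> h' \<cdot> \<langle>x, n\<rangle>"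
  shows "h = h'"
proof -
  have X: "T \<turnstile>\<^sub>o X" using hom_ob[OF h] by simp
  have z: "h \<cdot> \<langle>\<guillemotleft>Id X\<guillemotright>, zr X\<rangle> = h' \<cdot> \<langle>\<guillemotleft>Id X\<guillemotright>, zr X\<rangle>"
    using z_elem[of "\<guillemotleft>Id X\<guillemotright>" X] X by simp
  have s: "h \<cdot> \<langle>\<guillemotleft>Fst X Nat\<guillemotright>, sc \<guillemotleft>Snd X Nat\<guillemotright>\<rangle> = g \<cdot> h"
    using s_elem[of "\<guillemotleft>Fst X Nat\<guillemotright>" "X \<^bold>\<times> Nat" "\<guillemotleft>Snd X Nat\<guillemotright>"] X h by simp
  have s': "h' \<cdot> \<langle>\<guillemotleft>Fst X Nat\<guillemotright>, sc \<guillemotleft>Snd X Nat\<guillemotright>\<rangle> = g \<cdot> h'"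
    using s'_elem[of "\<guillemotleft>Fst X Nat\<guillemotright>" "X \<^bold>\<times> Nat" "\<guillemotleft>Snd X Nat\<guillemotright>"] X h' by simp
  have i: "hom \<langle>\<guillemotleft>Id X\<guillemotright>, zr X\<rangle> X (X \<^bold>\<times> Nat)" using X by simp
  then have b: "hom (h \<cdot> \<langle>\<guillemotleft>Id X\<guillemotright>, zr X\<rangle>) X B" using h by simp
  obtain th th' tg tb where t: "T \<turnstile> th \<Colon> X \<^bold>\<times> Nat \<rightarrow> B" "T \<turnstile> th' \<Colon> X \<^bold>\<times> Nat \<rightarrow> B" "T \<turnstile> tg \<Colon> B \<rightarrow> B" "T \<turnstile> tb \<Colon> X \<rightarrow> B"
    and e: "h = \<guillemotleft>th\<guillemotright>" "h' = \<guillemotleft>th'\<guillemotright>" "g = \<guillemotleft>tg\<guillemotright>" "h \<cdot> \<langle>\<guillemotleft>Id X\<guillemotright>, zr X\<rangle> = \<guillemotleft>tb\<guillemotright>"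
    by (rule homE[OF h], rule homE[OF h'], rule homE[OF g], rule homE[OF b]) blast
  have I: "T \<turnstile> \<^bold>\<langle>Id X, zero X\<^bold>\<rangle> \<Colon> X \<rightarrow> X \<^bold>\<times> Nat" by (intro arr_Pair arr_Id arr_zero X)
  have C: "T \<turnstile> cross X Nat (Id X) Succ \<Colon> X \<^bold>\<times> Nat \<rightarrow> X \<^bold>\<times> Nat"
    unfolding cross_def by (intro arr_Pair arr_Comp[OF arr_Fst arr_Id] arr_Comp[OF arr_Snd arr_Succ] X ob_Nat)
  have "\<guillemotleft>k\<guillemotright> = \<guillemotleft>Iter tg \<odot> cross X Nat tb (Id Nat)\<guillemotright>" 
    if k: "T \<turnstile> k \<Colon> X \<^bold>\<times> Nat \<rightarrow> B" and kz: "\<guillemotleft>k\<guillemotright> \<cdot> \<langle>\<guillemotleft>Id X\<guillemotright>, zr X\<rangle> = \<guillemotleft>tb\<guillemotright>"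
      and ks: "\<guillemotleft>k\<guillemotright> \<cdot> \<langle>\<guillemotleft>Fst X Nat\<guillemotright>, sc \<guillemotleft>Snd X Nat\<guillemotright>\<rangle> = \<guillemotleft>tg\<guillemotright> \<cdot> \<guillemotleft>k\<guillemotright>" for k
  proof (rule cls_eqI[OF k _ eq_Iter_unique[OF t(4,3) k]])
    show "T \<turnstile> Iter tg \<odot> cross X Nat tb (Id Nat) \<Colon> X \<^bold>\<times> Nat \<rightarrow> B" unfolding cross_def
      by (rule arr_Comp[OF arr_Pair[OF arr_Comp[OF arr_Fst t(4)] arr_Comp[OF arr_Snd arr_Id]] arr_Iter[OF t(3)]]) (simp_all add: X)
    show "T \<turnstile> k \<odot> \<^bold>\<langle>Id X, zero X\<^bold>\<rangle> \<approx> tb \<Colon> X \<rightarrow> B"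
      using cls_eq_iff[OF arr_Comp[OF I k], of tb] kz by simp
    show "T \<turnstile> k \<odot> cross X Nat (Id X) Succ \<approx> tg \<odot> k \<Colon> X \<^bold>\<times> Nat \<rightarrow> B"
      using cls_eq_iff[OF arr_Comp[OF C k], of "tg \<odot> k"] ks X by simp
  qed
  from this[OF t(1)] this[OF t(2)] show ?thesis using e z s s' by simp
qed

text \<open>
  The step of a primitive recursion may use the parameter and the counter.  Pairing the value with
  its argument turns it into a plain iteration on \<open>(X \<times> \<nat>) \<times> B\<close>.
\<close>

lemma rec_unique:
  assumes h: "hom h (X \<^bold>\<times> Nat) B" and h': "hom h' (X \<^bold>\<times> Nat) B" and g: "hom g ((X \<^bold>\<times> Nat) \<^bold>\<times> B) B"
    and z: "\<And>Y x. hom x Y X \<Longrightarrow> h \<cdot> \<langle>x, zr Y\<rangle> = h' \<cdot> \<langle>x, zr Y\<rangle>"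
    and s: "\<And>Y x n. hom x Y X \<Longrightarrow> hom n Y Nat \<Longrightarrow> h \<cdot> \<langle>x, sc n\<rangle> = g \<cdot> \<langle>\<langle>x, n\<rangle>, h \<cdot> \<langle>x, n\<rangle>\<rangle>"
    and s': "\<And>Y x n. hom x Y X \<Longrightarrow> hom n Y Nat \<Longrightarrow> h' \<cdot> \<langle>x, sc n\<rangle> = g \<cdot> \<langle>\<langle>x, n\<rangle>, h' \<cdot> \<langle>x, n\<rangle>\<rangle>"
  shows "h = h'"
proof -
  have o: "T \<turnstile>\<^sub>o X" "T \<turnstile>\<^sub>o B" using hom_ob[OF h] by simp_all
  let ?P = "X \<^bold>\<times> Nat"
  let ?st = "\<langle>\<langle>\<guillemotleft>Fst X Nat\<guillemotright> \<cdot> \<guillemotleft>Fst ?P B\<guillemotright>, sc (\<guillemotleft>Snd X Nat\<guillemotright> \<cdot> \<guillemotleft>Fst ?P B\<guillemotright>)\<rangle>, g\<rangle>"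
  have "\<langle>\<guillemotleft>Id ?P\<guillemotright>, h\<rangle> = \<langle>\<guillemotleft>Id ?P\<guillemotright>, h'\<rangle>"
    by (rule iter_unique[where g = ?st and X = X and B = "?P \<^bold>\<times> B"]) (use h h' g o in \<open>simp_all add: z s s'\<close>)
  from arg_cong[OF this, of "\<lambda>z. \<guillemotleft>Snd ?P B\<guillemotright> \<cdot> z"] show ?thesis using h h' o by simp
qed

text \<open>
  The case where the step of the recursion does not depend on the previous value.
\<close>

lemma nat_cases:
  assumes h: "hom h (X \<^bold>\<times> Nat) B" and h': "hom h' (X \<^bold>\<times> Nat) B"
    and z: "\<And>Y x. hom x Y X \<Longrightarrow> h \<cdot> \<langle>x, zr Y\<rangle> = h' \<cdot> \<langle>x, zr Y\<rangle>"
    and s: "\<And>Y x n. hom x Y X \<Longrightarrow> hom n Y Nat \<Longrightarrow> h \<cdot> \<langle>x, sc n\<rangle> = h' \<cdot> \<langle>x, sc n\<rangle>"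
  shows "h = h'"
proof -
  have o: "T \<turnstile>\<^sub>o X" "T \<turnstile>\<^sub>o B" using hom_ob[OF h] by simp_all
  show ?thesis
    by (rule rec_unique[OF h h' _ z, where g = "h \<cdot> \<langle>\<guillemotleft>Fst X Nat\<guillemotright>, sc \<guillemotleft>Snd X Nat\<guillemotright>\<rangle> \<cdot> \<guillemotleft>Fst (X \<^bold>\<times> Nat) B\<guillemotright>"])
      (use h h' o in \<open>simp_all add: s\<close>)
qed

section \<open>Arithmetic\<close>

abbreviation ad where "ad x y \<equiv> \<guillemotleft>add\<guillemotright> \<cdot> \<langle>x, y\<rangle>"
abbreviation ms where "ms x y \<equiv> \<guillemotleft>monus\<guillemotright> \<cdot> \<langle>x, y\<rangle>"
abbreviation ml where "ml x y \<equiv> \<guillemotleft>mult\<guillemotright> \<cdot> \<langle>x, y\<rangle>"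
abbreviation pd where "pd x \<equiv> \<guillemotleft>pre\<guillemotright> \<cdot> x"
abbreviation nt where "nt x \<equiv> \<guillemotleft>nott\<guillemotright> \<cdot> x"
abbreviation sg where "sg x \<equiv> \<guillemotleft>sgnt\<guillemotright> \<cdot> x"

lemma hom_add [simp]: "hom \<guillemotleft>add\<guillemotright> (Nat \<^bold>\<times> Nat) Nat"
  by (simp add: add_def)

lemma ad_zero [simp]: "wt x \<Longrightarrow> src x = X \<Longrightarrow> tgt x = Nat \<Longrightarrow> ad x (zr X) = x"
  by (simp add: add_def)

lemma ad_Succ [simp]:
  "wt x \<Longrightarrow> wt y \<Longrightarrow> src y = src x \<Longrightarrow> tgt x = Nat \<Longrightarrow> tgt y = Nat \<Longrightarrow> ad x (sc y) = sc (ad x y)"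
  by (simp add: add_def)

text \<open>
  Identities of this kind are proved for projections and then instantiated by composition.  A
  statement in a single variable \<open>n\<close> is proved on \<open>\<nat> \<times> \<nat>\<close> with a dummy parameter and
  instantiated at the pair of \<open>n\<close> with itself.
\<close>

lemma zero_ad [simp]:
  assumes "wt x" "src x = X" "tgt x = Nat" shows "ad (zr X) x = x"
proof -
  have "ad (zr (Nat \<^bold>\<times> Nat)) \<guillemotleft>Snd Nat Nat\<guillemotright> = \<guillemotleft>Snd Nat Nat\<guillemotright>"
    by (rule iter_unique[where g = "\<guillemotleft>Succ\<guillemotright>" and X = Nat and B = Nat]) simp_all
  from arg_cong[OF this, of "\<lambda>z. z \<cdot> \<langle>x, x\<rangle>"] show ?thesis using assms by simp
qed

lemma Succ_ad [simp]:
  assumes "wt x" "wt y" "src y = src x" "tgt x = Nat" "tgt y = Nat" shows "ad (sc x) y = sc (ad x y)"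
proof -
  have "ad (sc \<guillemotleft>Fst Nat Nat\<guillemotright>) \<guillemotleft>Snd Nat Nat\<guillemotright> = sc \<guillemotleft>add\<guillemotright>"
    by (rule iter_unique[where g = "\<guillemotleft>Succ\<guillemotright>" and X = Nat and B = Nat]) simp_all
  from arg_cong[OF this, of "\<lambda>z. z \<cdot> \<langle>x, y\<rangle>"] show ?thesis using assms by simp
qed

lemma pd_eq:
  assumes "wt x" "src x = X" "tgt x = Nat"
  shows "pd x = \<guillemotleft>Snd Nat Nat\<guillemotright> \<cdot> \<guillemotleft>Iter \<^bold>\<langle>Succ \<odot> Fst Nat Nat, Fst Nat Nat\<^bold>\<rangle>\<guillemotright> \<cdot> \<langle>\<langle>zr X, zr X\<rangle>, x\<rangle>"
  using assms by (simp add: pre_def)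

lemma hom_pre [simp]: "hom \<guillemotleft>pre\<guillemotright> Nat Nat"
  by (simp add: pre_def)

lemma pd_zero [simp]: "T \<turnstile>\<^sub>o X \<Longrightarrow> pd (zr X) = zr X"
  by (simp add: pd_eq)

lemma pd_Succ [simp]:
  assumes "wt x" "tgt x = Nat" shows "pd (sc x) = x"
proof -
  let ?I = "\<guillemotleft>Iter \<^bold>\<langle>Succ \<odot> Fst Nat Nat, Fst Nat Nat\<^bold>\<rangle>\<guillemotright>"
  have "\<guillemotleft>Fst Nat Nat\<guillemotright> \<cdot> ?I \<cdot> \<langle>\<langle>zr (Nat \<^bold>\<times> Nat), zr (Nat \<^bold>\<times> Nat)\<rangle>, \<guillemotleft>Snd Nat Nat\<guillemotright>\<rangle> = \<guillemotleft>Snd Nat Nat\<guillemotright>"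
    by (rule iter_unique[where g = "\<guillemotleft>Succ\<guillemotright>" and X = Nat and B = Nat]) simp_all
  from arg_cong[OF this, of "\<lambda>z. z \<cdot> \<langle>x, x\<rangle>"] show ?thesis using assms by (simp add: pd_eq)
qed

lemma hom_monus [simp]: "hom \<guillemotleft>monus\<guillemotright> (Nat \<^bold>\<times> Nat) Nat"
  by (simp add: monus_def)

lemma ms_zero [simp]: "wt x \<Longrightarrow> src x = X \<Longrightarrow> tgt x = Nat \<Longrightarrow> ms x (zr X) = x"
  by (simp add: monus_def)

lemma ms_Succ:
  "wt x \<Longrightarrow> wt y \<Longrightarrow> src y = src x \<Longrightarrow> tgt x = Nat \<Longrightarrow> tgt y = Nat \<Longrightarrow> ms x (sc y) = pd (ms x y)"
  by (simp add: monus_def)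

lemma zero_ms [simp]:
  assumes "wt x" "src x = X" "tgt x = Nat" shows "ms (zr X) x = zr X"
proof -
  have "ms (zr (Nat \<^bold>\<times> Nat)) \<guillemotleft>Snd Nat Nat\<guillemotright> = zr (Nat \<^bold>\<times> Nat)"
    by (rule iter_unique[where g = "\<guillemotleft>pre\<guillemotright>" and X = Nat and B = Nat]) (simp_all add: ms_Succ)
  from arg_cong[OF this, of "\<lambda>z. z \<cdot> \<langle>x, x\<rangle>"] show ?thesis using assms by simp
qed

text \<open>
  The predecessor of \<open>(x+1) - n\<close> and \<open>x - n\<close> both iterate the predecessor from \<open>x\<close>.
\<close>

lemma Succ_ms_Succ [simp]:
  assumes "wt x" "wt y" "src y = src x" "tgt x = Nat" "tgt y = Nat" shows "ms (sc x) (sc y) = ms x y"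
proof -
  have "pd (ms (sc \<guillemotleft>Fst Nat Nat\<guillemotright>) \<guillemotleft>Snd Nat Nat\<guillemotright>) = \<guillemotleft>monus\<guillemotright>"
    by (rule iter_unique[where g = "\<guillemotleft>pre\<guillemotright>" and X = Nat and B = Nat]) (simp_all add: ms_Succ)
  from arg_cong[OF this, of "\<lambda>z. z \<cdot> \<langle>x, y\<rangle>"] show ?thesis using assms by (simp add: ms_Succ)
qed

lemma hom_nott [simp]: "hom \<guillemotleft>nott\<guillemotright> Nat Nat"
  by (simp add: nott_def)

lemma nt_zero [simp]: "T \<turnstile>\<^sub>o X \<Longrightarrow> nt (zr X) = tr X"
  by (simp add: nott_def)

lemma nt_Succ [simp]: "wt x \<Longrightarrow> tgt x = Nat \<Longrightarrow> nt (sc x) = zr (src x)"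
  by (simp add: nott_def)

lemma hom_sgnt [simp]: "hom \<guillemotleft>sgnt\<guillemotright> Nat Nat"
  by (simp add: sgnt_def)

lemma sg_zero [simp]: "T \<turnstile>\<^sub>o X \<Longrightarrow> sg (zr X) = zr X"
  by (simp add: sgnt_def)

lemma sg_Succ [simp]: "wt x \<Longrightarrow> tgt x = Nat \<Longrightarrow> sg (sc x) = tr (src x)"
  by (simp add: sgnt_def)

lemma sg_nt [simp]:
  assumes "wt x" "tgt x = Nat" shows "sg (nt x) = nt x"
proof -
  have "sg (nt \<guillemotleft>Snd Nat Nat\<guillemotright>) = nt \<guillemotleft>Snd Nat Nat\<guillemotright>"
    by (rule nat_cases[where X = Nat and B = Nat]) simp_all
  from arg_cong[OF this, of "\<lambda>z. z \<cdot> \<langle>x, x\<rangle>"] show ?thesis using assms by simp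
qed

lemma sg_sg [simp]: "wt x \<Longrightarrow> tgt x = Nat \<Longrightarrow> sg (sg x) = sg x"
  using sg_nt[of "nt x"] by (simp add: sgnt_def)

lemma nt_nt [simp]: "wt x \<Longrightarrow> tgt x = Nat \<Longrightarrow> nt (nt x) = sg x"
  by (simp add: sgnt_def)

lemma hom_mult [simp]: "hom \<guillemotleft>mult\<guillemotright> (Nat \<^bold>\<times> Nat) Nat"
  by (simp add: mult_def)

lemma ml_eq:
  assumes "wt x" "wt y" "src y = src x" "tgt x = Nat" "tgt y = Nat"
  shows "ml x y = \<guillemotleft>Snd Nat Nat\<guillemotright> \<cdot> \<guillemotleft>Iter \<^bold>\<langle>Fst Nat Nat, add \<odot> \<^bold>\<langle>Snd Nat Nat, Fst Nat Nat\<^bold>\<rangle>\<^bold>\<rangle>\<guillemotright> \<cdot> \<langle>\<langle>x, zr (src x)\<rangle>, y\<rangle>"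
  using assms by (simp add: mult_def)

lemma ml_zero [simp]: "wt x \<Longrightarrow> src x = X \<Longrightarrow> tgt x = Nat \<Longrightarrow> ml x (zr X) = zr X"
  by (auto simp add: ml_eq)

text \<open>
  The iteration defining multiplication keeps its first component \<open>x\<close> constant.
\<close>

lemma ml_Succ [simp]:
  assumes "wt x" "wt y" "src y = src x" "tgt x = Nat" "tgt y = Nat"
  shows "ml x (sc y) = ad (ml x y) x"
proof -
  let ?I = "\<guillemotleft>Iter \<^bold>\<langle>Fst Nat Nat, add \<odot> \<^bold>\<langle>Snd Nat Nat, Fst Nat Nat\<^bold>\<rangle>\<^bold>\<rangle>\<guillemotright>"
  have "\<guillemotleft>Fst Nat Nat\<guillemotright> \<cdot> ?I = \<guillemotleft>Fst Nat Nat\<guillemotright> \<cdot> \<guillemotleft>Fst (Nat \<^bold>\<times> Nat) Nat\<guillemotright>"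
    by (rule iter_unique[where g = "\<guillemotleft>Id Nat\<guillemotright>" and X = "Nat \<^bold>\<times> Nat" and B = Nat]) simp_all
  from arg_cong[OF this, of "\<lambda>z. z \<cdot> \<langle>\<langle>x, zr (src x)\<rangle>, y\<rangle>"] show ?thesis using assms by (simp add: ml_eq)
qed

lemma zero_ml [simp]:
  assumes "wt x" "src x = X" "tgt x = Nat" shows "ml (zr X) x = zr X"
proof -
  have "ml (zr (Nat \<^bold>\<times> Nat)) \<guillemotleft>Snd Nat Nat\<guillemotright> = zr (Nat \<^bold>\<times> Nat)"
    by (rule iter_unique[where g = "\<guillemotleft>Id Nat\<guillemotright>" and X = Nat and B = Nat]) simp_all
  from arg_cong[OF this, of "\<lambda>z. z \<cdot> \<langle>x, x\<rangle>"] show ?thesis using assms by simp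
qed

section \<open>Predicates as truth values at a stage\<close>

abbreviation pred where "pred p X \<equiv> hom p X Nat \<and> sg p = p"
text \<open>
  Connectives on elements are written with the operations that define them, so that they
  compute by rewriting as soon as one argument is known to be \<open>zr X\<close> or \<open>tr X\<close>.
\<close>

abbreviation dj where "dj p q \<equiv> sg (ad p q)"
abbreviation cj where "cj p q \<equiv> sg (ml p q)"
abbreviation im where "im p q \<equiv> dj (nt p) q"
abbreviation le where "le x y \<equiv> nt (ms x y)"
abbreviation eqe where "eqe B x y \<equiv> \<guillemotleft>eqp B\<guillemotright> \<cdot> \<langle>x, y\<rangle>"

lemma cls_neg [simp]: "\<guillemotleft>\<^bold>\<not> f\<guillemotright> = nt \<guillemotleft>f\<guillemotright>" by (simp add: neg_def)
lemma cls_conj [simp]: "\<guillemotleft>f \<^bold>\<and> g\<guillemotright> = cj \<guillemotleft>f\<guillemotright> \<guillemotleft>g\<guillemotright>" by (simp add: conj_def)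
lemma cls_disj [simp]: "\<guillemotleft>f \<^bold>\<or> g\<guillemotright> = dj \<guillemotleft>f\<guillemotright> \<guillemotleft>g\<guillemotright>" by (simp add: disj_def)
lemma cls_impl [simp]: "\<guillemotleft>f \<^bold>\<longrightarrow> g\<guillemotright> = im \<guillemotleft>f\<guillemotright> \<guillemotleft>g\<guillemotright>" by (simp add: impl_def)
lemma cls_leq [simp]: "\<guillemotleft>f \<^bold>\<le> g\<guillemotright> = le \<guillemotleft>f\<guillemotright> \<guillemotleft>g\<guillemotright>" by (simp add: leq_def)
lemma cls_equ [simp]: "\<guillemotleft>equ B f g\<guillemotright> = eqe B \<guillemotleft>f\<guillemotright> \<guillemotleft>g\<guillemotright>" by (simp add: equ_def)

lemma prd_iff: "T \<turnstile> \<chi> \<Colon> A \<rightarrow> \<two> \<longleftrightarrow> pred \<guillemotleft>\<chi>\<guillemotright> A"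
proof
  assume "T \<turnstile> \<chi> \<Colon> A \<rightarrow> \<two>"
  then have c: "T \<turnstile> \<chi> \<Colon> A \<rightarrow> Nat" "T \<turnstile> sgnt \<odot> \<chi> \<approx> \<chi> \<Colon> A \<rightarrow> Nat" by (auto elim: prdE)
  have s: "T \<turnstile> sgnt \<Colon> Nat \<rightarrow> Nat" using hom_sgnt hom_cls_iff by blast
  from hom_cls[OF c(1)] cls_eqI[OF arr_Comp[OF c(1) s] c] show "pred \<guillemotleft>\<chi>\<guillemotright> A" by simp
next
  assume a: "pred \<guillemotleft>\<chi>\<guillemotright> A"
  then have c: "T \<turnstile> \<chi> \<Colon> A \<rightarrow> Nat" using hom_cls_iff by blast
  moreover have "T \<turnstile> sgnt \<odot> \<chi> \<approx> \<chi> \<Colon> A \<rightarrow> Nat"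
    using cls_eq_iff[OF c, of "sgnt \<odot> \<chi>"] a eq_sym by simp
  ultimately show "T \<turnstile> \<chi> \<Colon> A \<rightarrow> \<two>" by (rule prd)
qed

lemma predE: assumes "pred p X" obtains \<chi> where "T \<turnstile> \<chi> \<Colon> X \<rightarrow> \<two>" "p = \<guillemotleft>\<chi>\<guillemotright>"
  using assms homE[of p X Nat] prd_iff by metis

lemma pred_cmp [simp]: "sg p = p \<Longrightarrow> sg (p \<cdot> u) = p \<cdot> u"
  by (metis cmp_assoc)

lemma hom_Incl: "T \<turnstile> \<chi> \<Colon> A \<rightarrow> \<two> \<Longrightarrow> hom \<guillemotleft>Incl A \<chi>\<guillemotright> (Sub A \<chi>) A"
  by (intro hom_cls arr_Incl) (use prd_iff hom_ob in blast)+

lemma pred_eqp_aux: "T \<turnstile>\<^sub>o B \<Longrightarrow> pred \<guillemotleft>eqp B\<guillemotright> (B \<^bold>\<times> B)"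
proof (induction B rule: eqp.induct)
  case (4 A \<chi>)
  then have c: "T \<turnstile>\<^sub>o A" "T \<turnstile> \<chi> \<Colon> A \<rightarrow> \<two>" by (auto elim: ob_SubE)
  from 4 c hom_Incl[OF c(2)] show ?case by simp
qed (simp_all add: Let_def)

lemma pred_eqp [simp]: "T \<turnstile>\<^sub>o B \<Longrightarrow> wt \<guillemotleft>eqp B\<guillemotright>" "T \<turnstile>\<^sub>o B \<Longrightarrow> src \<guillemotleft>eqp B\<guillemotright> = B \<^bold>\<times> B"
  "T \<turnstile>\<^sub>o B \<Longrightarrow> tgt \<guillemotleft>eqp B\<guillemotright> = Nat" "T \<turnstile>\<^sub>o B \<Longrightarrow> \<guillemotleft>sgnt\<guillemotright> \<cdot> \<guillemotleft>eqp B\<guillemotright> = \<guillemotleft>eqp B\<guillemotright>"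
  using pred_eqp_aux by blast+

lemma eqe_Nat: "hom x X Nat \<Longrightarrow> hom y X Nat \<Longrightarrow> eqe Nat x y = cj (le x y) (le y x)"
  by simp

lemma Incl_true: assumes c: "T \<turnstile> \<chi> \<Colon> A \<rightarrow> \<two>" shows "\<guillemotleft>\<chi>\<guillemotright> \<cdot> \<guillemotleft>Incl A \<chi>\<guillemotright> = tr (Sub A \<chi>)"
proof -
  have h: "hom \<guillemotleft>\<chi>\<guillemotright> A Nat" using c prd_iff by blast
  then have A: "T \<turnstile>\<^sub>o A" and "T \<turnstile> \<chi> \<Colon> A \<rightarrow> Nat" using hom_ob hom_cls_iff by blast+
  have "T \<turnstile> \<chi> \<odot> Incl A \<chi> \<Colon> Sub A \<chi> \<rightarrow> Nat"
    by (rule iffD1[OF hom_cls_iff]) (use hom_Incl[OF c] h in simp)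
  moreover have "T \<turnstile> true (Sub A \<chi>) \<Colon> Sub A \<chi> \<rightarrow> Nat"
    by (rule iffD1[OF hom_cls_iff]) (use ob_Sub[OF A c] in simp)
  ultimately have "\<guillemotleft>\<chi> \<odot> Incl A \<chi>\<guillemotright> = \<guillemotleft>true (Sub A \<chi>)\<guillemotright>" using cls_eqI eq_Incl[OF A c] by blast
  then show ?thesis by simp
qed

lemma Lift_exists:
  assumes c: "T \<turnstile> \<chi> \<Colon> A \<rightarrow> \<two>" and f: "hom f C A" and t: "\<guillemotleft>\<chi>\<guillemotright> \<cdot> f = tr C"
  obtains k where "hom k C (Sub A \<chi>)" "\<guillemotleft>Incl A \<chi>\<guillemotright> \<cdot> k = f"
proof -
  obtain tf where tf: "T \<turnstile> tf \<Colon> C \<rightarrow> A" "f = \<guillemotleft>tf\<guillemotright>" using f by (rule homE)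
  have h: "T \<turnstile> \<chi> \<Colon> A \<rightarrow> Nat" using c by (auto elim: prdE)
  have "T \<turnstile> \<chi> \<odot> tf \<approx> true C \<Colon> C \<rightarrow> Nat"
    using cls_eq_iff[OF arr_Comp[OF tf(1) h], of "true C"] t tf(2) by simp
  note L = arr_Lift[OF c tf(1) this]
  have i: "T \<turnstile> Incl A \<chi> \<Colon> Sub A \<chi> \<rightarrow> A" using hom_Incl[OF c] hom_cls_iff by blast
  from cls_eqI[OF arr_Comp[OF L i] tf(1) eq_Lift[OF L]] hom_cls[OF L] tf(2)
  show ?thesis using that by simp
qed

lemma Incl_cancel:
  assumes c: "T \<turnstile> \<chi> \<Colon> A \<rightarrow> \<two>" and g: "hom g C (Sub A \<chi>)" and h: "hom h C (Sub A \<chi>)"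
    and e: "\<guillemotleft>Incl A \<chi>\<guillemotright> \<cdot> g = \<guillemotleft>Incl A \<chi>\<guillemotright> \<cdot> h"
  shows "g = h"
proof -
  obtain tg th where t: "T \<turnstile> tg \<Colon> C \<rightarrow> Sub A \<chi>" "g = \<guillemotleft>tg\<guillemotright>" "T \<turnstile> th \<Colon> C \<rightarrow> Sub A \<chi>" "h = \<guillemotleft>th\<guillemotright>"
    by (rule homE[OF g], rule homE[OF h]) blast
  have i: "T \<turnstile> Incl A \<chi> \<Colon> Sub A \<chi> \<rightarrow> A" using hom_Incl[OF c] hom_cls_iff by blast
  have "T \<turnstile> Incl A \<chi> \<odot> tg \<approx> Incl A \<chi> \<odot> th \<Colon> C \<rightarrow> A"
    using cls_eq_iff[OF arr_Comp[OF t(1) i], of "Incl A \<chi> \<odot> th"] e t by simp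
  from cls_eqI[OF t(1,3) eq_Incl_mono[OF t(1,3) this]] show ?thesis using t by simp
qed

text \<open>
  Equality under the hypothesis \<open>\<chi>\<close>.  This equivalence is what makes the equality predicate of an
  arbitrary object usable, without a look at its definition.
\<close>

lemma Incl_eq_iff:
  assumes c: "T \<turnstile> \<chi> \<Colon> A \<rightarrow> \<two>" and f: "hom f A B" and g: "hom g A B"
  shows "f \<cdot> \<guillemotleft>Incl A \<chi>\<guillemotright> = g \<cdot> \<guillemotleft>Incl A \<chi>\<guillemotright> \<longleftrightarrow> im \<guillemotleft>\<chi>\<guillemotright> (eqe B f g) = tr A"
proof -
  obtain tf tg where t: "T \<turnstile> tf \<Colon> A \<rightarrow> B" "f = \<guillemotleft>tf\<guillemotright>" "T \<turnstile> tg \<Colon> A \<rightarrow> B" "g = \<guillemotleft>tg\<guillemotright>"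
    by (rule homE[OF f], rule homE[OF g]) blast
  have i: "T \<turnstile> Incl A \<chi> \<Colon> Sub A \<chi> \<rightarrow> A" using hom_Incl[OF c] hom_cls_iff by blast
  have h: "hom \<guillemotleft>\<chi>\<guillemotright> A Nat" using c prd_iff by blast
  have B: "T \<turnstile>\<^sub>o B" using hom_ob[OF f] by simp
  have "hom \<guillemotleft>\<chi> \<^bold>\<longrightarrow> equ B tf tg\<guillemotright> A Nat" using h f g t B by simp
  then have m: "T \<turnstile> (\<chi> \<^bold>\<longrightarrow> equ B tf tg) \<Colon> A \<rightarrow> Nat" using hom_cls_iff by blast
  have "T \<turnstile> true A \<Colon> A \<rightarrow> Nat"
    by (rule iffD1[OF hom_cls_iff]) (use hom_ob[OF f] in simp)
  then have 1: "im \<guillemotleft>\<chi>\<guillemotright> (eqe B f g) = tr A \<longleftrightarrow> T \<turnstile> (\<chi> \<^bold>\<longrightarrow> equ B tf tg) \<approx> true A \<Colon> A \<rightarrow> Nat"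
    using cls_eq_iff[OF m, of "true A"] t by simp
  have 2: "f \<cdot> \<guillemotleft>Incl A \<chi>\<guillemotright> = g \<cdot> \<guillemotleft>Incl A \<chi>\<guillemotright> \<longleftrightarrow> T \<turnstile> tf \<odot> Incl A \<chi> \<approx> tg \<odot> Incl A \<chi> \<Colon> Sub A \<chi> \<rightarrow> B"
    using cls_eq_iff[OF arr_Comp[OF i t(1)], of "tg \<odot> Incl A \<chi>"] arr_Comp[OF i t(3)] t by simp
  show ?thesis using 1 2 eq_Sub[OF c t(1,3)] eq_Sub_conv[OF c t(1,3)] by blast
qed

text \<open>
  Equality under the hypothesis \<open>true\<close> is equality, since the inclusion of \<open>{X | true}\<close> has a section.
\<close>

lemma eqe_imp_eq:
  assumes f: "hom f X B" and g: "hom g X B" and e: "eqe B f g = tr X"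
  shows "f = g"
proof -
  have X: "T \<turnstile>\<^sub>o X" "T \<turnstile>\<^sub>o B" using hom_ob[OF f] by simp_all
  have c: "T \<turnstile> true X \<Colon> X \<rightarrow> \<two>" using X by (simp add: prd_iff)
  have "f \<cdot> \<guillemotleft>Incl X (true X)\<guillemotright> = g \<cdot> \<guillemotleft>Incl X (true X)\<guillemotright>"
    using X f g e by (simp add: Incl_eq_iff[OF c f g])
  moreover obtain k where "hom k X (Sub X (true X))" "\<guillemotleft>Incl X (true X)\<guillemotright> \<cdot> k = \<guillemotleft>Id X\<guillemotright>"
    using Lift_exists[OF c, of "\<guillemotleft>Id X\<guillemotright>" X] X by auto
  ultimately show ?thesis using f g by (metis Id_right cmp_assoc)
qed

lemma eqe_refl [simp]:
  assumes "wt f" "src f = X" "tgt f = B" shows "eqe B f f = tr X"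
proof -
  have f: "hom f X B" using assms by simp
  have X: "T \<turnstile>\<^sub>o X" "T \<turnstile>\<^sub>o B" using hom_ob[OF f] by simp_all
  have c: "T \<turnstile> true X \<Colon> X \<rightarrow> \<two>" using X by (simp add: prd_iff)
  show ?thesis using Incl_eq_iff[OF c f f] X f by simp
qed

lemma nt_ml_sg: assumes "wt c" "src c = X" "tgt c = Nat" shows "ml (nt c) (sg c) = zr X"
proof -
  have "ml (nt \<guillemotleft>Snd Nat Nat\<guillemotright>) (sg \<guillemotleft>Snd Nat Nat\<guillemotright>) = zr (Nat \<^bold>\<times> Nat)"
    by (rule nat_cases[where X = Nat and B = Nat]) simp_all
  from arg_cong[OF this, of "\<lambda>z. z \<cdot> \<langle>c, c\<rangle>"] show ?thesis using assms by simp
qed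

text \<open>
  The tautology behind case distinction; as an identity between primitive recursive functions it is
  proved by distinguishing zero and successor in both variables.
\<close>

lemma cases_identity:
  assumes "hom c X Nat" "hom e X Nat" shows "cj (im c e) (im (nt c) e) = sg e"
proof -
  let ?c = "\<guillemotleft>Fst Nat Nat\<guillemotright>" let ?e = "\<guillemotleft>Snd Nat Nat\<guillemotright>"
  have "cj (im ?c ?e) (im (nt ?c) ?e) = sg ?e"
    by (rule nat_cases[where X = Nat and B = Nat]) (simp_all add: nt_ml_sg)
  from arg_cong[OF this, of "\<lambda>z. z \<cdot> \<langle>c, e\<rangle>"] show ?thesis using assms by simp
qed

text \<open>
  Either case is an equality under a hypothesis, hence an implication with conclusion the equality
  predicate of \<open>f\<close> and \<open>g\<close>; these combine to that predicate.
\<close>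

lemma pred_cases:
  assumes p: "pred p X" and f: "hom f X B" and g: "hom g X B"
    and 1: "\<And>Y u. hom u Y X \<Longrightarrow> p \<cdot> u = tr Y \<Longrightarrow> f \<cdot> u = g \<cdot> u"
    and 2: "\<And>Y u. hom u Y X \<Longrightarrow> p \<cdot> u = zr Y \<Longrightarrow> f \<cdot> u = g \<cdot> u"
  shows "f = g"
proof (rule eqe_imp_eq[OF f g])
  have X: "T \<turnstile>\<^sub>o X" "T \<turnstile>\<^sub>o B" using hom_ob[OF f] by simp_all
  let ?e = "eqe B f g"
  have e: "pred ?e X" using f g X by simp
  obtain \<chi> where c: "T \<turnstile> \<chi> \<Colon> X \<rightarrow> \<two>" "p = \<guillemotleft>\<chi>\<guillemotright>" using p by (rule predE)
  have n: "T \<turnstile> nott \<odot> \<chi> \<Colon> X \<rightarrow> \<two>" using p c(2) by (simp add: prd_iff)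
  have a: "im p ?e = tr X" using 1[OF hom_Incl[OF c(1)]] Incl_true[OF c(1)] Incl_eq_iff[OF c(1) f g] c(2) by simp
  have i: "hom \<guillemotleft>Incl X (nott \<odot> \<chi>)\<guillemotright> (Sub X (nott \<odot> \<chi>)) X" by (rule hom_Incl[OF n])
  then have S: "T \<turnstile>\<^sub>o Sub X (nott \<odot> \<chi>)" using hom_ob by blast
  have "nt (p \<cdot> \<guillemotleft>Incl X (nott \<odot> \<chi>)\<guillemotright>) = tr (Sub X (nott \<odot> \<chi>))" using Incl_true[OF n] c(2) by simp
  from arg_cong[OF this, of nt] have "p \<cdot> \<guillemotleft>Incl X (nott \<odot> \<chi>)\<guillemotright> = zr (Sub X (nott \<odot> \<chi>))"
    using i p S by simp
  from 2[OF i this] have b: "im (nt p) ?e = tr X" using Incl_eq_iff[OF n f g] c(2) by simp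
  have "sg ?e = tr X" using cases_identity[of p X ?e] p e a b X by simp
  then show "?e = tr X" using e by simp
qed

lemma eqe_true: assumes q: "pred q X" shows "eqe Nat q (tr X) = q"
proof (rule pred_cases[OF q, where B = Nat])
  have X: "T \<turnstile>\<^sub>o X" using hom_ob q by blast
  show "hom (eqe Nat q (tr X)) X Nat" "hom q X Nat" using q X by simp_all
  fix Y u assume u: "hom u Y X"
  then have Y: "T \<turnstile>\<^sub>o Y" using hom_ob by blast
  show "eqe Nat q (tr X) \<cdot> u = q \<cdot> u" if "q \<cdot> u = tr Y" using q X Y u that by simp
  show "eqe Nat q (tr X) \<cdot> u = q \<cdot> u" if "q \<cdot> u = zr Y" using q X Y u that by simp
qed

text \<open>
  Deduction theorem: it suffices to verify \<open>q\<close> at the generic later stage \<open>{X | p}\<close>.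
\<close>

lemma im_iff:
  assumes p: "pred p X" and q: "pred q X"
  shows "im p q = tr X \<longleftrightarrow> (\<forall>Y u. hom u Y X \<longrightarrow> p \<cdot> u = tr Y \<longrightarrow> q \<cdot> u = tr Y)"
proof
  have X: "T \<turnstile>\<^sub>o X" using hom_ob q by blast
  show "\<forall>Y u. hom u Y X \<longrightarrow> p \<cdot> u = tr Y \<longrightarrow> q \<cdot> u = tr Y" if i: "im p q = tr X"
  proof (intro allI impI)
    fix Y u assume u: "hom u Y X" "p \<cdot> u = tr Y"
    then have Y: "T \<turnstile>\<^sub>o Y" using hom_ob by blast
    from arg_cong[OF i, of "\<lambda>z. z \<cdot> u"] show "q \<cdot> u = tr Y" using u p q X Y by simp
  qed
  assume a: "\<forall>Y u. hom u Y X \<longrightarrow> p \<cdot> u = tr Y \<longrightarrow> q \<cdot> u = tr Y"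
  obtain \<chi> where c: "T \<turnstile> \<chi> \<Colon> X \<rightarrow> \<two>" "p = \<guillemotleft>\<chi>\<guillemotright>" using p by (rule predE)
  have i: "hom \<guillemotleft>Incl X \<chi>\<guillemotright> (Sub X \<chi>) X" by (rule hom_Incl[OF c(1)])
  have "q \<cdot> \<guillemotleft>Incl X \<chi>\<guillemotright> = tr X \<cdot> \<guillemotleft>Incl X \<chi>\<guillemotright>" using a i Incl_true[OF c(1)] c(2) by simp
  then show "im p q = tr X" using Incl_eq_iff[OF c(1), of q Nat "tr X"] q X c(2) eqe_true[OF q] by simp
qed

lemma pred_eqI:
  assumes p: "pred p X" and q: "hom q X Nat" and "\<And>Y u. hom u Y X \<Longrightarrow> p \<cdot> u = zr Y \<Longrightarrow> q \<cdot> u = zr Y"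
    and "\<And>Y u. hom u Y X \<Longrightarrow> p \<cdot> u = tr Y \<Longrightarrow> q \<cdot> u = tr Y"
  shows "p = q"
  by (rule pred_cases[OF p _ q]) (use assms in simp_all)

lemma cj_iff:
  assumes p: "pred p X" and q: "pred q X"
  shows "cj p q = tr X \<longleftrightarrow> p = tr X \<and> q = tr X"
proof
  have X: "T \<turnstile>\<^sub>o X" using hom_ob q by blast
  show "cj p q = tr X" if "p = tr X \<and> q = tr X" using that X by simp
  assume a: "cj p q = tr X"
  have *: "tr X \<cdot> u = zr Y" if u: "hom u Y X" and z: "p \<cdot> u = zr Y \<or> q \<cdot> u = zr Y" for u Y
  proof -
    have Y: "T \<turnstile>\<^sub>o Y" using u hom_ob by blast
    show ?thesis using arg_cong[OF a, of "\<lambda>z. z \<cdot> u"] u p q X Y z by auto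
  qed
  have "p = tr X" by (rule pred_eqI[OF p]) (use * X in \<open>simp_all\<close>)
  moreover have "q = tr X" by (rule pred_eqI[OF q]) (use * X in \<open>simp_all\<close>)
  ultimately show "p = tr X \<and> q = tr X" by simp
qed

lemma dj_cases:
  assumes d: "dj p q = tr X" and p: "pred p X" and q: "pred q X" and f: "hom f X B" and g: "hom g X B"
    and 1: "\<And>Y u. hom u Y X \<Longrightarrow> p \<cdot> u = tr Y \<Longrightarrow> f \<cdot> u = g \<cdot> u"
    and 2: "\<And>Y u. hom u Y X \<Longrightarrow> q \<cdot> u = tr Y \<Longrightarrow> f \<cdot> u = g \<cdot> u"
  shows "f = g"
proof (rule pred_cases[OF p f g 1])
  fix Y u assume u: "hom u Y X" "p \<cdot> u = zr Y"
  moreover have "T \<turnstile>\<^sub>o X" "T \<turnstile>\<^sub>o Y" using u hom_ob by blast+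
  ultimately have "q \<cdot> u = tr Y" using arg_cong[OF d, of "\<lambda>z. z \<cdot> u"] p q by simp
  then show "f \<cdot> u = g \<cdot> u" using 2 u by blast
qed

text \<open>
  If the induction step holds, then \<open>p(n+1)\<close> equals \<open>p(n) \<or> p(n+1)\<close>.  This is a recursion
  for \<open>p\<close> that the constant \<open>true\<close> satisfies as well.
\<close>

lemma pred_induct:
  assumes p: "pred p (X \<^bold>\<times> Nat)"
    and z: "\<And>Y x. hom x Y X \<Longrightarrow> p \<cdot> \<langle>x, zr Y\<rangle> = tr Y"
    and s: "\<And>Y x n. hom x Y X \<Longrightarrow> hom n Y Nat \<Longrightarrow> p \<cdot> \<langle>x, n\<rangle> = tr Y \<Longrightarrow> p \<cdot> \<langle>x, sc n\<rangle> = tr Y"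
  shows "p = tr (X \<^bold>\<times> Nat)"
proof -
  let ?P = "X \<^bold>\<times> Nat"
  have X: "T \<turnstile>\<^sub>o X" using hom_ob[of p] p by auto
  let ?g = "dj \<guillemotleft>Snd ?P Nat\<guillemotright> (p \<cdot> \<langle>\<guillemotleft>Fst X Nat\<guillemotright> \<cdot> \<guillemotleft>Fst ?P Nat\<guillemotright>, sc (\<guillemotleft>Snd X Nat\<guillemotright> \<cdot> \<guillemotleft>Fst ?P Nat\<guillemotright>)\<rangle>)"
  show ?thesis
  proof (rule rec_unique[where X = X and B = Nat and g = ?g])
    show "hom p ?P Nat" "hom (tr ?P) ?P Nat" "hom ?g (?P \<^bold>\<times> Nat) Nat" using p X by simp_all
    fix Y x assume x: "hom x Y X"
    then have Y: "T \<turnstile>\<^sub>o Y" using hom_ob by blast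
    show "p \<cdot> \<langle>x, zr Y\<rangle> = tr ?P \<cdot> \<langle>x, zr Y\<rangle>" using z[OF x] x X Y by simp
    fix n assume n: "hom n Y Nat"
    have "p \<cdot> \<langle>x, sc n\<rangle> = dj (p \<cdot> \<langle>x, n\<rangle>) (p \<cdot> \<langle>x, sc n\<rangle>)"
    proof (rule pred_cases[where p = "p \<cdot> \<langle>x, n\<rangle>" and X = Y and B = Nat])
      fix Z u assume u: "hom u Z Y"
      then have Z: "T \<turnstile>\<^sub>o Z" using hom_ob by blast
      {
        assume "(p \<cdot> \<langle>x, n\<rangle>) \<cdot> u = tr Z"
        then show "(p \<cdot> \<langle>x, sc n\<rangle>) \<cdot> u = dj (p \<cdot> \<langle>x, n\<rangle>) (p \<cdot> \<langle>x, sc n\<rangle>) \<cdot> u"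
          using x n u Z p s[of "x \<cdot> u" Z "n \<cdot> u"] by simp
      next
        assume "(p \<cdot> \<langle>x, n\<rangle>) \<cdot> u = zr Z"
        then show "(p \<cdot> \<langle>x, sc n\<rangle>) \<cdot> u = dj (p \<cdot> \<langle>x, n\<rangle>) (p \<cdot> \<langle>x, sc n\<rangle>) \<cdot> u"
          using x n u Z p by simp
      }
    qed (use p x n in simp_all)
    then show "p \<cdot> \<langle>x, sc n\<rangle> = ?g \<cdot> \<langle>\<langle>x, n\<rangle>, p \<cdot> \<langle>x, n\<rangle>\<rangle>" using x n p X by simp
    show "tr ?P \<cdot> \<langle>x, sc n\<rangle> = ?g \<cdot> \<langle>\<langle>x, n\<rangle>, tr ?P \<cdot> \<langle>x, n\<rangle>\<rangle>" using x n p X Y by simp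
  qed
qed

lemma true_cls_iff: "hom \<guillemotleft>f\<guillemotright> A Nat \<Longrightarrow> \<guillemotleft>f\<guillemotright> = tr A \<longleftrightarrow> T \<turnstile> f \<approx> true A \<Colon> A \<rightarrow> Nat"
proof -
  assume f: "hom \<guillemotleft>f\<guillemotright> A Nat"
  then have "T \<turnstile>\<^sub>o A" using hom_ob by blast
  then have "T \<turnstile> true A \<Colon> A \<rightarrow> Nat" by (intro iffD1[OF hom_cls_iff]) simp
  then show ?thesis using cls_eq_iff[of f A Nat "true A"] f hom_cls_iff[of f A Nat] by simp
qed

lemma partial_mapI:
  assumes d: "hom \<guillemotleft>dom_map F\<guillemotright> (dom_ob F) C" and r: "hom \<guillemotleft>rule_map F\<guillemotright> (dom_ob F) B"
    and u: "\<And>Y x y. hom x Y (dom_ob F) \<Longrightarrow> hom y Y (dom_ob F) \<Longrightarrow>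
      \<guillemotleft>dom_map F\<guillemotright> \<cdot> x = \<guillemotleft>dom_map F\<guillemotright> \<cdot> y \<Longrightarrow> \<guillemotleft>rule_map F\<guillemotright> \<cdot> x = \<guillemotleft>rule_map F\<guillemotright> \<cdot> y"
  shows "T \<turnstile> F \<Colon> C \<rightharpoonup> B"
proof -
  let ?E = "dom_ob F" let ?d = "\<guillemotleft>dom_map F\<guillemotright>" and ?r = "\<guillemotleft>rule_map F\<guillemotright>"
  let ?x = "\<guillemotleft>Fst ?E ?E\<guillemotright>" and ?y = "\<guillemotleft>Snd ?E ?E\<guillemotright>"
  have o: "T \<turnstile>\<^sub>o ?E" "T \<turnstile>\<^sub>o C" "T \<turnstile>\<^sub>o B" using hom_ob d r by blast+
  have "im (eqe C (?d \<cdot> ?x) (?d \<cdot> ?y)) (eqe B (?r \<cdot> ?x) (?r \<cdot> ?y)) = tr (?E \<^bold>\<times> ?E)"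
  proof (rule iffD2[OF im_iff])
    show "\<forall>Y u. hom u Y (?E \<^bold>\<times> ?E) \<longrightarrow> eqe C (?d \<cdot> ?x) (?d \<cdot> ?y) \<cdot> u = tr Y \<longrightarrow>
        eqe B (?r \<cdot> ?x) (?r \<cdot> ?y) \<cdot> u = tr Y"
    proof (intro allI impI)
      fix Y v assume v: "hom v Y (?E \<^bold>\<times> ?E)" and e: "eqe C (?d \<cdot> ?x) (?d \<cdot> ?y) \<cdot> v = tr Y"
      have "?d \<cdot> ?x \<cdot> v = ?d \<cdot> ?y \<cdot> v" by (rule eqe_imp_eq) (use e v d o in simp_all)
      then have "?r \<cdot> ?x \<cdot> v = ?r \<cdot> ?y \<cdot> v" using u[of "?x \<cdot> v" Y "?y \<cdot> v"] v o by simp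
      then show "eqe B (?r \<cdot> ?x) (?r \<cdot> ?y) \<cdot> v = tr Y" using v r o by simp
    qed
  qed (use d r o in simp_all)
  then have "T \<turnstile> (eqp C \<odot> cross ?E ?E (dom_map F) (dom_map F) \<^bold>\<longrightarrow> eqp B \<odot> cross ?E ?E (rule_map F) (rule_map F)) \<approx> true (?E \<^bold>\<times> ?E) \<Colon> ?E \<^bold>\<times> ?E \<rightarrow> Nat"
    by (intro iffD1[OF true_cls_iff]) (use d r o in simp_all)
  then show ?thesis using d r hom_cls_iff unfolding partial_map_def Let_def by blast
qed

section \<open>The order of the natural numbers\<close>

declare eqp.simps(2) [simp del]

lemma le_refl [simp]: assumes "wt x" "tgt x = Nat" "src x = X" shows "le x x = tr X"
proof -
  have x: "hom x X Nat" using assms by simp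
  then have "T \<turnstile>\<^sub>o X" using hom_ob by blast
  then show ?thesis using eqe_refl[OF assms(1,3,2)] eqe_Nat[OF x x] cj_iff[of "le x x" X "le x x"] x by simp
qed

lemma le_antisym:
  assumes "hom x X Nat" "hom y X Nat" "le x y = tr X" "le y x = tr X" shows "x = y"
proof -
  have "T \<turnstile>\<^sub>o X" using assms hom_ob by blast
  then show ?thesis using eqe_imp_eq[OF assms(1,2)] eqe_Nat[OF assms(1,2)] assms by simp
qed

lemma nt_true_zero: assumes "hom x X Nat" "nt x = tr X" shows "x = zr X"
proof -
  have "T \<turnstile>\<^sub>o X" using assms hom_ob by blast
  then show ?thesis using le_antisym[OF assms(1), of "zr X"] assms by simp
qed

text \<open>
  Case distinction on an arbitrary number \<open>d\<close> at stage \<open>X\<close>, as opposed to \<open>nat_cases\<close>, where the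
  number is a variable.
\<close>

lemma nat_split:
  assumes d: "hom d X Nat" and f: "hom f X B" and g: "hom g X B"
    and 1: "\<And>Y u. hom u Y X \<Longrightarrow> d \<cdot> u = zr Y \<Longrightarrow> f \<cdot> u = g \<cdot> u"
    and 2: "\<And>Y u k. hom u Y X \<Longrightarrow> hom k Y Nat \<Longrightarrow> d \<cdot> u = sc k \<Longrightarrow> f \<cdot> u = g \<cdot> u"
  shows "f = g"
proof -
  have X: "T \<turnstile>\<^sub>o X" using hom_ob f by blast
  have "dj (nt \<guillemotleft>Snd Nat Nat\<guillemotright>) (eqe Nat \<guillemotleft>Snd Nat Nat\<guillemotright> (sc (pd \<guillemotleft>Snd Nat Nat\<guillemotright>))) = tr (Nat \<^bold>\<times> Nat)"
    by (rule nat_cases[where X = Nat and B = Nat]) simp_all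
  from arg_cong[OF this, of "\<lambda>z. z \<cdot> \<langle>d, d\<rangle>"]
  have *: "dj (nt d) (eqe Nat d (sc (pd d))) = tr X" using d by simp
  show ?thesis
  proof (rule dj_cases[OF * _ _ f g])
    show "pred (nt d) X" "pred (eqe Nat d (sc (pd d))) X" using d X by simp_all
    fix Y u assume u: "hom u Y X"
    show "f \<cdot> u = g \<cdot> u" if "nt d \<cdot> u = tr Y"
      by (rule 1[OF u nt_true_zero]) (use d u that in simp_all)
    show "f \<cdot> u = g \<cdot> u" if "eqe Nat d (sc (pd d)) \<cdot> u = tr Y"
      by (rule 2[OF u, of "pd (d \<cdot> u)"]) (use d u that eqe_imp_eq[of "d \<cdot> u" Y Nat "sc (pd (d \<cdot> u))"] in simp_all)
  qed
qed

lemma le_add [simp]: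
  assumes "wt x" "wt k" "src x = X" "src k = X" "tgt x = Nat" "tgt k = Nat"
  shows "le x (ad x k) = tr X"
proof -
  let ?p = "le \<guillemotleft>Fst Nat Nat\<guillemotright> \<guillemotleft>add\<guillemotright>"
  have "?p = tr (Nat \<^bold>\<times> Nat)"
  proof (rule pred_induct)
    show "pred ?p (Nat \<^bold>\<times> Nat)" by simp
    fix Y x assume x: "hom x Y Nat"
    then have Y: "T \<turnstile>\<^sub>o Y" using hom_ob by blast
    show "?p \<cdot> \<langle>x, zr Y\<rangle> = tr Y" using x Y by simp
    fix n assume n: "hom n Y Nat" and "?p \<cdot> \<langle>x, n\<rangle> = tr Y"
    then have "ms x (ad x n) = zr Y" using x Y by (intro nt_true_zero) simp_all
    then show "?p \<cdot> \<langle>x, sc n\<rangle> = tr Y" using x n Y by (simp add: ms_Succ)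
  qed
  from arg_cong[OF this, of "\<lambda>z. z \<cdot> \<langle>x, k\<rangle>"] show ?thesis using assms by simp
qed

lemma le_Succ:
  assumes "hom x X Nat" "hom y X Nat" "le x y = tr X" shows "le x (sc y) = tr X"
proof -
  have "T \<turnstile>\<^sub>o X" using assms hom_ob by blast
  moreover have "ms x y = zr X" by (rule nt_true_zero) (use assms in simp_all)
  ultimately show ?thesis using assms by (simp add: ms_Succ)
qed

text \<open>
  Linearity of the order by a single induction on \<open>n\<close>.  In place of \<open>n \<le> m\<close> the first alternative
  asserts the stronger \<open>m = n + (m - n)\<close>, which tells in the induction step whether \<open>n\<close> has reached
  \<open>m\<close> (then \<open>m + 1 \<le> n + 1\<close>) or not (then the difference decreases by one).
\<close>

lemma monus_or_less:
  assumes m: "hom m X Nat" and n: "hom n X Nat"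
  shows "dj (eqe Nat m (ad n (ms m n))) (le (sc m) n) = tr X"
proof -
  let ?m = "\<guillemotleft>Fst Nat Nat\<guillemotright>" and ?n = "\<guillemotleft>Snd Nat Nat\<guillemotright>"
  let ?p = "dj (eqe Nat ?m (ad ?n (ms ?m ?n))) (le (sc ?m) ?n)"
  have "?p = tr (Nat \<^bold>\<times> Nat)"
  proof (rule pred_induct)
    show "pred ?p (Nat \<^bold>\<times> Nat)" by simp
    fix Y m assume m: "hom m Y Nat"
    then have Y: "T \<turnstile>\<^sub>o Y" using hom_ob by blast
    show "?p \<cdot> \<langle>m, zr Y\<rangle> = tr Y" using m Y by simp
    fix n assume n: "hom n Y Nat" and IH: "?p \<cdot> \<langle>m, n\<rangle> = tr Y"
    show "?p \<cdot> \<langle>m, sc n\<rangle> = tr Y"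
    proof (rule dj_cases[where X = Y and p = "eqe Nat m (ad n (ms m n))" and q = "le (sc m) n" and B = Nat])
      show "dj (eqe Nat m (ad n (ms m n))) (le (sc m) n) = tr Y" using IH m n by simp
    next
      fix Z u assume u: "hom u Z Y" and e: "eqe Nat m (ad n (ms m n)) \<cdot> u = tr Z"
      then have Z: "T \<turnstile>\<^sub>o Z" using hom_ob by blast
      define m' n' where mn: "m' = m \<cdot> u" "n' = n \<cdot> u"
      have m': "hom m' Z Nat" and n': "hom n' Z Nat" using mn m n u by simp_all
      have e: "m' = ad n' (ms m' n')"
        by (rule eqe_imp_eq) (use e m' n' mn u m n in simp_all)
      have "?p \<cdot> \<langle>m', sc n'\<rangle> = tr Z"
      proof (rule nat_split[where d = "ms m' n'" and X = Z and B = Nat])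
        fix W v assume v: "hom v W Z" and z: "ms m' n' \<cdot> v = zr W"
        then have W: "T \<turnstile>\<^sub>o W" using hom_ob by blast
        have "m' \<cdot> v = n' \<cdot> v" using arg_cong[OF e, of "\<lambda>z. z \<cdot> v"] z m' n' v by simp
        then show "(?p \<cdot> \<langle>m', sc n'\<rangle>) \<cdot> v = tr Z \<cdot> v" using m' n' v W Z by simp
      next
        fix W v k assume v: "hom v W Z" and k: "hom k W Nat" and z: "ms m' n' \<cdot> v = sc k"
        then have W: "T \<turnstile>\<^sub>o W" using hom_ob by blast
        have "m' \<cdot> v = sc (ad (n' \<cdot> v) k)" using arg_cong[OF e, of "\<lambda>z. z \<cdot> v"] z m' n' v k by simp
        moreover have "ms (m' \<cdot> v) (sc (n' \<cdot> v)) = k" using z m' n' v k by (simp add: ms_Succ)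
        ultimately show "(?p \<cdot> \<langle>m', sc n'\<rangle>) \<cdot> v = tr Z \<cdot> v" using m' n' v k W Z by simp
      qed (use m' n' Z in simp_all)
      then show "(?p \<cdot> \<langle>m, sc n\<rangle>) \<cdot> u = tr Y \<cdot> u" using mn m n u Y by simp
    next
      fix Z u assume u: "hom u Z Y" and e: "le (sc m) n \<cdot> u = tr Z"
      then have Z: "T \<turnstile>\<^sub>o Z" using hom_ob by blast
      have "le (sc (m \<cdot> u)) (sc (n \<cdot> u)) = tr Z" by (rule le_Succ) (use u e m n in simp_all)
      then show "(?p \<cdot> \<langle>m, sc n\<rangle>) \<cdot> u = tr Y \<cdot> u" using m n u Y Z by simp
    qed (use m n Y in simp_all)
  qed
  from arg_cong[OF this, of "\<lambda>z. z \<cdot> \<langle>m, n\<rangle>"] show ?thesis using m n by simp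
qed

lemma less_or_ge:
  assumes m: "hom m X Nat" and n: "hom n X Nat" and f: "hom f X B" and g: "hom g X B"
    and 1: "\<And>Y u. hom u Y X \<Longrightarrow> le (n \<cdot> u) (m \<cdot> u) = tr Y \<Longrightarrow> f \<cdot> u = g \<cdot> u"
    and 2: "\<And>Y u. hom u Y X \<Longrightarrow> le (sc (m \<cdot> u)) (n \<cdot> u) = tr Y \<Longrightarrow> f \<cdot> u = g \<cdot> u"
  shows "f = g"
proof (rule dj_cases[OF monus_or_less[OF m n] _ _ f g])
  show "pred (eqe Nat m (ad n (ms m n))) X" "pred (le (sc m) n) X" using m n by simp_all
  fix Y u assume u: "hom u Y X"
  show "f \<cdot> u = g \<cdot> u" if "eqe Nat m (ad n (ms m n)) \<cdot> u = tr Y"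
  proof (rule 1[OF u])
    have "m \<cdot> u = ad (n \<cdot> u) (ms (m \<cdot> u) (n \<cdot> u))"
      by (rule eqe_imp_eq) (use u m n that in simp_all)
    then show "le (n \<cdot> u) (m \<cdot> u) = tr Y" 
      using le_add[of "n \<cdot> u" "ms (m \<cdot> u) (n \<cdot> u)" Y] u m n by simp
  qed
  show "f \<cdot> u = g \<cdot> u" if "le (sc m) n \<cdot> u = tr Y"
    by (rule 2[OF u]) (use u m n that in simp)
qed

end

section \<open>Quantifiers\<close>

locale quantified = calculus +
  assumes not_PRa: "T \<noteq> PRa"
begin

lemma pred_All [simp]:
  assumes "T \<turnstile> \<phi> \<Colon> A \<^bold>\<times> B \<rightarrow> \<two>"
  shows "wt \<guillemotleft>All A B \<phi>\<guillemotright>" "src \<guillemotleft>All A B \<phi>\<guillemotright> = A" "tgt \<guillemotleft>All A B \<phi>\<guillemotright> = Nat" "sg \<guillemotleft>All A B \<phi>\<guillemotright> = \<guillemotleft>All A B \<phi>\<guillemotright>"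
  using prd_iff[of "All A B \<phi>" A] prd[OF arr_All[OF not_PRa assms] sgn_All[OF not_PRa assms]] by simp_all

lemma pred_Ex [simp]:
  assumes "T \<turnstile> \<phi> \<Colon> A \<^bold>\<times> B \<rightarrow> \<two>"
  shows "wt \<guillemotleft>Ex A B \<phi>\<guillemotright>" "src \<guillemotleft>Ex A B \<phi>\<guillemotright> = A" "tgt \<guillemotleft>Ex A B \<phi>\<guillemotright> = Nat" "sg \<guillemotleft>Ex A B \<phi>\<guillemotright> = \<guillemotleft>Ex A B \<phi>\<guillemotright>"
  using prd_iff[of "Ex A B \<phi>" A] prd[OF arr_Ex[OF not_PRa assms] sgn_Ex[OF not_PRa assms]] by simp_all

text \<open>
  From right to left, the hypothesis is used at the generic element, the second projection at stage
  \<open>X \<times> B\<close>; substitution into the quantifier brings the parameter \<open>x\<close> to this stage.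
\<close>

lemma All_iff:
  assumes p: "T \<turnstile> \<phi> \<Colon> A \<^bold>\<times> B \<rightarrow> \<two>" and x: "hom x X A"
  shows "\<guillemotleft>All A B \<phi>\<guillemotright> \<cdot> x = tr X \<longleftrightarrow>
    (\<forall>Y u b. hom u Y X \<longrightarrow> hom b Y B \<longrightarrow> \<guillemotleft>\<phi>\<guillemotright> \<cdot> \<langle>x \<cdot> u, b\<rangle> = tr Y)"
proof
  have ph: "pred \<guillemotleft>\<phi>\<guillemotright> (A \<^bold>\<times> B)" using p prd_iff by blast
  have o: "T \<turnstile>\<^sub>o A" "T \<turnstile>\<^sub>o B" "T \<turnstile>\<^sub>o X" using hom_ob[of "\<guillemotleft>\<phi>\<guillemotright>" "A \<^bold>\<times> B" Nat] ph hom_ob[OF x] by simp_all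
  show "\<forall>Y u b. hom u Y X \<longrightarrow> hom b Y B \<longrightarrow> \<guillemotleft>\<phi>\<guillemotright> \<cdot> \<langle>x \<cdot> u, b\<rangle> = tr Y"
    if a: "\<guillemotleft>All A B \<phi>\<guillemotright> \<cdot> x = tr X"
  proof (intro allI impI)
    fix Y u b assume u: "hom u Y X" "hom b Y B"
    then have Y: "T \<turnstile>\<^sub>o Y" using hom_ob by blast
    have "im (\<guillemotleft>All A B \<phi>\<guillemotright> \<cdot> \<guillemotleft>Fst A B\<guillemotright>) \<guillemotleft>\<phi>\<guillemotright> = tr (A \<^bold>\<times> B)"
      using true_cls_iff[of "All A B \<phi> \<odot> Fst A B \<^bold>\<longrightarrow> \<phi>" "A \<^bold>\<times> B"] All_elim[OF not_PRa p] ph o p by simp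
    from arg_cong[OF this, of "\<lambda>z. z \<cdot> \<langle>x \<cdot> u, b\<rangle>"] arg_cong[OF a, of "\<lambda>z. z \<cdot> u"]
    show "\<guillemotleft>\<phi>\<guillemotright> \<cdot> \<langle>x \<cdot> u, b\<rangle> = tr Y" using ph p u x o Y by simp
  qed
  assume a: "\<forall>Y u b. hom u Y X \<longrightarrow> hom b Y B \<longrightarrow> \<guillemotleft>\<phi>\<guillemotright> \<cdot> \<langle>x \<cdot> u, b\<rangle> = tr Y"
  obtain tx where tx: "T \<turnstile> tx \<Colon> X \<rightarrow> A" "x = \<guillemotleft>tx\<guillemotright>" using x by (rule homE)
  let ?c = "\<phi> \<odot> cross X B tx (Id B)"
  have c: "\<guillemotleft>?c\<guillemotright> = \<guillemotleft>\<phi>\<guillemotright> \<cdot> \<langle>x \<cdot> \<guillemotleft>Fst X B\<guillemotright>, \<guillemotleft>Snd X B\<guillemotright>\<rangle>" using tx o by simp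
  have pc: "T \<turnstile> ?c \<Colon> X \<^bold>\<times> B \<rightarrow> \<two>" unfolding prd_iff c using ph x o by simp
  have "\<guillemotleft>?c\<guillemotright> = tr (X \<^bold>\<times> B)"
    unfolding c using a[rule_format, of "\<guillemotleft>Fst X B\<guillemotright>" "X \<^bold>\<times> B" "\<guillemotleft>Snd X B\<guillemotright>"] o by simp
  then have "\<guillemotleft>true X \<odot> Fst X B \<^bold>\<longrightarrow> ?c\<guillemotright> = tr (X \<^bold>\<times> B)" using o by (simp del: cls_Comp cls_cross) simp
  then have "T \<turnstile> (true X \<odot> Fst X B \<^bold>\<longrightarrow> ?c) \<approx> true (X \<^bold>\<times> B) \<Colon> X \<^bold>\<times> B \<rightarrow> Nat"
    using true_cls_iff[of "true X \<odot> Fst X B \<^bold>\<longrightarrow> ?c" "X \<^bold>\<times> B"] o by simp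
  moreover have "T \<turnstile> true X \<Colon> X \<rightarrow> \<two>" using o by (simp add: prd_iff)
  ultimately have "T \<turnstile> (true X \<^bold>\<longrightarrow> All X B ?c) \<approx> true X \<Colon> X \<rightarrow> Nat"
    using All_intro[OF not_PRa pc] by blast
  then have "\<guillemotleft>All X B ?c\<guillemotright> = tr X"
    using true_cls_iff[of "true X \<^bold>\<longrightarrow> All X B ?c" X] o pred_All[OF pc] by simp
  moreover have "\<guillemotleft>All A B \<phi> \<odot> tx\<guillemotright> = \<guillemotleft>All X B ?c\<guillemotright>"
    by (rule cls_eqI[OF arr_Comp[OF tx(1) arr_All[OF not_PRa p]] arr_All[OF not_PRa pc] All_subst[OF not_PRa p tx(1)]])
  ultimately show "\<guillemotleft>All A B \<phi>\<guillemotright> \<cdot> x = tr X" using tx(2) by simp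
qed

lemma Ex_I:
  assumes p: "T \<turnstile> \<phi> \<Colon> A \<^bold>\<times> B \<rightarrow> \<two>" and x: "hom x X A" and b: "hom b X B" and t: "\<guillemotleft>\<phi>\<guillemotright> \<cdot> \<langle>x, b\<rangle> = tr X"
  shows "\<guillemotleft>Ex A B \<phi>\<guillemotright> \<cdot> x = tr X"
proof -
  have ph: "pred \<guillemotleft>\<phi>\<guillemotright> (A \<^bold>\<times> B)" using p prd_iff by blast
  have o: "T \<turnstile>\<^sub>o A" "T \<turnstile>\<^sub>o B" "T \<turnstile>\<^sub>o X" using hom_ob[of "\<guillemotleft>\<phi>\<guillemotright>" "A \<^bold>\<times> B" Nat] ph hom_ob[OF x] by simp_all
  have "im \<guillemotleft>\<phi>\<guillemotright> (\<guillemotleft>Ex A B \<phi>\<guillemotright> \<cdot> \<guillemotleft>Fst A B\<guillemotright>) = tr (A \<^bold>\<times> B)"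
    using true_cls_iff[of "\<phi> \<^bold>\<longrightarrow> Ex A B \<phi> \<odot> Fst A B" "A \<^bold>\<times> B"] Ex_intro[OF not_PRa p] ph o p by simp
  from arg_cong[OF this, of "\<lambda>z. z \<cdot> \<langle>x, b\<rangle>"] show ?thesis using ph p b x o t by simp
qed

text \<open>
  The elimination rule is restricted to predicates; it extends to equations by way of the
  equality predicate of \<open>f\<close> and \<open>g\<close>.
\<close>

lemma Ex_E:
  assumes p: "T \<turnstile> \<phi> \<Colon> A \<^bold>\<times> B \<rightarrow> \<two>" and x: "hom x X A" and t: "\<guillemotleft>Ex A B \<phi>\<guillemotright> \<cdot> x = tr X"
    and f: "hom f X C" and g: "hom g X C"
    and 1: "\<And>Y u b. hom u Y X \<Longrightarrow> hom b Y B \<Longrightarrow> \<guillemotleft>\<phi>\<guillemotright> \<cdot> \<langle>x \<cdot> u, b\<rangle> = tr Y \<Longrightarrow> f \<cdot> u = g \<cdot> u"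
  shows "f = g"
proof (rule eqe_imp_eq[OF f g])
  have ph: "pred \<guillemotleft>\<phi>\<guillemotright> (A \<^bold>\<times> B)" using p prd_iff by blast
  have o: "T \<turnstile>\<^sub>o A" "T \<turnstile>\<^sub>o B" "T \<turnstile>\<^sub>o X" "T \<turnstile>\<^sub>o C"
    using hom_ob[of "\<guillemotleft>\<phi>\<guillemotright>" "A \<^bold>\<times> B" Nat] ph hom_ob[OF x] hom_ob[OF f] by simp_all
  obtain tx where tx: "T \<turnstile> tx \<Colon> X \<rightarrow> A" "x = \<guillemotleft>tx\<guillemotright>" using x by (rule homE)
  have e: "pred (eqe C f g) X" using f g o by simp
  then obtain \<psi> where s: "T \<turnstile> \<psi> \<Colon> X \<rightarrow> \<two>" "eqe C f g = \<guillemotleft>\<psi>\<guillemotright>" by (rule predE)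
  let ?c = "\<phi> \<odot> cross X B tx (Id B)"
  have c: "\<guillemotleft>?c\<guillemotright> = \<guillemotleft>\<phi>\<guillemotright> \<cdot> \<langle>x \<cdot> \<guillemotleft>Fst X B\<guillemotright>, \<guillemotleft>Snd X B\<guillemotright>\<rangle>" using tx o by simp
  have pc: "T \<turnstile> ?c \<Colon> X \<^bold>\<times> B \<rightarrow> \<two>" unfolding prd_iff c using ph x o by simp
  have "im \<guillemotleft>?c\<guillemotright> (eqe C f g \<cdot> \<guillemotleft>Fst X B\<guillemotright>) = tr (X \<^bold>\<times> B)"
  proof (rule iffD2[OF im_iff], goal_cases)
    case 1 show ?case using pc prd_iff by blast
  next
    case 2 show ?case using e o f g by simp
  next
    case 3
    show ?case
    proof (intro allI impI)
      fix Y u assume u: "hom u Y (X \<^bold>\<times> B)" and cu: "\<guillemotleft>?c\<guillemotright> \<cdot> u = tr Y"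
      have "\<guillemotleft>\<phi>\<guillemotright> \<cdot> \<langle>x \<cdot> \<guillemotleft>Fst X B\<guillemotright> \<cdot> u, \<guillemotleft>Snd X B\<guillemotright> \<cdot> u\<rangle> = tr Y" using cu[unfolded c] u by simp
      from assms(6)[OF _ _ this] have "f \<cdot> \<guillemotleft>Fst X B\<guillemotright> \<cdot> u = g \<cdot> \<guillemotleft>Fst X B\<guillemotright> \<cdot> u" using u o by simp
      then show "(eqe C f g \<cdot> \<guillemotleft>Fst X B\<guillemotright>) \<cdot> u = tr Y" using u f g o by simp
    qed
  qed
  moreover have "pred \<guillemotleft>?c\<guillemotright> (X \<^bold>\<times> B)" using pc prd_iff by blast
  ultimately have "T \<turnstile> (?c \<^bold>\<longrightarrow> \<psi> \<odot> Fst X B) \<approx> true (X \<^bold>\<times> B) \<Colon> X \<^bold>\<times> B \<rightarrow> Nat"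
    using true_cls_iff[of "?c \<^bold>\<longrightarrow> \<psi> \<odot> Fst X B" "X \<^bold>\<times> B"] o s ph x tx by simp
  from Ex_elim[OF not_PRa pc s(1) this]
  have "im \<guillemotleft>Ex X B ?c\<guillemotright> (eqe C f g) = tr X"
    using true_cls_iff[of "Ex X B ?c \<^bold>\<longrightarrow> \<psi>" X] o pred_Ex[OF pc] s(2) e by simp
  moreover have "\<guillemotleft>Ex A B \<phi> \<odot> tx\<guillemotright> = \<guillemotleft>Ex X B ?c\<guillemotright>"
    by (rule cls_eqI[OF arr_Comp[OF tx(1) arr_Ex[OF not_PRa p]] arr_Ex[OF not_PRa pc] Ex_subst[OF not_PRa p tx(1)]])
  then have "\<guillemotleft>Ex X B ?c\<guillemotright> = tr X" using t tx(2) by simp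
  ultimately show "eqe C f g = tr X" using e o by simp
qed

text \<open>
  The scope of the inner quantifier of unique existence, a predicate of \<open>((a,b),b')\<close>.
\<close>

abbreviation uniq where
  "uniq A B \<delta> \<equiv>
     (\<delta> \<odot> \<^bold>\<langle>Fst A B \<odot> Fst (A \<^bold>\<times> B) B, Snd (A \<^bold>\<times> B) B\<^bold>\<rangle>
      \<^bold>\<longrightarrow> equ B (Snd (A \<^bold>\<times> B) B) (Snd A B \<odot> Fst (A \<^bold>\<times> B) B))"

lemma Ex1_eq: "Ex1 A B \<delta> = Ex A B (\<delta> \<^bold>\<and> All (A \<^bold>\<times> B) B (uniq A B \<delta>))"
  by (simp add: Ex1_def Let_def)

lemma prd_uniq:
  assumes p: "T \<turnstile> \<delta> \<Colon> A \<^bold>\<times> B \<rightarrow> \<two>"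
  shows "T \<turnstile> uniq A B \<delta> \<Colon> (A \<^bold>\<times> B) \<^bold>\<times> B \<rightarrow> \<two>"
proof -
  have d: "pred \<guillemotleft>\<delta>\<guillemotright> (A \<^bold>\<times> B)" using p prd_iff by blast
  then have "T \<turnstile>\<^sub>o A" "T \<turnstile>\<^sub>o B" using hom_ob[of "\<guillemotleft>\<delta>\<guillemotright>" "A \<^bold>\<times> B" Nat] by simp_all
  then show ?thesis using d by (simp add: prd_iff)
qed

lemma prd_Ex1_body:
  assumes p: "T \<turnstile> \<delta> \<Colon> A \<^bold>\<times> B \<rightarrow> \<two>"
  shows "T \<turnstile> \<delta> \<^bold>\<and> All (A \<^bold>\<times> B) B (uniq A B \<delta>) \<Colon> A \<^bold>\<times> B \<rightarrow> \<two>"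
  using p pred_All[OF prd_uniq[OF p]] unfolding prd_iff cls_conj by simp

lemma hom_Ex1: "T \<turnstile> \<delta> \<Colon> A \<^bold>\<times> B \<rightarrow> \<two> \<Longrightarrow> hom \<guillemotleft>Ex1 A B \<delta>\<guillemotright> A Nat"
  using pred_Ex[OF prd_Ex1_body] unfolding Ex1_eq by blast

lemma Ex1_I:
  assumes p: "T \<turnstile> \<delta> \<Colon> A \<^bold>\<times> B \<rightarrow> \<two>" and x: "hom x X A" and m: "hom m X B"
    and t: "\<guillemotleft>\<delta>\<guillemotright> \<cdot> \<langle>x, m\<rangle> = tr X"
    and uniq: "\<And>Y u b. hom u Y X \<Longrightarrow> hom b Y B \<Longrightarrow> \<guillemotleft>\<delta>\<guillemotright> \<cdot> \<langle>x \<cdot> u, b\<rangle> = tr Y \<Longrightarrow> b = m \<cdot> u"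
  shows "\<guillemotleft>Ex1 A B \<delta>\<guillemotright> \<cdot> x = tr X"
proof -
  have d: "pred \<guillemotleft>\<delta>\<guillemotright> (A \<^bold>\<times> B)" using p prd_iff by blast
  have o: "T \<turnstile>\<^sub>o A" "T \<turnstile>\<^sub>o B" "T \<turnstile>\<^sub>o X" using hom_ob[of "\<guillemotleft>\<delta>\<guillemotright>" "A \<^bold>\<times> B" Nat] d hom_ob[OF x] by simp_all
  let ?P = "A \<^bold>\<times> B"
  let ?u = "uniq A B \<delta>"
  note u = prd_uniq[OF p]
  have "\<guillemotleft>All ?P B ?u\<guillemotright> \<cdot> \<langle>x, m\<rangle> = tr X"
  proof (rule iffD2[OF All_iff[OF u]])
    show "hom \<langle>x, m\<rangle> X ?P" using x m by simp
    show "\<forall>Y v b. hom v Y X \<longrightarrow> hom b Y B \<longrightarrow> \<guillemotleft>?u\<guillemotright> \<cdot> \<langle>\<langle>x, m\<rangle> \<cdot> v, b\<rangle> = tr Y"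
    proof (intro allI impI)
      fix Y v b assume v: "hom v Y X" and b: "hom b Y B"
      then have Y: "T \<turnstile>\<^sub>o Y" using hom_ob by blast
      have "im (\<guillemotleft>\<delta>\<guillemotright> \<cdot> \<langle>x \<cdot> v, b\<rangle>) (eqe B b (m \<cdot> v)) = tr Y"
      proof (rule iffD2[OF im_iff])
        show "\<forall>Z w. hom w Z Y \<longrightarrow> (\<guillemotleft>\<delta>\<guillemotright> \<cdot> \<langle>x \<cdot> v, b\<rangle>) \<cdot> w = tr Z \<longrightarrow> eqe B b (m \<cdot> v) \<cdot> w = tr Z"
        proof (intro allI impI)
          fix Z w assume w: "hom w Z Y" and "(\<guillemotleft>\<delta>\<guillemotright> \<cdot> \<langle>x \<cdot> v, b\<rangle>) \<cdot> w = tr Z"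
          then have "b \<cdot> w = m \<cdot> v \<cdot> w" using uniq[of "v \<cdot> w" Z "b \<cdot> w"] x v b w by simp
          then show "eqe B b (m \<cdot> v) \<cdot> w = tr Z" using w v b m by simp
        qed
      qed (use d x v b m o in simp_all)
      then show "\<guillemotleft>?u\<guillemotright> \<cdot> \<langle>\<langle>x, m\<rangle> \<cdot> v, b\<rangle> = tr Y" using x m v b o by simp
    qed
  qed
  then have "\<guillemotleft>\<delta> \<^bold>\<and> All ?P B ?u\<guillemotright> \<cdot> \<langle>x, m\<rangle> = tr X"
    unfolding cls_conj using t pred_All[OF u] d x m o by (simp del: cls_impl)
  from Ex_I[OF prd_Ex1_body[OF p] x m this] show ?thesis unfolding Ex1_eq .
qed

end

section \<open>Bounded search and least elements\<close>

locale minimization = quantified +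
  fixes A :: obj and \<phi> :: trm
  assumes prd_phi: "T \<turnstile> \<phi> \<Colon> A \<^bold>\<times> Nat \<rightarrow> \<two>"
begin

abbreviation bm where "bm \<equiv> \<guillemotleft>bounded_min A \<phi>\<guillemotright>"

lemma pred_phi [simp]: "wt \<guillemotleft>\<phi>\<guillemotright>" "src \<guillemotleft>\<phi>\<guillemotright> = A \<^bold>\<times> Nat" "tgt \<guillemotleft>\<phi>\<guillemotright> = Nat" "sg \<guillemotleft>\<phi>\<guillemotright> = \<guillemotleft>\<phi>\<guillemotright>"
  using prd_phi prd_iff by blast+

lemma ob_A [simp]: "T \<turnstile>\<^sub>o A" using hom_ob(1)[of "\<guillemotleft>\<phi>\<guillemotright>" "A \<^bold>\<times> Nat" Nat] by simp

abbreviation step where "step \<equiv> \<^bold>\<langle>Fst A Nat, add \<odot> \<^bold>\<langle>Snd A Nat, \<^bold>\<not> \<phi>\<^bold>\<rangle>\<^bold>\<rangle>"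

lemma hom_bm [simp]: "wt bm" "src bm = A \<^bold>\<times> Nat" "tgt bm = Nat"
  by (simp_all add: bounded_min_def)

lemma bm_eq: "hom a X A \<Longrightarrow> hom n X Nat \<Longrightarrow> bm \<cdot> \<langle>a, n\<rangle> = \<guillemotleft>Snd A Nat\<guillemotright> \<cdot> \<guillemotleft>Iter step\<guillemotright> \<cdot> \<langle>\<langle>a, zr X\<rangle>, n\<rangle>"
  by (simp add: bounded_min_def)

lemma bm_zero: "hom a X A \<Longrightarrow> bm \<cdot> \<langle>a, zr X\<rangle> = zr X"
  using hom_ob(1)[of a X A] by (simp add: bm_eq)

text \<open>
  The iteration leaves the parameter \<open>a\<close> fixed, so its state after \<open>n\<close> steps is the pair of \<open>a\<close> and
  the value of the search.
\<close>

lemma bm_Succ: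
  assumes a: "hom a X A" and n: "hom n X Nat"
  shows "bm \<cdot> \<langle>a, sc n\<rangle> = ad (bm \<cdot> \<langle>a, n\<rangle>) (nt (\<guillemotleft>\<phi>\<guillemotright> \<cdot> \<langle>a, bm \<cdot> \<langle>a, n\<rangle>\<rangle>))"
proof -
  have X: "T \<turnstile>\<^sub>o X" using hom_ob a by blast
  have "\<guillemotleft>Fst A Nat\<guillemotright> \<cdot> \<guillemotleft>Iter step\<guillemotright> = \<guillemotleft>Fst A Nat\<guillemotright> \<cdot> \<guillemotleft>Fst (A \<^bold>\<times> Nat) Nat\<guillemotright>"
    by (rule iter_unique[where g = "\<guillemotleft>Id A\<guillemotright>" and X = "A \<^bold>\<times> Nat" and B = A]) simp_all
  from arg_cong[OF this, of "\<lambda>z. z \<cdot> \<langle>\<langle>a, zr X\<rangle>, n\<rangle>"]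
  have "\<guillemotleft>Fst A Nat\<guillemotright> \<cdot> \<guillemotleft>Iter step\<guillemotright> \<cdot> \<langle>\<langle>a, zr X\<rangle>, n\<rangle> = a" using a n X by simp
  then have "\<guillemotleft>Iter step\<guillemotright> \<cdot> \<langle>\<langle>a, zr X\<rangle>, n\<rangle> = \<langle>a, bm \<cdot> \<langle>a, n\<rangle>\<rangle>"
    using pair_eta[of "\<guillemotleft>Iter step\<guillemotright> \<cdot> \<langle>\<langle>a, zr X\<rangle>, n\<rangle>" A Nat] a n X by (simp add: bm_eq)
  then show ?thesis using a n X by (simp add: bm_eq)
qed

text \<open>
  The search advances by one in every step until it meets a place where \<open>\<phi>\<close> holds.
\<close>

lemma bm_stationary:
  assumes a: "hom a X A" and n: "hom n X Nat"
  shows "dj (\<guillemotleft>\<phi>\<guillemotright> \<cdot> \<langle>a, bm \<cdot> \<langle>a, n\<rangle>\<rangle>) (eqe Nat (bm \<cdot> \<langle>a, n\<rangle>) n) = tr X"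
proof -
  let ?p = "dj (\<guillemotleft>\<phi>\<guillemotright> \<cdot> \<langle>\<guillemotleft>Fst A Nat\<guillemotright>, bm\<rangle>) (eqe Nat bm \<guillemotleft>Snd A Nat\<guillemotright>)"
  have "?p = tr (A \<^bold>\<times> Nat)"
  proof (rule pred_induct)
    show "pred ?p (A \<^bold>\<times> Nat)" by simp
    fix Y a assume a: "hom a Y A"
    then have Y: "T \<turnstile>\<^sub>o Y" using hom_ob by blast
    show "?p \<cdot> \<langle>a, zr Y\<rangle> = tr Y" using a Y by (simp add: bm_zero)
    fix n assume n: "hom n Y Nat" and IH: "?p \<cdot> \<langle>a, n\<rangle> = tr Y"
    let ?b = "bm \<cdot> \<langle>a, n\<rangle>"
    show "?p \<cdot> \<langle>a, sc n\<rangle> = tr Y"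
    proof (rule pred_cases[where p = "\<guillemotleft>\<phi>\<guillemotright> \<cdot> \<langle>a, ?b\<rangle>" and X = Y and B = Nat])
      fix Z u assume u: "hom u Z Y" and t: "(\<guillemotleft>\<phi>\<guillemotright> \<cdot> \<langle>a, ?b\<rangle>) \<cdot> u = tr Z"
      then have Z: "T \<turnstile>\<^sub>o Z" using hom_ob by blast
      show "(?p \<cdot> \<langle>a, sc n\<rangle>) \<cdot> u = tr Y \<cdot> u"
        using t a n u Z Y bm_Succ[of "a \<cdot> u" Z "n \<cdot> u"] by simp
    next
      fix Z u assume u: "hom u Z Y" and t: "(\<guillemotleft>\<phi>\<guillemotright> \<cdot> \<langle>a, ?b\<rangle>) \<cdot> u = zr Z"
      then have Z: "T \<turnstile>\<^sub>o Z" using hom_ob by blast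
      have "eqe Nat (?b \<cdot> u) (n \<cdot> u) = tr Z" using arg_cong[OF IH, of "\<lambda>z. z \<cdot> u"] t a n u Z Y by simp
      then have "?b \<cdot> u = n \<cdot> u" by (rule eqe_imp_eq[rotated 2]) (use a n u in simp_all)
      then show "(?p \<cdot> \<langle>a, sc n\<rangle>) \<cdot> u = tr Y \<cdot> u"
        using t a n u Z Y bm_Succ[of "a \<cdot> u" Z "n \<cdot> u"] by simp
    qed (use a n Y in simp_all)
  qed
  from arg_cong[OF this, of "\<lambda>z. z \<cdot> \<langle>a, n\<rangle>"] show ?thesis using a n by simp
qed

lemma phi_bm:
  assumes a: "hom a X A" and n: "hom n X Nat" and t: "\<guillemotleft>\<phi>\<guillemotright> \<cdot> \<langle>a, n\<rangle> = tr X"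
  shows "\<guillemotleft>\<phi>\<guillemotright> \<cdot> \<langle>a, bm \<cdot> \<langle>a, n\<rangle>\<rangle> = tr X"
proof (rule dj_cases[OF bm_stationary[OF a n], where B = Nat])
  have X: "T \<turnstile>\<^sub>o X" using hom_ob a by blast
  let ?b = "bm \<cdot> \<langle>a, n\<rangle>"
  show "pred (\<guillemotleft>\<phi>\<guillemotright> \<cdot> \<langle>a, ?b\<rangle>) X" "hom (\<guillemotleft>\<phi>\<guillemotright> \<cdot> \<langle>a, ?b\<rangle>) X Nat" "pred (eqe Nat ?b n) X" "hom (tr X) X Nat"
    using a n X by simp_all
  fix Y u assume u: "hom u Y X"
  then have Y: "T \<turnstile>\<^sub>o Y" using hom_ob by blast
  show "(\<guillemotleft>\<phi>\<guillemotright> \<cdot> \<langle>a, ?b\<rangle>) \<cdot> u = tr X \<cdot> u" if "(\<guillemotleft>\<phi>\<guillemotright> \<cdot> \<langle>a, ?b\<rangle>) \<cdot> u = tr Y" using that u X by simp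
  assume "eqe Nat ?b n \<cdot> u = tr Y"
  then have "?b \<cdot> u = n \<cdot> u" by (intro eqe_imp_eq[of "?b \<cdot> u" Y Nat "n \<cdot> u"]) (use a n u in simp_all)
  then show "(\<guillemotleft>\<phi>\<guillemotright> \<cdot> \<langle>a, ?b\<rangle>) \<cdot> u = tr X \<cdot> u" using arg_cong[OF t, of "\<lambda>z. z \<cdot> u"] a n u X by simp
qed

text \<open>
  By induction on \<open>n\<close>, for a fixed place \<open>m\<close> where \<open>\<phi>\<close> holds: a search at \<open>m\<close> has stopped, and a
  search below \<open>m\<close> advances by at most one.
\<close>

lemma bm_le:
  assumes a: "hom a X A" and n: "hom n X Nat" and m: "hom m X Nat" and t: "\<guillemotleft>\<phi>\<guillemotright> \<cdot> \<langle>a, m\<rangle> = tr X"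
  shows "le (bm \<cdot> \<langle>a, n\<rangle>) m = tr X"
proof -
  have X: "T \<turnstile>\<^sub>o X" using hom_ob a by blast
  let ?a = "a \<cdot> \<guillemotleft>Fst X Nat\<guillemotright>" and ?m = "m \<cdot> \<guillemotleft>Fst X Nat\<guillemotright>" and ?n = "\<guillemotleft>Snd X Nat\<guillemotright>"
  let ?p = "le (bm \<cdot> \<langle>?a, ?n\<rangle>) ?m"
  have "?p = tr (X \<^bold>\<times> Nat)"
  proof (rule pred_induct)
    show "pred ?p (X \<^bold>\<times> Nat)" using a m X by simp
    fix Y x assume x: "hom x Y X"
    then have Y: "T \<turnstile>\<^sub>o Y" using hom_ob by blast
    show "?p \<cdot> \<langle>x, zr Y\<rangle> = tr Y" using a m x X Y by (simp add: bm_zero)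
    fix n assume n: "hom n Y Nat" and IH: "?p \<cdot> \<langle>x, n\<rangle> = tr Y"
    let ?ax = "a \<cdot> x" and ?mx = "m \<cdot> x" let ?b = "bm \<cdot> \<langle>?ax, n\<rangle>"
    have IH: "le ?b ?mx = tr Y" using IH a m x n X Y by simp
    have t: "\<guillemotleft>\<phi>\<guillemotright> \<cdot> \<langle>?ax, ?mx\<rangle> = tr Y" using arg_cong[OF t, of "\<lambda>z. z \<cdot> x"] a m x X by simp
    have "le (bm \<cdot> \<langle>?ax, sc n\<rangle>) ?mx = tr Y"
    proof (rule less_or_ge[where m = ?b and n = ?mx and B = Nat])
      fix Z u assume u: "hom u Z Y" and l: "le (?mx \<cdot> u) (?b \<cdot> u) = tr Z"
      then have Z: "T \<turnstile>\<^sub>o Z" using hom_ob by blast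
      have "?b \<cdot> u = ?mx \<cdot> u" 
        by (rule le_antisym[of _ Z]) (use l arg_cong[OF IH, of "\<lambda>z. z \<cdot> u"] a m x n u Y in simp_all)
      then show "le (bm \<cdot> \<langle>?ax, sc n\<rangle>) ?mx \<cdot> u = tr Y \<cdot> u"
        using bm_Succ[of "a \<cdot> x \<cdot> u" Z "n \<cdot> u"] arg_cong[OF t, of "\<lambda>z. z \<cdot> u"] a m x n u Y Z by simp
    next
      fix Z u assume u: "hom u Z Y" and l: "le (sc (?b \<cdot> u)) (?mx \<cdot> u) = tr Z"
      then have Z: "T \<turnstile>\<^sub>o Z" using hom_ob by blast
      let ?c = "\<guillemotleft>\<phi>\<guillemotright> \<cdot> \<langle>?ax \<cdot> u, ?b \<cdot> u\<rangle>"
      have "le (ad (?b \<cdot> u) (nt ?c)) (?mx \<cdot> u) = tr Z"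
      proof (rule pred_cases[where p = ?c and X = Z and B = Nat])
        fix W v assume v: "hom v W Z" 
        then have W: "T \<turnstile>\<^sub>o W" using hom_ob by blast
        show "le (ad (?b \<cdot> u) (nt ?c)) (?mx \<cdot> u) \<cdot> v = tr Z \<cdot> v" if "?c \<cdot> v = tr W"
          using that arg_cong[OF IH, of "\<lambda>z. z \<cdot> u \<cdot> v"] a m x n u v Y Z W by simp
        show "le (ad (?b \<cdot> u) (nt ?c)) (?mx \<cdot> u) \<cdot> v = tr Z \<cdot> v" if "?c \<cdot> v = zr W"
          using that arg_cong[OF l, of "\<lambda>z. z \<cdot> v"] a m x n u v Y Z W by simp
      qed (use a m x n u Z in simp_all)
      then show "le (bm \<cdot> \<langle>?ax, sc n\<rangle>) ?mx \<cdot> u = tr Y \<cdot> u"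
        using bm_Succ[of "a \<cdot> x \<cdot> u" Z "n \<cdot> u"] a m x n u Y Z by simp
    qed (use a m x n Y in simp_all)
    then show "?p \<cdot> \<langle>x, sc n\<rangle> = tr Y" using a m x n X Y by simp
  qed
  from arg_cong[OF this, of "\<lambda>z. z \<cdot> \<langle>\<guillemotleft>Id X\<guillemotright>, n\<rangle>"] show ?thesis using a m n X by simp
qed

lemma prd_is_min: "T \<turnstile> is_min A \<phi> \<Colon> A \<^bold>\<times> Nat \<rightarrow> \<two>"
  and is_min_iff: "hom a X A \<Longrightarrow> hom m X Nat \<Longrightarrow> \<guillemotleft>is_min A \<phi>\<guillemotright> \<cdot> \<langle>a, m\<rangle> = tr X \<longleftrightarrow>
    \<guillemotleft>\<phi>\<guillemotright> \<cdot> \<langle>a, m\<rangle> = tr X \<and>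
    (\<forall>Y u n. hom u Y X \<longrightarrow> hom n Y Nat \<longrightarrow> \<guillemotleft>\<phi>\<guillemotright> \<cdot> \<langle>a \<cdot> u, n\<rangle> = tr Y \<longrightarrow> le (m \<cdot> u) n = tr Y)"
proof -
  let ?Y = "A \<^bold>\<times> Nat"
  let ?c = "\<phi> \<odot> \<^bold>\<langle>Fst A Nat \<odot> Fst ?Y Nat, Snd ?Y Nat\<^bold>\<rangle> \<^bold>\<longrightarrow> Snd A Nat \<odot> Fst ?Y Nat \<^bold>\<le> Snd ?Y Nat"
  have d: "is_min A \<phi> = (\<phi> \<^bold>\<and> All ?Y Nat ?c)" by (simp add: is_min_def Let_def)
  have c: "T \<turnstile> ?c \<Colon> ?Y \<^bold>\<times> Nat \<rightarrow> \<two>" by (simp add: prd_iff)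
  show "T \<turnstile> is_min A \<phi> \<Colon> A \<^bold>\<times> Nat \<rightarrow> \<two>"
    unfolding prd_iff d cls_conj using pred_All[OF c] by simp
  assume a: "hom a X A" and m: "hom m X Nat"
  then have X: "T \<turnstile>\<^sub>o X" using hom_ob by blast
  have "\<guillemotleft>is_min A \<phi>\<guillemotright> \<cdot> \<langle>a, m\<rangle> = cj (\<guillemotleft>\<phi>\<guillemotright> \<cdot> \<langle>a, m\<rangle>) (\<guillemotleft>All ?Y Nat ?c\<guillemotright> \<cdot> \<langle>a, m\<rangle>)"
    unfolding d cls_conj using a m by simp
  moreover have "\<guillemotleft>All ?Y Nat ?c\<guillemotright> \<cdot> \<langle>a, m\<rangle> = tr X \<longleftrightarrow>
    (\<forall>Y u n. hom u Y X \<longrightarrow> hom n Y Nat \<longrightarrow> \<guillemotleft>\<phi>\<guillemotright> \<cdot> \<langle>a \<cdot> u, n\<rangle> = tr Y \<longrightarrow> le (m \<cdot> u) n = tr Y)"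
    (is "_ \<longleftrightarrow> ?R")
  proof -
    have "\<guillemotleft>All ?Y Nat ?c\<guillemotright> \<cdot> \<langle>a, m\<rangle> = tr X \<longleftrightarrow>
      (\<forall>Y u n. hom u Y X \<longrightarrow> hom n Y Nat \<longrightarrow> \<guillemotleft>?c\<guillemotright> \<cdot> \<langle>\<langle>a, m\<rangle> \<cdot> u, n\<rangle> = tr Y)"
      by (rule All_iff[OF c]) (use a m in simp)
    also have "\<dots> \<longleftrightarrow> (\<forall>Y u n. hom u Y X \<longrightarrow> hom n Y Nat \<longrightarrow>
        im (\<guillemotleft>\<phi>\<guillemotright> \<cdot> \<langle>a \<cdot> u, n\<rangle>) (le (m \<cdot> u) n) = tr Y)"
      using a m by simp
    also have "\<dots> \<longleftrightarrow> ?R"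
    proof (intro iffI allI impI)
      fix Y u n assume h: "\<forall>Y u n. hom u Y X \<longrightarrow> hom n Y Nat \<longrightarrow> im (\<guillemotleft>\<phi>\<guillemotright> \<cdot> \<langle>a \<cdot> u, n\<rangle>) (le (m \<cdot> u) n) = tr Y"
        and u: "hom u Y X" and n: "hom n Y Nat" and t: "\<guillemotleft>\<phi>\<guillemotright> \<cdot> \<langle>a \<cdot> u, n\<rangle> = tr Y"
      have "T \<turnstile>\<^sub>o Y" using u hom_ob by blast
      then show "le (m \<cdot> u) n = tr Y" using h[rule_format, OF u n] t a m u n by simp
    next
      fix Y u n assume h: ?R and u: "hom u Y X" and n: "hom n Y Nat"
      show "im (\<guillemotleft>\<phi>\<guillemotright> \<cdot> \<langle>a \<cdot> u, n\<rangle>) (le (m \<cdot> u) n) = tr Y"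
      proof (rule iffD2[OF im_iff])
        show "\<forall>Z v. hom v Z Y \<longrightarrow> (\<guillemotleft>\<phi>\<guillemotright> \<cdot> \<langle>a \<cdot> u, n\<rangle>) \<cdot> v = tr Z \<longrightarrow> le (m \<cdot> u) n \<cdot> v = tr Z"
        proof (intro allI impI)
          fix Z v assume v: "hom v Z Y" and t: "(\<guillemotleft>\<phi>\<guillemotright> \<cdot> \<langle>a \<cdot> u, n\<rangle>) \<cdot> v = tr Z"
          have "le (m \<cdot> u \<cdot> v) (n \<cdot> v) = tr Z"
            by (rule h[rule_format, of "u \<cdot> v"]) (use u v n a t in simp_all)
          then show "le (m \<cdot> u) n \<cdot> v = tr Z" using v u n m by simp
        qed
      qed (use a m u n in simp_all)
    qed
    finally show ?thesis .
  qed
  ultimately show "\<guillemotleft>is_min A \<phi>\<guillemotright> \<cdot> \<langle>a, m\<rangle> = tr X \<longleftrightarrow> \<guillemotleft>\<phi>\<guillemotright> \<cdot> \<langle>a, m\<rangle> = tr X \<and> ?R"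
    using cj_iff[of "\<guillemotleft>\<phi>\<guillemotright> \<cdot> \<langle>a, m\<rangle>" X "\<guillemotleft>All ?Y Nat ?c\<guillemotright> \<cdot> \<langle>a, m\<rangle>"] pred_All[OF c] a m by simp
qed

lemma is_min_bm:
  assumes a: "hom a X A" and n: "hom n X Nat" and t: "\<guillemotleft>\<phi>\<guillemotright> \<cdot> \<langle>a, n\<rangle> = tr X"
  shows "\<guillemotleft>is_min A \<phi>\<guillemotright> \<cdot> \<langle>a, bm \<cdot> \<langle>a, n\<rangle>\<rangle> = tr X"
proof -
  have "le (bm \<cdot> \<langle>a \<cdot> u, n \<cdot> u\<rangle>) m = tr Y"
    if "hom u Y X" "hom m Y Nat" "\<guillemotleft>\<phi>\<guillemotright> \<cdot> \<langle>a \<cdot> u, m\<rangle> = tr Y" for Y u m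
    by (rule bm_le) (use that a n in simp_all)
  then show ?thesis using is_min_iff[OF a, of "bm \<cdot> \<langle>a, n\<rangle>"] phi_bm[OF a n t] a n by simp
qed

lemma is_min_unique:
  assumes a: "hom a X A" and m: "hom m X Nat" and n: "hom n X Nat"
    and "\<guillemotleft>is_min A \<phi>\<guillemotright> \<cdot> \<langle>a, m\<rangle> = tr X" "\<guillemotleft>is_min A \<phi>\<guillemotright> \<cdot> \<langle>a, n\<rangle> = tr X"
  shows "m = n"
proof -
  have X: "T \<turnstile>\<^sub>o X" using hom_ob a by blast
  have *: "le x y = tr X" if "hom x X Nat" "hom y X Nat" "\<guillemotleft>is_min A \<phi>\<guillemotright> \<cdot> \<langle>a, x\<rangle> = tr X"
    "\<guillemotleft>is_min A \<phi>\<guillemotright> \<cdot> \<langle>a, y\<rangle> = tr X" for x y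
  proof -
    have "le (x \<cdot> \<guillemotleft>Id X\<guillemotright>) y = tr X"
    proof (rule iffD1[OF is_min_iff[OF a that(1)] that(3), THEN conjunct2, rule_format])
      show "\<guillemotleft>\<phi>\<guillemotright> \<cdot> \<langle>a \<cdot> \<guillemotleft>Id X\<guillemotright>, y\<rangle> = tr X"
        using iffD1[OF is_min_iff[OF a that(2)] that(4)] a by simp
    qed (use X that in simp_all)
    then show ?thesis using that by simp
  qed
  show ?thesis by (rule le_antisym) (use assms * in blast)+
qed

text \<open>
  The data of the quantified \<open>\<mu>\<close>-operator: its domain of definition \<open>D\<close> with inclusion \<open>\<iota>\<close>, the graph
  \<open>\<delta>\<close> from which its rule is described, and that rule \<open>r\<close>.
\<close>

abbreviation \<epsilon> where "\<epsilon> \<equiv> Ex A Nat \<phi>"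
abbreviation D where "D \<equiv> Sub A \<epsilon>"
abbreviation \<delta> where "\<delta> \<equiv> is_min A \<phi> \<odot> cross D Nat (Incl A \<epsilon>) (Id Nat)"
abbreviation \<iota> where "\<iota> \<equiv> \<guillemotleft>Incl A \<epsilon>\<guillemotright>"
abbreviation r where "r \<equiv> \<guillemotleft>Desc D Nat \<delta>\<guillemotright>"

lemma prd_\<epsilon>: "T \<turnstile> \<epsilon> \<Colon> A \<rightarrow> \<two>"
  unfolding prd_iff using pred_Ex[OF prd_phi] by simp

lemma hom_\<iota> [simp]: "wt \<iota>" "src \<iota> = D" "tgt \<iota> = A"
  using hom_Incl[OF prd_\<epsilon>] by simp_all

lemma ob_D [simp]: "T \<turnstile>\<^sub>o D"
  using hom_ob(1)[of \<iota> D A] by simp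

lemma pred_is_min: "pred \<guillemotleft>is_min A \<phi>\<guillemotright> (A \<^bold>\<times> Nat)"
  using prd_is_min prd_iff by blast

lemma prd_\<delta>: "T \<turnstile> \<delta> \<Colon> D \<^bold>\<times> Nat \<rightarrow> \<two>"
  unfolding prd_iff using pred_is_min by simp

lemma \<delta>_eq: "hom x X D \<Longrightarrow> hom m X Nat \<Longrightarrow> \<guillemotleft>\<delta>\<guillemotright> \<cdot> \<langle>x, m\<rangle> = \<guillemotleft>is_min A \<phi>\<guillemotright> \<cdot> \<langle>\<iota> \<cdot> x, m\<rangle>"
  using pred_is_min by simp

text \<open>
  Unique existence is a predicate on \<open>{a | \<exists>n \<phi>(a,n)}\<close>.  For its proof a witness \<open>n\<close> may therefore be
  assumed, and bounded search up to \<open>n\<close> provides the least element.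
\<close>

lemma Ex1_min: "\<guillemotleft>Ex1 D Nat \<delta>\<guillemotright> = tr D"
proof (rule Ex_E[OF prd_phi, where x = \<iota> and X = D and C = Nat])
  show "hom \<iota> D A" "hom \<guillemotleft>Ex1 D Nat \<delta>\<guillemotright> D Nat" "hom (tr D) D Nat"
    using hom_Ex1[OF prd_\<delta>] by simp_all
  show "\<guillemotleft>\<epsilon>\<guillemotright> \<cdot> \<iota> = tr D" by (rule Incl_true[OF prd_\<epsilon>])
  fix Y u n assume u: "hom u Y D" and n: "hom n Y Nat" and t: "\<guillemotleft>\<phi>\<guillemotright> \<cdot> \<langle>\<iota> \<cdot> u, n\<rangle> = tr Y"
  have "\<guillemotleft>Ex1 D Nat \<delta>\<guillemotright> \<cdot> u = tr Y"
  proof (rule Ex1_I[OF prd_\<delta> u, where m = "bm \<cdot> \<langle>\<iota> \<cdot> u, n\<rangle>"])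
    show "hom (bm \<cdot> \<langle>\<iota> \<cdot> u, n\<rangle>) Y Nat" using u n by simp
    then show "\<guillemotleft>\<delta>\<guillemotright> \<cdot> \<langle>u, bm \<cdot> \<langle>\<iota> \<cdot> u, n\<rangle>\<rangle> = tr Y"
      unfolding \<delta>_eq[OF u \<open>hom (bm \<cdot> \<langle>\<iota> \<cdot> u, n\<rangle>) Y Nat\<close>] by (intro is_min_bm) (use u n t in simp_all)
    fix Z v b assume v: "hom v Z Y" and b: "hom b Z Nat" and d: "\<guillemotleft>\<delta>\<guillemotright> \<cdot> \<langle>u \<cdot> v, b\<rangle> = tr Z"
    have uv: "hom (u \<cdot> v) Z D" using u v by simp
    show "b = (bm \<cdot> \<langle>\<iota> \<cdot> u, n\<rangle>) \<cdot> v"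
    proof (rule is_min_unique)
      show "\<guillemotleft>is_min A \<phi>\<guillemotright> \<cdot> \<langle>\<iota> \<cdot> u \<cdot> v, b\<rangle> = tr Z" using d[unfolded \<delta>_eq[OF uv b]] .
      have "\<guillemotleft>is_min A \<phi>\<guillemotright> \<cdot> \<langle>\<iota> \<cdot> u \<cdot> v, bm \<cdot> \<langle>\<iota> \<cdot> u \<cdot> v, n \<cdot> v\<rangle>\<rangle> = tr Z"
        by (rule is_min_bm) (use arg_cong[OF t, of "\<lambda>z. z \<cdot> v"] u v n hom_ob[of u Y D] in simp_all)
      then show "\<guillemotleft>is_min A \<phi>\<guillemotright> \<cdot> \<langle>\<iota> \<cdot> u \<cdot> v, (bm \<cdot> \<langle>\<iota> \<cdot> u, n\<rangle>) \<cdot> v\<rangle> = tr Z" using u v n by simp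
    qed (use u v n b in simp_all)
  qed
  then show "\<guillemotleft>Ex1 D Nat \<delta>\<guillemotright> \<cdot> u = tr D \<cdot> u" using u by simp
qed

lemma arr_r: "T \<turnstile> Desc D Nat \<delta> \<Colon> D \<rightarrow> Nat"
  by (rule arr_Desc[OF not_PRa prd_\<delta> iffD1[OF true_cls_iff[OF hom_Ex1[OF prd_\<delta>]] Ex1_min]])

lemma hom_r [simp]: "wt r" "src r = D" "tgt r = Nat"
  using hom_cls[OF arr_r] by simp_all

text \<open>
  The graph of the described map is \<open>\<delta>\<close>, and every value is equal to itself.
\<close>

lemma is_min_r:
  assumes d: "hom d X D" shows "\<guillemotleft>is_min A \<phi>\<guillemotright> \<cdot> \<langle>\<iota> \<cdot> d, r \<cdot> d\<rangle> = tr X"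
proof -
  have rd: "hom (r \<cdot> d) X Nat" using d by simp
  have "hom \<guillemotleft>eqp Nat \<odot> cross D Nat (Desc D Nat \<delta>) (Id Nat)\<guillemotright> (D \<^bold>\<times> Nat) Nat" by simp
  then have "T \<turnstile> eqp Nat \<odot> cross D Nat (Desc D Nat \<delta>) (Id Nat) \<Colon> D \<^bold>\<times> Nat \<rightarrow> Nat"
    using hom_cls_iff by blast
  from cls_eqI[OF this _ eq_Desc[OF arr_r]] prd_\<delta>
  have "eqe Nat (r \<cdot> \<guillemotleft>Fst D Nat\<guillemotright>) \<guillemotleft>Snd D Nat\<guillemotright> = \<guillemotleft>\<delta>\<guillemotright>" by (auto elim!: prdE)
  from arg_cong[OF this, of "\<lambda>z. z \<cdot> \<langle>d, r \<cdot> d\<rangle>"]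
  have "\<guillemotleft>\<delta>\<guillemotright> \<cdot> \<langle>d, r \<cdot> d\<rangle> = tr X" using d by simp
  then show ?thesis unfolding \<delta>_eq[OF d rd] .
qed

text \<open>
  The domain of definition of the primitive recursive \<open>\<mu>\<close>-operator, and its inclusion.
\<close>

abbreviation D' where "D' \<equiv> Sub (A \<^bold>\<times> Nat) \<phi>"
abbreviation \<iota>' where "\<iota>' \<equiv> \<guillemotleft>Incl (A \<^bold>\<times> Nat) \<phi>\<guillemotright>"

lemma hom_\<iota>' [simp]: "wt \<iota>'" "src \<iota>' = D'" "tgt \<iota>' = A \<^bold>\<times> Nat"
  using hom_Incl[OF prd_phi] by simp_all

lemma ob_D' [simp]: "T \<turnstile>\<^sub>o D'"
  using hom_ob(1)[of \<iota>' D' "A \<^bold>\<times> Nat"] by simp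

lemma is_min_rule:
  assumes d: "hom d X D'"
  shows "\<guillemotleft>is_min A \<phi>\<guillemotright> \<cdot> \<langle>\<guillemotleft>Fst A Nat\<guillemotright> \<cdot> \<iota>' \<cdot> d, bm \<cdot> \<iota>' \<cdot> d\<rangle> = tr X"
proof -
  let ?a = "\<guillemotleft>Fst A Nat\<guillemotright> \<cdot> \<iota>' \<cdot> d" let ?n = "\<guillemotleft>Snd A Nat\<guillemotright> \<cdot> \<iota>' \<cdot> d"
  have e: "\<langle>?a, ?n\<rangle> = \<iota>' \<cdot> d" using d by (intro pair_eta) simp_all
  have "\<guillemotleft>\<phi>\<guillemotright> \<cdot> \<iota>' \<cdot> d = tr X" using arg_cong[OF Incl_true[OF prd_phi], of "\<lambda>z. z \<cdot> d"] d by simp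
  then have "\<guillemotleft>\<phi>\<guillemotright> \<cdot> \<langle>?a, ?n\<rangle> = tr X" unfolding e .
  from is_min_bm[OF _ _ this] show ?thesis unfolding e using d by simp
qed

theorem mu_eq: "T \<turnstile> mu_PRa A \<phi> \<wedgeq> mu_Q A \<phi> \<Colon> A \<rightharpoonup> Nat"
proof -
  let ?F = "mu_PRa A \<phi>" and ?G = "mu_Q A \<phi>"
  have F: "dom_ob ?F = D'" "dom_map ?F = Fst A Nat \<odot> Incl (A \<^bold>\<times> Nat) \<phi>"
    "rule_map ?F = bounded_min A \<phi> \<odot> Incl (A \<^bold>\<times> Nat) \<phi>"
    by (simp_all add: mu_PRa_def)
  have G: "dom_ob ?G = D" "dom_map ?G = Incl A \<epsilon>" "rule_map ?G = Desc D Nat \<delta>"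
    by (simp_all add: mu_Q_def Let_def)
  have pF: "T \<turnstile> ?F \<Colon> A \<rightharpoonup> Nat"
  proof (rule partial_mapI, unfold F)
    fix Y x y assume x: "hom x Y D'" and y: "hom y Y D'"
      and "\<guillemotleft>Fst A Nat \<odot> Incl (A \<^bold>\<times> Nat) \<phi>\<guillemotright> \<cdot> x = \<guillemotleft>Fst A Nat \<odot> Incl (A \<^bold>\<times> Nat) \<phi>\<guillemotright> \<cdot> y"
    then have e: "\<guillemotleft>Fst A Nat\<guillemotright> \<cdot> \<iota>' \<cdot> x = \<guillemotleft>Fst A Nat\<guillemotright> \<cdot> \<iota>' \<cdot> y" by simp
    have "bm \<cdot> \<iota>' \<cdot> x = bm \<cdot> \<iota>' \<cdot> y"
      by (rule is_min_unique[OF _ _ _ is_min_rule[OF x] is_min_rule[OF y, folded e]]) (use x y in simp_all)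
    then show "\<guillemotleft>bounded_min A \<phi> \<odot> Incl (A \<^bold>\<times> Nat) \<phi>\<guillemotright> \<cdot> x = \<guillemotleft>bounded_min A \<phi> \<odot> Incl (A \<^bold>\<times> Nat) \<phi>\<guillemotright> \<cdot> y" by simp
  qed simp_all
  have pG: "T \<turnstile> ?G \<Colon> A \<rightharpoonup> Nat"
  proof (rule partial_mapI, unfold G)
    fix Y x y assume "hom x Y D" "hom y Y D" "\<iota> \<cdot> x = \<iota> \<cdot> y"
    then show "r \<cdot> x = r \<cdot> y" using Incl_cancel[OF prd_\<epsilon>, of x Y y] by simp
  qed simp_all
  have a: "hom (\<guillemotleft>Fst A Nat\<guillemotright> \<cdot> \<iota>') D' A" by simp
  have "\<guillemotleft>\<epsilon>\<guillemotright> \<cdot> \<guillemotleft>Fst A Nat\<guillemotright> \<cdot> \<iota>' = tr D'"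
  proof (rule Ex_I[OF prd_phi a])
    show "hom (\<guillemotleft>Snd A Nat\<guillemotright> \<cdot> \<iota>') D' Nat" by simp
    have "\<langle>\<guillemotleft>Fst A Nat\<guillemotright> \<cdot> \<iota>', \<guillemotleft>Snd A Nat\<guillemotright> \<cdot> \<iota>'\<rangle> = \<iota>'" by (rule pair_eta) simp_all
    then show "\<guillemotleft>\<phi>\<guillemotright> \<cdot> \<langle>\<guillemotleft>Fst A Nat\<guillemotright> \<cdot> \<iota>', \<guillemotleft>Snd A Nat\<guillemotright> \<cdot> \<iota>'\<rangle> = tr D'"
      using Incl_true[OF prd_phi] by simp
  qed
  from Lift_exists[OF prd_\<epsilon> a this] obtain i where i: "hom i D' D" "\<iota> \<cdot> i = \<guillemotleft>Fst A Nat\<guillemotright> \<cdot> \<iota>'" .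
  have ri: "r \<cdot> i = bm \<cdot> \<iota>'"
  proof (rule is_min_unique[OF a])
    show "\<guillemotleft>is_min A \<phi>\<guillemotright> \<cdot> \<langle>\<guillemotleft>Fst A Nat\<guillemotright> \<cdot> \<iota>', r \<cdot> i\<rangle> = tr D'" using is_min_r[OF i(1)] i(2) by simp
    show "\<guillemotleft>is_min A \<phi>\<guillemotright> \<cdot> \<langle>\<guillemotleft>Fst A Nat\<guillemotright> \<cdot> \<iota>', bm \<cdot> \<iota>'\<rangle> = tr D'"
      using is_min_rule[of "\<guillemotleft>Id D'\<guillemotright>" D'] by simp
  qed (use i in simp_all)
  have m: "\<guillemotleft>is_min A \<phi>\<guillemotright> \<cdot> \<langle>\<iota>, r\<rangle> = tr D" using is_min_r[of "\<guillemotleft>Id D\<guillemotright>" D] by simp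
  then have "\<guillemotleft>\<phi>\<guillemotright> \<cdot> \<langle>\<iota>, r\<rangle> = tr D" using is_min_iff[of \<iota> D r] by simp
  from Lift_exists[OF prd_phi _ this] obtain j where j: "hom j D D'" "\<iota>' \<cdot> j = \<langle>\<iota>, r\<rangle>" by auto
  have rj: "bm \<cdot> \<iota>' \<cdot> j = r"
  proof (rule is_min_unique[OF _ _ _ _ m])
    show "\<guillemotleft>is_min A \<phi>\<guillemotright> \<cdot> \<langle>\<iota>, bm \<cdot> \<iota>' \<cdot> j\<rangle> = tr D" using is_min_rule[OF j(1)] j(2) by simp
  qed (use j in simp_all)
  obtain ti tj where t: "T \<turnstile> ti \<Colon> D' \<rightarrow> D" "i = \<guillemotleft>ti\<guillemotright>" "T \<turnstile> tj \<Colon> D \<rightarrow> D'" "j = \<guillemotleft>tj\<guillemotright>"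
    by (rule homE[OF i(1)], rule homE[OF j(1)]) blast
  have "T \<turnstile> Incl A \<epsilon> \<odot> ti \<approx> Fst A Nat \<odot> Incl (A \<^bold>\<times> Nat) \<phi> \<Colon> D' \<rightarrow> A"
    by (rule eqvI) (use i t in simp_all)
  moreover have "T \<turnstile> Desc D Nat \<delta> \<odot> ti \<approx> bounded_min A \<phi> \<odot> Incl (A \<^bold>\<times> Nat) \<phi> \<Colon> D' \<rightarrow> Nat"
    by (rule eqvI) (use i ri t in simp_all)
  moreover have "T \<turnstile> (Fst A Nat \<odot> Incl (A \<^bold>\<times> Nat) \<phi>) \<odot> tj \<approx> Incl A \<epsilon> \<Colon> D \<rightarrow> A"
    by (rule eqvI) (use j t in simp_all)
  moreover have "T \<turnstile> (bounded_min A \<phi> \<odot> Incl (A \<^bold>\<times> Nat) \<phi>) \<odot> tj \<approx> Desc D Nat \<delta> \<Colon> D \<rightarrow> Nat"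
    by (rule eqvI) (use j rj t in simp_all)
  ultimately show ?thesis unfolding partial_eq_def F G using pF pG t(1,3) by blast
qed

end

theorem mainTheorem2:
  fixes A :: obj and \<phi> :: trm
  assumes "PRa \<turnstile>\<^sub>o A"
    and "PRa \<turnstile> \<phi> \<Colon> A \<^bold>\<times> Nat \<rightarrow> \<two>"
  shows "(Q \<turnstile> mu_PRa A \<phi> \<wedgeq> mu_Q A \<phi> \<Colon> A \<rightharpoonup> Nat) \<and>
         (Qwo \<turnstile> mu_PRa A \<phi> \<wedgeq> mu_Q A \<phi> \<Colon> A \<rightharpoonup> Nat)"
proof -
  have "T \<turnstile> mu_PRa A \<phi> \<wedgeq> mu_Q A \<phi> \<Colon> A \<rightharpoonup> Nat" if "T \<noteq> PRa" for T
  proof -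
    interpret minimization T A \<phi>
      by unfold_locales (use that PRa_mono_prd[OF that assms(2)] in auto)
    show ?thesis by (rule mu_eq)
  qed
  then show ?thesis by simp
qed

end
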